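(* Let $(\xi_k)_{k\in\mathbb Z}$ be a strictly stationary Markov chain with values in a measurable space $(S,\mathcal B(S))$, with marginal law $\pi$ and regular transition probability $Q(x,A)=P(\xi_k\in A\mid\xi_{k-1}=x)$. Assume that there are constants $a>0$, $b<\infty$ and a set $S'\in\mathcal B(S)$ with $\pi(S')=1$ such that $$a\,\pi(A)\le Q(x,A)\le b\,\pi(A)\quad\text{for all }A\in\mathcal B(S)\text{ and }x\in S'.$$ Let $g:S\to\mathbb R$ be measurable, $X_k=g(\xi_k)$ for $k\in\mathbb Z$, and $S_n=\sum_{k=1}^nX_k$. Assume that $E(X_0)=0$, that $H(x)=E\big(X_0^2I(|X_0|\le x)\big)$ is a slowly varying function as $x\to\infty$, and that $X_0$ has a non-lattice distribution. Then there is a sequence $b_n\to\infty$ such that for every continuous function $h:\mathbb R\to\mathbb R$ with compact support, $$\lim_{n\to\infty}\sup_{u\in\mathbb R}\Big|\sqrt{2\pi}\,b_n\,E\big[h(S_n-u)\big]-\exp\Big(-\frac{u^2}{2b_n^2}\Big)\int_{\mathbb R}h\,d\lambda\Big|=0,$$ where $\lambda$ is Lebesgue measure.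
   Context: A real random variable $X$ has a non-lattice distribution if there are no $v>0$ and $c\in\mathbb R$ such that $X$ takes values almost surely in $\{c+kv:k\in\mathbb Z\}$; equivalently, $|E(\exp(itX))|<1$ for all $t\ne0$. The variance of $X_0$ is allowed to be infinite. $I(\cdot)$ denotes the indicator of an event. *)

theory Defs
  imports "HOL-Probability.Probability"
begin

definition slowly_varying :: "(real \<Rightarrow> real) \<Rightarrow> bool" where
  "slowly_varying L \<longleftrightarrow>
     (\<exists>x0. L \<in> borel_measurable (restrict_space borel {x0..}) \<and> (\<forall>x\<ge>x0. 0 < L x)) \<and>
     (\<forall>t>0. ((\<lambda>x. L (t * x) / L x) \<longlongrightarrow> 1) at_top)"

context prob_space
begin

definition strictly_stationary :: "'s measure \<Rightarrow> (int \<Rightarrow> 'a \<Rightarrow> 's) \<Rightarrow> bool" where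
  "strictly_stationary S \<xi> \<longleftrightarrow>
     (\<forall>k. \<xi> k \<in> M \<rightarrow>\<^sub>M S) \<and>
     (\<forall>m. distr M (\<Pi>\<^sub>M k\<in>UNIV. S) (\<lambda>\<omega> k. \<xi> (k + m) \<omega>) =
          distr M (\<Pi>\<^sub>M k\<in>UNIV. S) (\<lambda>\<omega> k. \<xi> k \<omega>))"

definition past :: "'s measure \<Rightarrow> (int \<Rightarrow> 'a \<Rightarrow> 's) \<Rightarrow> int \<Rightarrow> 'a measure" where
  "past S \<xi> k = sigma (space M) {\<xi> j -` A \<inter> space M | j A. j \<le> k \<and> A \<in> sets S}"

text \<open>Membership of \<open>Q\<close> in \<open>S \<rightarrow>\<^sub>M prob_algebra S\<close> says that \<open>Q x\<close> is a probability
  measure on \<open>S\<close> for every \<open>x\<close> and that \<open>x \<mapsto> Q x A\<close> is measurable for every measurable \<open>A\<close>.\<close>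

definition markov_chain_with ::
    "'s measure \<Rightarrow> ('s \<Rightarrow> 's measure) \<Rightarrow> (int \<Rightarrow> 'a \<Rightarrow> 's) \<Rightarrow> bool" where
  "markov_chain_with S Q \<xi> \<longleftrightarrow>
     Q \<in> S \<rightarrow>\<^sub>M prob_algebra S \<and>
     (\<forall>k. \<xi> k \<in> M \<rightarrow>\<^sub>M S) \<and>
     (\<forall>k. \<forall>A\<in>sets S. AE \<omega> in M.
        real_cond_exp M (past S \<xi> (k - 1)) (indicator (\<xi> k -` A \<inter> space M)) \<omega> =
        measure (Q (\<xi> (k - 1) \<omega>)) A)"

definition non_lattice :: "('a \<Rightarrow> real) \<Rightarrow> bool" where
  "non_lattice X \<longleftrightarrow>
     \<not> (\<exists>v>0. \<exists>c. AE \<omega> in M. X \<omega> \<in> {c + of_int k * v | k :: int. True})"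

end

end

theory Submission
  imports Defs
begin

text \<open>Write \<open>K\<close> for the transition operator and \<open>P\<^sub>t F = K (exp (i t g) F)\<close>, so that the characteristic
  function of the sum is the \<open>\<pi>\<close>-mean of \<open>P\<^sub>t\<^sup>n 1\<close>.  Since \<open>K - a \<pi>\<close> is a positive kernel of mass \<open>1 - a\<close>, two steps
  of \<open>P\<^sub>t\<close> have norm at most \<open>1 - a\<^sup>2 (1 - |\<phi> t|)\<close>, where \<open>\<phi>\<close> is the characteristic function of one summand; this
  yields the domination near \<open>0\<close> and the exponential decay away from \<open>0\<close>.  For the limit near \<open>0\<close>
  no spectral theory is needed: solving two Poisson equations gives a function that is an eigenfunction of \<open>P\<^sub>t\<close> up to an error
  of order \<open>|t|\<^sup>3 + |t| |1 - \<phi> t|\<close>, with eigenvalue \<open>\<phi> t - \<kappa> t\<^sup>2 + o(t\<^sup>2)\<close>, where \<open>\<kappa>\<close> is the sum of the covariances;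
  \<open>\<kappa>\<close> is finite even if the variance is not, because the pair laws are bounded by \<open>b \<pi> \<otimes> \<pi>\<close>.  The two-step bound also
  shows that \<open>H(x) + 2 \<kappa>\<close> is at least a positive multiple of \<open>H(x)\<close>, and \<open>b\<^sub>n\<close> solves \<open>n (H(b\<^sub>n) + 2 \<kappa>) = b\<^sub>n\<^sup>2\<close>.
  Fourier inversion for Fejer kernels then gives the local limit theorem for these, uniformly in the shift,
  and a continuous compactly supported \<open>h\<close> is approximated by its Fejer means.\<close>

subsection \<open>Two-sided bounded kernels and the Poisson equation\<close>

text \<open>A second-order perturbation of an operator normally uses two moments of
  \<open>g\<close>, and here only one is available. The way out: \<open>e t - 1\<close> is of order
  \<open>t\<close> in L1, and the upper density bound lets \<open>K\<close> map L1 into bounded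
  functions. The dependence correction to \<open>\<phi>\<close> is then the integral of a product in
  which one factor is differentiated once in L1 and the other, a Poisson solution, once in sup norm.
  All infinite-variance behaviour stays inside \<open>\<phi>\<close>, which concerns a single
  summand. Contraction needs two steps because one step can be neutralised: \<open>P t\<close> maps
  the conjugate of \<open>e t\<close> to \<open>1\<close>. A cancellation of the quadratic term has
  to be excluded as well: for finite variance \<open>\<kappa>\<close> may be negative and comparable
  to \<open>H\<close>. The contraction is therefore applied to the approximate eigenfunction itself,
  which bounds the modulus of the eigenvalue from above. At \<open>t = s / bn n\<close> the quantity
  \<open>n * t\<^sup>2 * H (1 / |t|)\<close> stays bounded, so an error per step that is smaller by
  a factor \<open>|t|\<close> vanishes even after n steps; this sets the accuracy required of the
  eigenfunction.\<close>

locale bounded_kernel = prob_space \<pi> for \<pi> :: "'s measure" +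
  fixes Q :: "'s \<Rightarrow> 's measure" and a b :: real
  assumes kernel: "Q \<in> \<pi> \<rightarrow>\<^sub>M prob_algebra \<pi>"
    and a_pos: "0 < a"
    and lower: "\<And>x A. x \<in> space \<pi> \<Longrightarrow> A \<in> sets \<pi> \<Longrightarrow> a * measure \<pi> A \<le> measure (Q x) A"
    and upper: "\<And>x A. x \<in> space \<pi> \<Longrightarrow> A \<in> sets \<pi> \<Longrightarrow> measure (Q x) A \<le> b * measure \<pi> A"
    and invariant: "\<pi> \<bind> Q = \<pi>"
begin

definition K :: "('s \<Rightarrow> complex) \<Rightarrow> 's \<Rightarrow> complex" where
  "K F x = (LINT y|Q x. F y)"

text \<open>A pointwise bound rather than an almost sure one: no null sets accumulate along iterates
  of \<open>K\<close>, and the explicit constant lets powers of \<open>t\<close> be tracked.\<close>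

definition bnd :: "real \<Rightarrow> ('s \<Rightarrow> complex) \<Rightarrow> bool" where
  "bnd C F \<longleftrightarrow> F \<in> borel_measurable \<pi> \<and> (\<forall>x\<in>space \<pi>. norm (F x) \<le> C)"

lemma kernel_prob:
  assumes "x \<in> space \<pi>"
  shows "prob_space (Q x)" "sets (Q x) = sets \<pi>" "space (Q x) = space \<pi>"
  using measurable_space[OF kernel assms] by (auto simp: space_prob_algebra dest: sets_eq_imp_space_eq)

lemma kernel_subprob [measurable]: "Q \<in> \<pi> \<rightarrow>\<^sub>M subprob_algebra \<pi>"
  using kernel by (rule measurable_prob_algebraD)

lemma a_le_1: "a \<le> 1"
proof -
  obtain x where x: "x \<in> space \<pi>" using not_empty by auto
  interpret Qx: prob_space "Q x" using kernel_prob[OF x] by auto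
  show ?thesis using lower[OF x sets.top] Qx.prob_space kernel_prob[OF x] prob_space by auto
qed

lemma b_ge_1: "1 \<le> b"
proof -
  obtain x where x: "x \<in> space \<pi>" using not_empty by auto
  interpret Qx: prob_space "Q x" using kernel_prob[OF x] by auto
  show ?thesis using upper[OF x sets.top] Qx.prob_space kernel_prob[OF x] prob_space by auto
qed

lemma scale_le_kernel:
  assumes x: "x \<in> space \<pi>"
  shows "scale_measure (ennreal a) \<pi> \<le> Q x"
proof -
  interpret Qx: prob_space "Q x" using kernel_prob[OF x] by auto
  show ?thesis
    using lower[OF x] a_pos kernel_prob[OF x]
    by (subst le_measure) (auto simp: emeasure_eq_measure Qx.emeasure_eq_measure ennreal_mult[symmetric])
qed

lemma kernel_le_scale:
  assumes x: "x \<in> space \<pi>"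
  shows "Q x \<le> scale_measure (ennreal b) \<pi>"
proof -
  interpret Qx: prob_space "Q x" using kernel_prob[OF x] by auto
  show ?thesis
    using upper[OF x] b_ge_1 kernel_prob[OF x]
    by (subst le_measure) (auto simp: emeasure_eq_measure Qx.emeasure_eq_measure ennreal_mult[symmetric])
qed

lemma nn_kernel_upper:
  assumes x: "x \<in> space \<pi>" and f: "f \<in> borel_measurable \<pi>"
  shows "(\<integral>\<^sup>+y. f y \<partial>Q x) \<le> ennreal b * (\<integral>\<^sup>+y. f y \<partial>\<pi>)"
  using nn_integral_mono_measure[OF _ kernel_le_scale[OF x], of f] kernel_prob[OF x] f
  by (simp add: nn_integral_scale_measure)

lemma nn_kernel_lower:
  assumes x: "x \<in> space \<pi>" and f: "f \<in> borel_measurable \<pi>"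
  shows "ennreal a * (\<integral>\<^sup>+y. f y \<partial>\<pi>) \<le> (\<integral>\<^sup>+y. f y \<partial>Q x)"
  using nn_integral_mono_measure[OF _ scale_le_kernel[OF x], of f] kernel_prob[OF x] f
  by (simp add: nn_integral_scale_measure)

lemma integrable_kernel:
  fixes F :: "'s \<Rightarrow> 'c::{banach, second_countable_topology}"
  assumes x: "x \<in> space \<pi>" and F: "integrable \<pi> F"
  shows "integrable (Q x) F"
proof (rule integrableI_bounded)
  show "F \<in> borel_measurable (Q x)" using F kernel_prob[OF x] by (simp cong: measurable_cong_sets)
  have "(\<integral>\<^sup>+y. norm (F y) \<partial>Q x) \<le> ennreal b * (\<integral>\<^sup>+y. norm (F y) \<partial>\<pi>)"
    using F by (intro nn_kernel_upper[OF x]) auto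
  also have "\<dots> < \<infinity>" using F by (auto simp: integrable_iff_bounded ennreal_mult_less_top)
  finally show "(\<integral>\<^sup>+y. norm (F y) \<partial>Q x) < \<infinity>" .
qed

lemma integral_kernel_upper:
  fixes f :: "'s \<Rightarrow> real"
  assumes x: "x \<in> space \<pi>" and F: "integrable \<pi> f" and nn: "\<And>y. 0 \<le> f y"
  shows "(LINT y|Q x. f y) \<le> b * (LINT y|\<pi>. f y)"
proof -
  have "ennreal (LINT y|Q x. f y) \<le> ennreal b * ennreal (LINT y|\<pi>. f y)"
    using nn_kernel_upper[OF x, of f] integrable_kernel[OF x F] F nn
    by (simp add: nn_integral_eq_integral)
  then show ?thesis using b_ge_1 nn by (simp add: ennreal_mult[symmetric] integral_nonneg)
qed

lemma integral_kernel_lower: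
  fixes f :: "'s \<Rightarrow> real"
  assumes x: "x \<in> space \<pi>" and F: "integrable \<pi> f" and nn: "\<And>y. y \<in> space \<pi> \<Longrightarrow> 0 \<le> f y"
  shows "a * (LINT y|\<pi>. f y) \<le> (LINT y|Q x. f y)"
proof -
  have "AE y in Q x. 0 \<le> f y" using nn kernel_prob[OF x] by (intro AE_I2) auto
  then have "ennreal a * ennreal (LINT y|\<pi>. f y) \<le> ennreal (LINT y|Q x. f y)"
    using nn_kernel_lower[OF x, of f] nn kernel_prob[OF x]
      nn_integral_eq_integral[OF F] nn_integral_eq_integral[OF integrable_kernel[OF x F]]
    by (simp add: F borel_measurable_integrable)
  moreover have "0 \<le> (LINT y|\<pi>. f y)" "0 \<le> (LINT y|Q x. f y)"
    using nn kernel_prob[OF x] by (auto intro!: integral_nonneg_AE AE_I2)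
  ultimately show ?thesis using a_pos by (simp add: ennreal_mult[symmetric])
qed

text \<open>The smoothing effect of the upper density bound: an L1 estimate becomes a sup estimate
  at the cost of the factor \<open>b\<close>. This is how the unbounded \<open>g\<close> is handled
  by its first absolute moment alone.\<close>

lemma norm_K_le:
  assumes x: "x \<in> space \<pi>" and F: "integrable \<pi> F"
  shows "norm (K F x) \<le> b * (LINT y|\<pi>. norm (F y))"
proof -
  have "norm (K F x) \<le> (LINT y|Q x. norm (F y))" unfolding K_def by (rule integral_norm_bound)
  also have "\<dots> \<le> b * (LINT y|\<pi>. norm (F y))" using F by (intro integral_kernel_upper[OF x]) auto
  finally show ?thesis .
qed

lemma bnd_nonneg: "bnd C F \<Longrightarrow> 0 \<le> C"
  using not_empty unfolding bnd_def by (meson norm_ge_zero order_trans ex_in_conv)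

lemma bnd_integrable: "bnd C F \<Longrightarrow> integrable \<pi> F"
  unfolding bnd_def by (intro integrable_const_bound[of _ C]) (auto intro: AE_I2)

lemma bnd_mult: "bnd C F \<Longrightarrow> bnd D G \<Longrightarrow> bnd (C * D) (\<lambda>x. F x * G x)"
  using bnd_nonneg[of C F] unfolding bnd_def by (auto simp: norm_mult intro!: mult_mono)

lemma bnd_add: "bnd C F \<Longrightarrow> bnd D G \<Longrightarrow> bnd (C + D) (\<lambda>x. F x + G x)"
  unfolding bnd_def by (auto intro!: norm_triangle_le add_mono)

lemma bnd_diff: "bnd C F \<Longrightarrow> bnd D G \<Longrightarrow> bnd (C + D) (\<lambda>x. F x - G x)"
  unfolding bnd_def by (auto intro!: norm_triangle_le_diff add_mono)

lemma bnd_const: "bnd (norm c) (\<lambda>x. c)"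
  unfolding bnd_def by auto

lemma bnd_mono: "bnd C F \<Longrightarrow> C \<le> D \<Longrightarrow> bnd D F"
  unfolding bnd_def by force

lemma measurable_K [measurable]: "F \<in> borel_measurable \<pi> \<Longrightarrow> K F \<in> borel_measurable \<pi>"
  unfolding K_def using measurable_compose[OF kernel_subprob integral_measurable_subprob_algebra] by simp

lemma bnd_K_integrable:
  assumes "integrable \<pi> F" shows "bnd (b * (LINT y|\<pi>. norm (F y))) (K F)"
  using assms norm_K_le unfolding bnd_def by auto

lemma K_add: "x \<in> space \<pi> \<Longrightarrow> integrable \<pi> F \<Longrightarrow> integrable \<pi> G \<Longrightarrow> K (\<lambda>y. F y + G y) x = K F x + K G x"
  unfolding K_def by (intro Bochner_Integration.integral_add integrable_kernel)

lemma K_diff: "x \<in> space \<pi> \<Longrightarrow> integrable \<pi> F \<Longrightarrow> integrable \<pi> G \<Longrightarrow> K (\<lambda>y. F y - G y) x = K F x - K G x"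
  unfolding K_def by (intro Bochner_Integration.integral_diff integrable_kernel)

lemma K_cmult: "K (\<lambda>y. c * F y) x = c * K F x"
  unfolding K_def by simp

lemma K_const: "x \<in> space \<pi> \<Longrightarrow> K (\<lambda>y. c) x = c"
  unfolding K_def using kernel_prob(1)[of x] by (simp add: prob_space.prob_space)

lemma K_cong: "x \<in> space \<pi> \<Longrightarrow> (\<And>y. y \<in> space \<pi> \<Longrightarrow> F y = G y) \<Longrightarrow> K F x = K G x"
  unfolding K_def using kernel_prob[of x] by (intro Bochner_Integration.integral_cong) auto

text \<open>Positivity speaks of real functions, so the complex value \<open>z\<close> to be bounded
  is tested in its own direction: \<open>r\<close> is the component of \<open>F\<close> along
  \<open>sgn z\<close>, it is at most \<open>C\<close>, and the lower bound of the kernel applies to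
  the nonnegative function \<open>C - r\<close>.\<close>

lemma K_minus_mean:
  assumes x: "x \<in> space \<pi>" and F: "bnd C F"
  shows "norm (K F x - complex_of_real a * (LINT y|\<pi>. F y)) \<le> (1 - a) * C"
proof -
  define z where "z = K F x - complex_of_real a * (LINT y|\<pi>. F y)"
  define r where "r = (\<lambda>y. sgn z \<bullet> F y)"
  have Fi: "integrable \<pi> F" using F by (rule bnd_integrable)
  have Fm[measurable]: "F \<in> borel_measurable \<pi>" using F by (simp add: bnd_def)
  have ri: "integrable \<pi> r" unfolding r_def using Fi by simp
  have rb: "r y \<le> C" if "y \<in> space \<pi>" for y
  proof -
    have "r y \<le> norm (sgn z) * norm (F y)" unfolding r_def by (rule norm_cauchy_schwarz)
    also have "\<dots> \<le> 1 * C" using F that by (intro mult_mono) (auto simp: bnd_def norm_sgn)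
    finally show ?thesis by simp
  qed
  interpret Qx: prob_space "Q x" using kernel_prob[OF x] by auto
  have rQ: "integrable (Q x) r" by (rule integrable_kernel[OF x ri])
  have "a * (LINT y|\<pi>. C - r y) \<le> (LINT y|Q x. C - r y)"
    using rb ri by (intro integral_kernel_lower[OF x]) auto
  then have *: "(LINT y|Q x. r y) - a * (LINT y|\<pi>. r y) \<le> (1 - a) * C"
    using ri rQ by (simp add: prob_space Qx.prob_space algebra_simps)
  have "(LINT y|Q x. r y) = sgn z \<bullet> K F x" "(LINT y|\<pi>. r y) = sgn z \<bullet> (LINT y|\<pi>. F y)"
    unfolding r_def K_def using integrable_kernel[OF x Fi] Fi by simp_all
  then have "(LINT y|Q x. r y) - a * (LINT y|\<pi>. r y) = sgn z \<bullet> z"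
    unfolding z_def by (simp add: inner_diff_right inner_scaleR_right[symmetric] scaleR_conv_of_real del: inner_scaleR_right)
  moreover have "sgn z \<bullet> z = norm z"
    by (cases "z = 0") (auto simp: sgn_div_norm dot_square_norm power2_eq_square)
  ultimately show ?thesis using * by (simp add: z_def)
qed

lemma K_mean_zero:
  assumes "bnd C F" "(LINT y|\<pi>. F y) = 0"
  shows "bnd ((1 - a) * C) (K F)"
  using K_minus_mean[OF _ assms(1)] assms unfolding bnd_def by auto

lemma bnd_K: assumes "bnd C F" shows "bnd C (K F)"
proof -
  have "norm (K F x) \<le> C" if x: "x \<in> space \<pi>" for x
  proof -
    interpret Qx: prob_space "Q x" using kernel_prob[OF x] by auto
    have "norm (K F x) \<le> (LINT y|Q x. norm (F y))" unfolding K_def by (rule integral_norm_bound)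
    also have "\<dots> \<le> (LINT y|Q x. C)"
      using assms kernel_prob[OF x] integrable_kernel[OF x bnd_integrable[OF assms]]
      by (intro integral_mono) (auto simp: bnd_def)
    finally show ?thesis by (simp add: Qx.prob_space)
  qed
  then show ?thesis using assms by (auto simp: bnd_def)
qed

lemma integral_K:
  assumes F: "bnd C F"
  shows "(LINT x|\<pi>. K F x) = (LINT x|\<pi>. F x)"
proof -
  have Fm [measurable]: "F \<in> borel_measurable \<pi>" using F by (simp add: bnd_def)
  have real: "(LINT x|\<pi>. (LINT y|Q x. f y)) = (LINT x|\<pi>. f x)"
    if f: "f \<in> borel_measurable \<pi>" "\<And>x. x \<in> space \<pi> \<Longrightarrow> \<bar>f x\<bar> \<le> C" for f :: "'s \<Rightarrow> real"
  proof -
    have "(LINT x|(\<pi> \<bind> Q). f x) = (LINT x|\<pi>. (LINT y|Q x. f y))"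
      using f prob_space.emeasure_space_1[OF kernel_prob(1)]
      by (intro integral_bind[where B=C and B'=1 and K=\<pi>]) (auto intro!: finite_measure_axioms AE_I2)
    then show ?thesis by (simp add: invariant)
  qed
  have Fb: "\<bar>Re (F x)\<bar> \<le> C" "\<bar>Im (F x)\<bar> \<le> C" if "x \<in> space \<pi>" for x
    using F that abs_Re_le_cmod[of "F x"] abs_Im_le_cmod[of "F x"] by (force simp: bnd_def)+
  have KF: "integrable \<pi> (K F)" "integrable \<pi> F" using bnd_K[OF F] F by (auto intro: bnd_integrable)
  have eq: "Re (K F x) = (LINT y|Q x. Re (F y))" "Im (K F x) = (LINT y|Q x. Im (F y))" if "x \<in> space \<pi>" for x
    unfolding K_def using integrable_kernel[OF that KF(2)] by simp_all
  have "(LINT x|\<pi>. Re (K F x)) = (LINT x|\<pi>. Re (F x))" "(LINT x|\<pi>. Im (K F x)) = (LINT x|\<pi>. Im (F x))"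
    using real[of "\<lambda>x. Re (F x)"] real[of "\<lambda>x. Im (F x)"] Fb
    by (auto simp: eq cong: Bochner_Integration.integral_cong)
  then show ?thesis using KF by (intro complex_eqI) simp_all
qed


text \<open>A pointwise absolutely convergent series of iterates solves the Poisson equation, because
  \<^term>\<open>K\<close> contracts mean-zero functions by the factor \<^term>\<open>1 - a\<close>.\<close>

lemma poisson_solution:
  assumes D: "bnd C D" and D0: "(LINT x|\<pi>. D x) = 0"
  shows "\<exists>w. bnd (C / a) w \<and> (LINT x|\<pi>. w x) = 0 \<and> (\<forall>x\<in>space \<pi>. w x = D x + K w x)"
proof -
  define T where "T = (\<lambda>n. (K ^^ n) D)"
  have T0: "T 0 = D" and TS: "\<And>n. T (Suc n) = K (T n)" by (auto simp: T_def)
  have T: "bnd ((1 - a) ^ n * C) (T n) \<and> (LINT x|\<pi>. T n x) = 0" for n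
  proof (induction n)
    case (Suc n)
    then have b: "bnd ((1 - a) ^ n * C) (T n)" and i: "(LINT x|\<pi>. T n x) = 0" by auto
    have "bnd ((1 - a) * ((1 - a) ^ n * C)) (K (T n))" using b i by (rule K_mean_zero)
    then have "bnd ((1 - a) ^ Suc n * C) (T (Suc n))" unfolding TS by (simp only: power_Suc mult.assoc)
    moreover have "(LINT x|\<pi>. T (Suc n) x) = 0" unfolding TS using integral_K[OF b] i by simp
    ultimately show ?case by blast
  qed (use D D0 in \<open>auto simp: T0\<close>)
  have Tm [measurable]: "T n \<in> borel_measurable \<pi>" for n using T[of n] by (simp add: bnd_def)
  have Tb: "norm (T n x) \<le> (1 - a) ^ n * C" if "x \<in> space \<pi>" for n x
    using T[of n] that by (simp add: bnd_def)
  have geo: "(\<lambda>n. (1 - a) ^ n * C) sums (C / a)"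
    using sums_mult2[OF geometric_sums[of "1 - a"], of C] a_pos a_le_1 by simp
  have geos: "summable (\<lambda>n. (1 - a) ^ n * C)" and geoi: "(\<Sum>n. (1 - a) ^ n * C) = C / a"
    using sums_summable[OF geo] sums_unique[OF geo] by simp_all
  have summ: "summable (\<lambda>n. norm (T n x))" if "x \<in> space \<pi>" for x
    by (rule summable_comparison_test'[OF geos, of 0]) (simp add: Tb[OF that])
  define w where "w = (\<lambda>x. \<Sum>n. T n x)"
  have wm [measurable]: "w \<in> borel_measurable \<pi>" unfolding w_def using Tm by (rule borel_measurable_suminf)
  have wb: "bnd (C / a) w"
    unfolding bnd_def
  proof (intro conjI ballI)
    fix x assume x: "x \<in> space \<pi>"
    have "norm (w x) \<le> (\<Sum>n. norm (T n x))" unfolding w_def by (rule summable_norm[OF summ[OF x]])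
    also have "\<dots> \<le> (\<Sum>n. (1 - a) ^ n * C)"
      by (intro suminf_le summ[OF x] geos Tb[OF x])
    finally show "norm (w x) \<le> C / a" by (simp only: geoi)
  qed fact
  \<comment> \<open>Needed for two measures: \<open>\<pi>\<close> yields the zero mean of the sum,
    and \<open>Q x\<close> yields its image under \<open>K\<close>.\<close>
  have exch: "(LINT y|N. w y) = (\<Sum>n. LINT y|N. T n y)"
    if N: "prob_space N" "sets N = sets \<pi>" for N
  proof -
    interpret N: prob_space N by fact
    have sp: "space N = space \<pi>" using N(2) by (rule sets_eq_imp_space_eq)
    have TN: "T n \<in> borel_measurable N" for n
      unfolding measurable_cong_sets[OF N(2) refl] by (rule Tm)
    have Ti: "integrable N (T n)" for n
      using Tb TN sp by (intro N.integrable_const_bound[of _ "(1 - a) ^ n * C"] AE_I2) auto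
    have "(LINT y|N. norm (T n y)) \<le> (1 - a) ^ n * C" for n
    proof -
      have "(LINT y|N. norm (T n y)) \<le> (LINT y|N. (1 - a) ^ n * C)"
        using Tb Ti by (intro integral_mono) (auto simp: sp)
      then show ?thesis by (simp add: N.prob_space)
    qed
    then have "summable (\<lambda>n. LINT y|N. norm (T n y))"
      by (intro summable_comparison_test'[OF geos, of 0]) (simp add: integral_nonneg_AE)
    then show ?thesis unfolding w_def using summ
      by (intro integral_suminf Ti) (auto simp: sp)
  qed
  have "(LINT x|\<pi>. w x) = 0"
    using exch[OF prob_space_axioms refl] T by simp
  moreover have "w x = D x + K w x" if x: "x \<in> space \<pi>" for x
  proof -
    have "K w x = (\<Sum>n. T (Suc n) x)"
      unfolding K_def exch[OF kernel_prob(1,2)[OF x]] TS by (simp add: K_def)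
    then show ?thesis
      using suminf_split_head[OF summable_norm_cancel[OF summ[OF x]]] by (simp add: w_def T0)
  qed
  ultimately show ?thesis using wb by blast
qed

text \<open>The equation turns a bound \<open>B'\<close> into \<open>C + (1 - a) * B'\<close>, and
  iterating leads to the fixed point \<open>C / a\<close> whatever the initial \<open>B\<close>.
  This controls solutions that are not given as the series of iterates.\<close>

lemma poisson_unique:
  assumes z: "bnd B z" and z0: "(LINT x|\<pi>. z x) = 0"
    and D: "bnd C D" and eq: "\<And>x. x \<in> space \<pi> \<Longrightarrow> z x = D x + K z x"
  shows "bnd (C / a) z"
proof -
  have step: "bnd (C + (1 - a) * B') z" if "bnd B' z" for B'
    using bnd_add[OF D K_mean_zero[OF that z0]] z eq by (auto simp: bnd_def)
  have iter: "bnd (C / a + (1 - a) ^ n * (B - C / a)) z" for n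
  proof (induction n)
    case (Suc n)
    have "C + (1 - a) * (C / a + (1 - a) ^ n * (B - C / a)) = C / a + (1 - a) ^ Suc n * (B - C / a)"
      using a_pos by (simp add: field_simps)
    then show ?case using step[OF Suc] by simp
  qed (use z in simp)
  have "norm (z x) \<le> C / a" if x: "x \<in> space \<pi>" for x
  proof (rule LIMSEQ_le_const)
    have "(\<lambda>n. C / a + (1 - a) ^ n * (B - C / a)) \<longlonglongrightarrow> C / a + 0 * (B - C / a)"
      using a_pos a_le_1 by (intro tendsto_intros LIMSEQ_power_zero) auto
    then show "(\<lambda>n. C / a + (1 - a) ^ n * (B - C / a)) \<longlonglongrightarrow> C / a" by simp
  qed (use iter x in \<open>auto simp: bnd_def\<close>)
  then show ?thesis using z by (auto simp: bnd_def)
qed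

end

section \<open>Twisted operators and their two-step contraction\<close>

locale kernel_observable = bounded_kernel +
  fixes g :: "'a \<Rightarrow> real"
  assumes g_integrable: "integrable \<pi> g" and g_mean: "(LINT x|\<pi>. g x) = 0"
begin

lemma g_measurable [measurable]: "g \<in> borel_measurable \<pi>"
  using g_integrable by auto

definition e :: "real \<Rightarrow> 'a \<Rightarrow> complex" where "e t x = iexp (t * g x)"
definition \<phi> :: "real \<Rightarrow> complex" where "\<phi> t = (LINT x|\<pi>. e t x)"
definition P :: "real \<Rightarrow> ('a \<Rightarrow> complex) \<Rightarrow> 'a \<Rightarrow> complex" where "P t F = K (\<lambda>x. e t x * F x)"
definition g_abs :: real where "g_abs = (LINT x|\<pi>. \<bar>g x\<bar>)"

lemma e_measurable [measurable]: "e t \<in> borel_measurable \<pi>"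
  unfolding e_def by measurable

lemma norm_e [simp]: "norm (e t x) = 1"
  by (simp add: e_def)

lemma bnd_e: "bnd 1 (e t)"
  by (simp add: bnd_def)

lemma bnd_e_mult: "bnd C F \<Longrightarrow> bnd C (\<lambda>x. e t x * F x)"
  using bnd_mult[OF bnd_e, of C F t] by simp

lemma bnd_P: "bnd C F \<Longrightarrow> bnd C (P t F)"
  unfolding P_def by (intro bnd_K bnd_e_mult)

lemma norm_\<phi>_le: "norm (\<phi> t) \<le> 1"
proof -
  have "norm (\<phi> t) \<le> (LINT x|\<pi>. norm (e t x))" unfolding \<phi>_def by (rule integral_norm_bound)
  then show ?thesis by (simp add: prob_space)
qed

lemma g_abs_nonneg: "0 \<le> g_abs"
  unfolding g_abs_def by (intro integral_nonneg_AE) auto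

text \<open>The \<open>a\<close>-part of the first step produces a constant \<open>c\<close>, so
  that the second step acts on it through \<open>K (e t)\<close> alone, where \<open>F\<close> can
  no longer compensate the oscillation: the factor is at most
  \<open>a * norm (\<phi> t) + (1 - a)\<close>. The rest \<open>G\<close> of the first step has size
  \<open>(1 - a) * C\<close>, and the two contributions add up to the stated factor.\<close>

lemma P_two_step:
  assumes F: "bnd C F"
  shows "bnd ((1 - a\<^sup>2 * (1 - norm (\<phi> t))) * C) (P t (P t F))"
proof -
  have C0: "0 \<le> C" using F by (rule bnd_nonneg)
  have Fm [measurable]: "F \<in> borel_measurable \<pi>" using F by (simp add: bnd_def)
  define c where "c = a * (LINT y|\<pi>. e t y * F y)"
  have c: "norm c \<le> a * C"
  proof -
    have "norm (LINT y|\<pi>. e t y * F y) \<le> (LINT y|\<pi>. norm (e t y * F y))" by (rule integral_norm_bound)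
    also have "\<dots> \<le> (LINT y|\<pi>. C)"
      using F bnd_integrable[OF F] by (intro integral_mono) (auto simp: bnd_def norm_mult)
    finally show ?thesis using a_pos by (simp add: c_def norm_mult prob_space)
  qed
  define G where "G = (\<lambda>x. P t F x - c)"
  have G: "bnd ((1 - a) * C) G"
    using K_minus_mean[OF _ bnd_e_mult[OF F]] by (auto simp: bnd_def G_def c_def P_def)
  have "norm (P t (P t F) x) \<le> (1 - a\<^sup>2 * (1 - norm (\<phi> t))) * C" if x: "x \<in> space \<pi>" for x
  proof -
    have "P t (P t F) x = K (\<lambda>y. c * e t y + e t y * G y) x"
      unfolding P_def[of t "P t F"] by (intro K_cong x) (simp add: G_def algebra_simps)
    also have "\<dots> = c * K (e t) x + K (\<lambda>y. e t y * G y) x"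
      using bnd_integrable[OF bnd_e[of t]] bnd_integrable[OF bnd_e_mult[OF G, of t]]
      by (simp add: K_add x K_cmult)
    finally have *: "norm (P t (P t F) x) \<le> norm c * norm (K (e t) x) + norm (K (\<lambda>y. e t y * G y) x)"
      by (simp add: norm_mult[symmetric] norm_triangle_ineq)
    have "norm (K (e t) x) \<le> norm (a * \<phi> t) + norm (K (e t) x - a * \<phi> t)"
      by (rule norm_triangle_sub)
    also have "\<dots> \<le> a * norm (\<phi> t) + (1 - a)"
      using K_minus_mean[OF x bnd_e, of t] a_pos by (simp add: \<phi>_def norm_mult)
    finally have "norm c * norm (K (e t) x) \<le> (a * C) * (a * norm (\<phi> t) + (1 - a))"
      using c a_pos C0 by (intro mult_mono) auto
    moreover have "norm (K (\<lambda>y. e t y * G y) x) \<le> (1 - a) * C"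
      using bnd_K[OF bnd_e_mult[OF G, of t]] x by (simp add: bnd_def)
    ultimately have "norm (P t (P t F) x) \<le> (a * C) * (a * norm (\<phi> t) + (1 - a)) + (1 - a) * C"
      using * by linarith
    also have "\<dots> = (1 - a\<^sup>2 * (1 - norm (\<phi> t))) * C" by (simp add: algebra_simps power2_eq_square)
    finally show ?thesis .
  qed
  then show ?thesis using bnd_P[OF bnd_P[OF F]] by (auto simp: bnd_def)
qed

lemma two_step_factor: "0 \<le> 1 - a\<^sup>2 * (1 - norm (\<phi> t))"  "1 - a\<^sup>2 * (1 - norm (\<phi> t)) \<le> 1"
proof -
  have "a\<^sup>2 * (1 - norm (\<phi> t)) \<le> 1 * 1"
    using a_le_1 a_pos norm_\<phi>_le[of t] by (intro mult_mono power_le_one) auto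
  then show "0 \<le> 1 - a\<^sup>2 * (1 - norm (\<phi> t))" by simp
  show "1 - a\<^sup>2 * (1 - norm (\<phi> t)) \<le> 1" using norm_\<phi>_le[of t] by simp
qed

lemma P_power_bound:
  "bnd ((1 - a\<^sup>2 * (1 - norm (\<phi> t))) ^ (n div 2)) ((P t ^^ n) (\<lambda>_. 1))"
proof (induction n rule: less_induct)
  case (less n)
  show ?case
  proof (cases "n < 2")
    case True
    then have "n = 0 \<or> n = 1" by auto
    then show ?thesis using bnd_const[of 1] bnd_P[OF bnd_const[of 1], of t] by auto
  next
    case False
    define m where "m = n - 2"
    have m: "n = Suc (Suc m)" using False by (simp add: m_def)
    have "bnd ((1 - a\<^sup>2 * (1 - norm (\<phi> t))) ^ (m div 2)) ((P t ^^ m) (\<lambda>_. 1))"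
      using less.IH[of m] m by simp
    from P_two_step[OF this, of t] show ?thesis unfolding m by simp
  qed
qed

end

subsection \<open>Second-order perturbation of the twisted kernel\<close>

context kernel_observable begin

lemma norm_e_minus_1: "norm (e t x - 1) \<le> \<bar>t\<bar> * \<bar>g x\<bar>"
  using iexp_approx1[of "t * g x" 0] by (simp add: e_def abs_mult)

text \<open>As \<open>g\<close> may be unbounded, \<open>e t - 1\<close> is of order
  \<open>t\<close> only in L1. Applying \<open>K\<close> afterwards restores a sup bound of the same
  order, which is the gain of one power of \<open>t\<close> used at each stage of the
  perturbation.\<close>

lemma integral_e_minus_1:
  assumes F: "bnd C F"
  shows "integrable \<pi> (\<lambda>x. (e t x - 1) * F x)"
    and "(LINT x|\<pi>. norm ((e t x - 1) * F x)) \<le> \<bar>t\<bar> * g_abs * C"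
proof -
  have Fm [measurable]: "F \<in> borel_measurable \<pi>" using F by (simp add: bnd_def)
  have eb: "bnd (1 + 1) (\<lambda>x. e t x - 1)" using bnd_diff[OF bnd_e[of t] bnd_const[of 1]] by simp
  show i: "integrable \<pi> (\<lambda>x. (e t x - 1) * F x)"
    by (rule bnd_integrable[OF bnd_mult[OF eb F]])
  have "(LINT x|\<pi>. norm ((e t x - 1) * F x)) \<le> (LINT x|\<pi>. \<bar>t\<bar> * C * \<bar>g x\<bar>)"
  proof (rule integral_mono)
    fix x assume x: "x \<in> space \<pi>"
    have "norm ((e t x - 1) * F x) \<le> (\<bar>t\<bar> * \<bar>g x\<bar>) * C"
      unfolding norm_mult using norm_e_minus_1 F x by (intro mult_mono) (auto simp: bnd_def)
    then show "norm ((e t x - 1) * F x) \<le> \<bar>t\<bar> * C * \<bar>g x\<bar>" by (simp add: ac_simps)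
  qed (use i g_integrable in auto)
  then show "(LINT x|\<pi>. norm ((e t x - 1) * F x)) \<le> \<bar>t\<bar> * g_abs * C"
    by (simp add: g_abs_def mult_ac)
qed

lemma bnd_K_e_minus_1:
  assumes F: "bnd C F"
  shows "bnd (b * g_abs * C * \<bar>t\<bar>) (K (\<lambda>x. (e t x - 1) * F x))"
proof (rule bnd_mono[OF bnd_K_integrable[OF integral_e_minus_1(1)[OF F]]])
  show "b * (LINT y|\<pi>. norm ((e t y - 1) * F y)) \<le> b * g_abs * C * \<bar>t\<bar>"
    using mult_left_mono[OF integral_e_minus_1(2)[OF F, of t], of b] b_ge_1 by (simp add: mult_ac)
qed

lemma norm_integral_bnd:
  assumes F: "bnd C F" shows "norm (LINT x|\<pi>. F x) \<le> C"
proof -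
  have "norm (LINT x|\<pi>. F x) \<le> (LINT x|\<pi>. norm (F x))" by (rule integral_norm_bound)
  also have "\<dots> \<le> (LINT x|\<pi>. C)"
    using F bnd_integrable[OF F] by (intro integral_mono) (auto simp: bnd_def)
  finally show ?thesis by (simp add: prob_space)
qed

lemma bnd_K_e_minus_\<phi>:
  "bnd (2 * b * g_abs * \<bar>t\<bar>) (\<lambda>x. K (e t) x - \<phi> t)" "(LINT x|\<pi>. K (e t) x - \<phi> t) = 0"
proof -
  have ei: "integrable \<pi> (e t)" by (rule bnd_integrable[OF bnd_e])
  show "(LINT x|\<pi>. K (e t) x - \<phi> t) = 0"
    using integral_K[OF bnd_e[of t]] bnd_integrable[OF bnd_K[OF bnd_e[of t]]]
    by (simp add: \<phi>_def prob_space)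
  have eq: "K (e t) x - \<phi> t = K (\<lambda>x. (e t x - 1) * 1) x - (LINT x|\<pi>. (e t x - 1) * 1)" if "x \<in> space \<pi>" for x
    using ei that by (simp add: K_diff K_const \<phi>_def prob_space)
  have one: "bnd 1 (\<lambda>x. 1)" using bnd_const[of 1] by simp
  have "norm (LINT x|\<pi>. (e t x - 1) * 1) \<le> \<bar>t\<bar> * g_abs * 1"
    using integral_norm_bound[of \<pi> "\<lambda>x. (e t x - 1) * 1"] integral_e_minus_1(2)[OF one, of t] by linarith
  also have "\<dots> \<le> b * g_abs * 1 * \<bar>t\<bar>"
    using b_ge_1 g_abs_nonneg mult_right_mono[of 1 b "\<bar>t\<bar> * g_abs"] by (simp add: mult_ac)
  finally have "bnd (b * g_abs * 1 * \<bar>t\<bar> + b * g_abs * 1 * \<bar>t\<bar>)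
     (\<lambda>x. K (\<lambda>x. (e t x - 1) * 1) x - (LINT x|\<pi>. (e t x - 1) * 1))"
    by (intro bnd_diff bnd_K_e_minus_1 one bnd_mono[OF bnd_const])
  moreover have "(\<lambda>x. K (e t) x - \<phi> t) \<in> borel_measurable \<pi>" by simp
  ultimately show "bnd (2 * b * g_abs * \<bar>t\<bar>) (\<lambda>x. K (e t) x - \<phi> t)"
    using eq unfolding bnd_def by (auto simp: mult_ac)
qed

text \<open>The first-order corrector of the constant eigenfunction: by its equation
  \<open>K (e t) + K (w t)\<close> equals \<open>\<phi> t + w t\<close>, so the non-constant
  first-order defect of \<open>1\<close> is reproduced as \<open>w t\<close>.\<close>

definition w :: "real \<Rightarrow> 'a \<Rightarrow> complex" where
  "w t = (SOME w. bnd (2 * b * g_abs * \<bar>t\<bar> / a) w \<and> (LINT x|\<pi>. w x) = 0 \<and>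
     (\<forall>x\<in>space \<pi>. w x = (K (e t) x - \<phi> t) + K w x))"

lemma w: "bnd (2 * b * g_abs / a * \<bar>t\<bar>) (w t)" "(LINT x|\<pi>. w t x) = 0"
    "x \<in> space \<pi> \<Longrightarrow> w t x = (K (e t) x - \<phi> t) + K (w t) x"
  using someI_ex[OF poisson_solution[OF bnd_K_e_minus_\<phi>[of t]]] by (simp_all add: w_def)

text \<open>The added integral is the mean of the second-order defect. It has to be moved into the
  eigenvalue because a Poisson equation is solvable only for a right-hand side of mean zero.\<close>

definition eigval :: "real \<Rightarrow> complex" where
  "eigval t = \<phi> t + (LINT x|\<pi>. (e t x - 1) * w t x)"

text \<open>Second-order perturbation: \<open>1 + w + w\<^sub>2\<close> is an eigenfunction of \<^term>\<open>P t\<close> up to an error of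
  third order, where \<open>w\<close> and \<open>w\<^sub>2\<close> solve the Poisson equations of the first two orders.\<close>

lemma approximate_eigenfunction:
  "\<exists>C\<ge>0. \<forall>t. \<bar>t\<bar> \<le> 1 \<longrightarrow> (\<exists>v. bnd (C * \<bar>t\<bar>) (\<lambda>x. v x - 1) \<and>
     bnd (C * (\<bar>t\<bar> ^ 3 + \<bar>t\<bar> * norm (1 - \<phi> t))) (\<lambda>x. P t v x - eigval t * v x))"
proof -
  \<comment> \<open>In this order the constants bound \<open>w t\<close> by \<open>|t|\<close>, its
    defect \<open>E\<close> by \<open>t\<^sup>2\<close>, the second corrector \<open>w2\<close> by
    \<open>t\<^sup>2\<close> and the final defect \<open>R\<close> by \<open>|t| ^ 3\<close>. Each
    Poisson solution costs \<open>1 / a\<close>, each multiplication by \<open>e t - 1\<close>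
    followed by \<open>K\<close> costs \<open>b * g_abs\<close>.\<close>
  define c2 c3 c4 c5 where "c2 = 2 * b * g_abs / a" "c3 = b * g_abs * c2" "c4 = 2 * c3 / a" "c5 = b * g_abs * c4"
  have c: "0 \<le> c2" "0 \<le> c3" "0 \<le> c4" "0 \<le> c5"
    using a_pos b_ge_1 g_abs_nonneg by (auto simp: c2_c3_c4_c5_def intro!: mult_nonneg_nonneg divide_nonneg_pos)
  define C where "C = (c2 + c4) * (1 + c3) + c5"
  show ?thesis
  proof (intro exI[of _ C] conjI allI impI)
    show "0 \<le> C" using c by (simp add: C_def)
    fix t :: real assume t: "\<bar>t\<bar> \<le> 1"
    have wb: "bnd (c2 * \<bar>t\<bar>) (w t)" using w(1)[of t] by (simp add: c2_c3_c4_c5_def)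
    define E where "E = K (\<lambda>x. (e t x - 1) * w t x)"
    have Eb: "bnd (c3 * \<bar>t\<bar>\<^sup>2) E"
      using bnd_K_e_minus_1[OF wb, of t]
      by (simp only: E_def c2_c3_c4_c5_def power2_eq_square mult_ac times_divide_eq_right times_divide_eq_left)
    define m where "m = (LINT x|\<pi>. E x)"
    have mb: "norm m \<le> c3 * \<bar>t\<bar>\<^sup>2" unfolding m_def by (rule norm_integral_bnd[OF Eb])
    have e1b: "bnd (1 + 1) (\<lambda>x. e t x - 1)" using bnd_diff[OF bnd_e[of t] bnd_const[of 1]] by simp
    have m_eq: "m = (LINT x|\<pi>. (e t x - 1) * w t x)"
      unfolding m_def E_def by (rule integral_K[OF bnd_mult[OF e1b wb]])
    have "bnd (c3 * \<bar>t\<bar>\<^sup>2 + c3 * \<bar>t\<bar>\<^sup>2) (\<lambda>x. E x - m)"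
      by (intro bnd_diff Eb bnd_mono[OF bnd_const] mb)
    moreover have "(LINT x|\<pi>. E x - m) = 0"
      using bnd_integrable[OF Eb] by (simp add: m_def prob_space)
    ultimately obtain w2 where "bnd ((c3 * \<bar>t\<bar>\<^sup>2 + c3 * \<bar>t\<bar>\<^sup>2) / a) w2"
      and w2: "\<And>x. x \<in> space \<pi> \<Longrightarrow> w2 x = E x - m + K w2 x"
      using poisson_solution by blast
    moreover have "(c3 * \<bar>t\<bar>\<^sup>2 + c3 * \<bar>t\<bar>\<^sup>2) / a = c4 * \<bar>t\<bar>\<^sup>2" by (simp add: c2_c3_c4_c5_def(3) field_simps)
    ultimately have w2b: "bnd (c4 * \<bar>t\<bar>\<^sup>2) w2" by simp
    define R where "R = K (\<lambda>x. (e t x - 1) * w2 x)"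
    have Rb: "bnd (c5 * \<bar>t\<bar> ^ 3) R"
      using bnd_K_e_minus_1[OF w2b, of t]
      by (simp add: R_def c2_c3_c4_c5_def power2_eq_square power3_eq_cube mult_ac)
    define v where "v = (\<lambda>x. 1 + (w t x + w2 x))"
    have t2: "\<bar>t\<bar>\<^sup>2 \<le> \<bar>t\<bar>" using t mult_left_le[of "\<bar>t\<bar>" "\<bar>t\<bar>"] by (simp add: power2_eq_square)
    have ww: "bnd ((c2 + c4) * \<bar>t\<bar>) (\<lambda>x. w t x + w2 x)"
      using mult_left_mono[OF t2, of c4] c
      by (intro bnd_mono[OF bnd_add[OF wb w2b]]) (simp add: algebra_simps)
    \<comment> \<open>The two Poisson equations cancel everything except the mismatch between
      \<open>1\<close> and the eigenvalue, multiplied by the correctors, and \<open>R\<close>. The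
      factor \<open>1 - \<phi> t\<close> is kept as it stands, since it need not be of order
      \<open>t\<^sup>2\<close> when the variance is infinite.\<close>
    have Pv: "P t v x - eigval t * v x = ((1 - \<phi> t) - m) * (w t x + w2 x) + R x" if x: "x \<in> space \<pi>" for x
    proof -
      note int = bnd_integrable[OF bnd_e[of t]] bnd_integrable[OF wb] bnd_integrable[OF w2b]
        bnd_integrable[OF bnd_mult[OF e1b wb]] bnd_integrable[OF bnd_mult[OF e1b w2b]]
      have "P t v x = K (\<lambda>x. e t x + (w t x + (e t x - 1) * w t x) + (w2 x + (e t x - 1) * w2 x)) x"
        unfolding P_def v_def by (simp add: algebra_simps)
      also have "\<dots> = K (e t) x + (K (w t) x + E x) + (K w2 x + R x)"
        unfolding E_def R_def using int by (simp add: K_add[OF x])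
      also have "\<dots> = \<phi> t + w t x + m + w2 x + R x"
        using w(3)[OF x, of t] w2[OF x] by (simp add: algebra_simps)
      finally show ?thesis unfolding v_def eigval_def m_eq[symmetric] by (simp add: algebra_simps)
    qed
    have "bnd (c3 * \<bar>t\<bar>\<^sup>2 + norm (1 - \<phi> t)) (\<lambda>x. (1 - \<phi> t) - m)"
      using mb norm_triangle_ineq4[of "1 - \<phi> t" m] by (intro bnd_mono[OF bnd_const]) simp
    then have b': "bnd ((c3 * \<bar>t\<bar>\<^sup>2 + norm (1 - \<phi> t)) * ((c2 + c4) * \<bar>t\<bar>) + c5 * \<bar>t\<bar> ^ 3)
        (\<lambda>x. ((1 - \<phi> t) - m) * (w t x + w2 x) + R x)"
      by (intro bnd_add bnd_mult ww Rb)
    have "(c3 * \<bar>t\<bar>\<^sup>2 + norm (1 - \<phi> t)) * ((c2 + c4) * \<bar>t\<bar>) + c5 * \<bar>t\<bar> ^ 3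
      = (c3 * (c2 + c4) + c5) * \<bar>t\<bar> ^ 3 + (c2 + c4) * (\<bar>t\<bar> * norm (1 - \<phi> t))"
      by (simp add: algebra_simps power2_eq_square power3_eq_cube)
    also have "\<dots> \<le> C * \<bar>t\<bar> ^ 3 + C * (\<bar>t\<bar> * norm (1 - \<phi> t))"
      using c by (intro add_mono mult_right_mono) (auto simp: C_def algebra_simps)
    finally have le: "(c3 * \<bar>t\<bar>\<^sup>2 + norm (1 - \<phi> t)) * ((c2 + c4) * \<bar>t\<bar>) + c5 * \<bar>t\<bar> ^ 3
      \<le> C * (\<bar>t\<bar> ^ 3 + \<bar>t\<bar> * norm (1 - \<phi> t))" by (simp add: algebra_simps)
    have vm: "v \<in> borel_measurable \<pi>" using ww by (auto simp: v_def bnd_def)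
    show "\<exists>v. bnd (C * \<bar>t\<bar>) (\<lambda>x. v x - 1) \<and>
     bnd (C * (\<bar>t\<bar> ^ 3 + \<bar>t\<bar> * norm (1 - \<phi> t))) (\<lambda>x. P t v x - eigval t * v x)"
    proof (intro exI[of _ v] conjI)
      have "c2 + c4 \<le> C" using c by (simp add: C_def algebra_simps)
      then show "bnd (C * \<bar>t\<bar>) (\<lambda>x. v x - 1)"
        using bnd_mono[OF ww, of "C * \<bar>t\<bar>"] by (simp add: v_def mult_right_mono)
      have "(\<lambda>x. P t v x - eigval t * v x) \<in> borel_measurable \<pi>"
        using vm unfolding P_def by measurable
      then show "bnd (C * (\<bar>t\<bar> ^ 3 + \<bar>t\<bar> * norm (1 - \<phi> t))) (\<lambda>x. P t v x - eigval t * v x)"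
        using bnd_mono[OF b' le] Pv by (simp add: bnd_def)
    qed
  qed
qed

text \<open>Dividing each factor of \<open>(e t - 1) * w t\<close> by \<open>\<i> * t\<close> gives
  \<open>r t\<close>, which tends to \<open>g\<close> in L1, and a quotient that tends uniformly to
  the solution \<open>u\<close> of \<open>u = K g + K u\<close>. Formally \<open>u\<close> is the
  sum of \<open>K^k g\<close> over \<open>k \<ge> 1\<close>, so the limit, the mean of
  \<open>g * u\<close>, is the sum of the covariances at positive lags.\<close>

lemma eigenvalue_second_order:
  "\<exists>\<kappa>::real. ((\<lambda>t. (eigval t - \<phi> t) / t\<^sup>2) \<longlongrightarrow> - complex_of_real \<kappa>) (at 0)"
proof -
  define r where "r = (\<lambda>t x. (e t x - 1) / (\<i> * t))"
  define \<eta> where "\<eta> t = (LINT x|\<pi>. norm (r t x - g x))" for t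
  have rm [measurable]: "r t \<in> borel_measurable \<pi>" for t unfolding r_def by measurable
  have rb: "norm (r t x) \<le> \<bar>g x\<bar>" for t x
    using norm_e_minus_1[of t x] by (cases "t = 0") (auto simp: r_def norm_divide norm_mult divide_simps mult_ac)
  have gi: "integrable \<pi> (\<lambda>x. complex_of_real (g x))" using g_integrable by simp
  have ri: "integrable \<pi> (r t)" for t
    using rb by (intro Bochner_Integration.integrable_bound[OF g_integrable]) auto
  have di: "integrable \<pi> (\<lambda>x. r t x - g x)" for t using ri gi by auto
  have \<eta>: "(\<eta> \<longlongrightarrow> 0) (at 0)"
    unfolding tendsto_at_iff_sequentially
  proof (intro allI impI)
    fix X :: "nat \<Rightarrow> real" assume X: "\<forall>i. X i \<in> UNIV - {0}" "X \<longlonglongrightarrow> 0"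
    have X0: "filterlim X (at 0) sequentially" using X by (auto simp: filterlim_at)
    have "(\<lambda>i. LINT x|\<pi>. norm (r (X i) x - g x)) \<longlonglongrightarrow> (LINT x|\<pi>. 0)"
    proof (rule integral_dominated_convergence)
      show "integrable \<pi> (\<lambda>x. 2 * \<bar>g x\<bar>)" using g_integrable by auto
      show "AE x in \<pi>. (\<lambda>i. norm (r (X i) x - g x)) \<longlonglongrightarrow> 0"
      proof (rule AE_I2)
        fix x
        have "((\<lambda>z. exp (\<i> * (z * g x))) has_field_derivative (\<i> * g x)) (at 0)"
          by (auto intro!: derivative_eq_intros)
        then have "((\<lambda>z::complex. (exp (\<i> * (z * g x)) - 1) / z) \<longlongrightarrow> \<i> * g x) (at 0)"
          by (simp add: has_field_derivative_iff)
        moreover have "filterlim complex_of_real (at 0) (at 0)"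
          by (auto simp: filterlim_at eventually_at_filter intro!: tendsto_eq_intros)
        ultimately have "((\<lambda>t. (exp (\<i> * (complex_of_real t * g x)) - 1) / complex_of_real t) \<longlongrightarrow> \<i> * g x) (at 0)"
          by (rule filterlim_compose)
        then have "((\<lambda>t. (iexp (t * g x) - 1) / t) \<longlongrightarrow> \<i> * g x) (at 0)" by simp
        then have lim: "((\<lambda>t. (iexp (t * g x) - 1) / t / \<i>) \<longlongrightarrow> \<i> * g x / \<i>) (at 0)"
          by (rule tendsto_divide) auto
        have "\<i> * g x / \<i> = g x" by simp
        moreover have "r t x = (iexp (t * g x) - 1) / t / \<i>" for t
          by (simp only: r_def e_def divide_divide_eq_left mult.commute)
        ultimately have "((\<lambda>t. r t x) \<longlongrightarrow> g x) (at 0)" using lim by (simp only:)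
        then have "(\<lambda>i. r (X i) x) \<longlonglongrightarrow> g x" using X0 by (rule filterlim_compose)
        from tendsto_norm[OF tendsto_diff[OF this tendsto_const[of "complex_of_real (g x)"]]]
        show "(\<lambda>i. norm (r (X i) x - g x)) \<longlonglongrightarrow> 0" by simp
      qed
      show "AE x in \<pi>. norm (norm (r (X i) x - g x)) \<le> 2 * \<bar>g x\<bar>" for i
        using norm_triangle_ineq4[of "r (X i) _" "complex_of_real (g _)"] rb[of "X i"]
        by (intro AE_I2) (smt (verit) norm_of_real real_norm_def norm_ge_zero)
    qed auto
    then show "(\<eta> \<circ> X) \<longlonglongrightarrow> 0" by (simp add: \<eta>_def comp_def)
  qed
  define G where "G = K (\<lambda>x. complex_of_real (g x))"
  have Gb: "bnd (b * g_abs) G" using bnd_K_integrable[OF gi] by (simp add: G_def g_abs_def)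
  have Db: "bnd ((b + 1) * \<eta> t) (\<lambda>x. (K (e t) x - \<phi> t) / (\<i> * t) - G x)" if t: "t \<noteq> 0" for t
  proof -
    have ei: "integrable \<pi> (e t)" by (rule bnd_integrable[OF bnd_e])
    have "(LINT x|\<pi>. r t x - g x) = (LINT x|\<pi>. r t x)" using ri gi g_mean by simp
    also have "\<dots> = (\<phi> t - 1) / (\<i> * t)"
      unfolding r_def using ei by (simp add: \<phi>_def prob_space)
    finally have p: "(LINT x|\<pi>. r t x - g x) = (\<phi> t - 1) / (\<i> * t)" .
    have "(K (e t) x - \<phi> t) / (\<i> * t) - G x = K (\<lambda>x. r t x - g x) x - (LINT x|\<pi>. r t x - g x)"
      if x: "x \<in> space \<pi>" for x
    proof -
      have "K (\<lambda>x. r t x - g x) x = K (r t) x - G x" unfolding G_def by (rule K_diff[OF x ri gi])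
      also have "K (r t) x = K (\<lambda>x. (1 / (\<i> * t)) * (e t x - 1)) x" by (simp add: r_def)
      also have "\<dots> = (K (e t) x - 1) / (\<i> * t)"
        unfolding K_cmult using K_diff[OF x ei, of "\<lambda>_. 1"] K_const[OF x, of 1] by simp
      finally show ?thesis unfolding p by (simp add: diff_divide_distrib)
    qed
    moreover have "bnd (b * \<eta> t + \<eta> t) (\<lambda>x. K (\<lambda>x. r t x - g x) x - (LINT x|\<pi>. r t x - g x))"
      using bnd_K_integrable[OF di[of t]] integral_norm_bound[of \<pi> "\<lambda>x. r t x - g x"]
      by (intro bnd_diff bnd_mono[OF bnd_const]) (auto simp: \<eta>_def)
    moreover have "(\<lambda>x. (K (e t) x - \<phi> t) / (\<i> * t) - G x) \<in> borel_measurable \<pi>"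
      using Gb by (auto simp: bnd_def)
    ultimately show ?thesis by (simp add: bnd_def distrib_right)
  qed
  have D0: "(LINT x|\<pi>. (K (e t) x - \<phi> t) / (\<i> * t)) = 0" for t
    using bnd_K_e_minus_\<phi>(2)[of t] by simp
  have Di: "integrable \<pi> (\<lambda>x. (K (e t) x - \<phi> t) / (\<i> * t))" for t
    using bnd_integrable[OF bnd_K_e_minus_\<phi>(1)[of t]] by auto
  \<comment> \<open>Invariance was shown for bounded functions, whereas \<open>g\<close> is only
    integrable. The mean of \<open>K g\<close> is therefore found as a limit of difference
    quotients, each of which has mean zero.\<close>
  have G0: "(LINT x|\<pi>. G x) = 0"
  proof -
    have "norm (LINT x|\<pi>. G x) \<le> (b + 1) * \<eta> t" if t: "t \<noteq> 0" for t
      using norm_integral_bnd[OF Db[OF t]]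
      unfolding Bochner_Integration.integral_diff[OF Di[of t] bnd_integrable[OF Gb]] D0[of t] by simp
    then have "norm (LINT x|\<pi>. G x) \<le> 0"
      using tendsto_mult[OF tendsto_const[of "b + 1"] \<eta>]
      by (intro tendsto_lowerbound[of "\<lambda>t. (b + 1) * \<eta> t" 0 "at (0::real)"]) (auto simp: eventually_at_filter)
    then show ?thesis by simp
  qed
  from poisson_solution[OF Gb G0] obtain u0 where u0: "bnd (b * g_abs / a) u0" "(LINT x|\<pi>. u0 x) = 0"
    "\<And>x. x \<in> space \<pi> \<Longrightarrow> u0 x = G x + K u0 x" by blast
  \<comment> \<open>The Poisson solution is complex-valued, but \<open>G\<close> is real, so the
    real part solves the same equation; this makes \<open>\<kappa>\<close> real.\<close>
  define u where "u = (\<lambda>x. complex_of_real (Re (u0 x)))"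
  have ub: "bnd (b * g_abs / a) u"
    using u0(1) abs_Re_le_cmod unfolding bnd_def u_def by (auto intro: order_trans)
  have u_mean: "(LINT x|\<pi>. u x) = 0"
    using u0(2) bnd_integrable[OF u0(1)] by (simp add: u_def)
  have u_eq: "u x = G x + K u x" if x: "x \<in> space \<pi>" for x
  proof -
    have "K u x = complex_of_real (Re (K u0 x))"
      unfolding K_def u_def using integrable_kernel[OF x bnd_integrable[OF u0(1)]] by simp
    moreover have "G x = complex_of_real (Re (G x))"
      unfolding G_def K_def by simp
    ultimately show ?thesis using u0(3)[OF x] by (simp add: u_def)
  qed
  define \<kappa> where "\<kappa> = (LINT x|\<pi>. g x * Re (u0 x))"
  have ub': "norm (u x) \<le> b * g_abs / a" if "x \<in> space \<pi>" for x using ub that by (simp add: bnd_def)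
  have um [measurable]: "u \<in> borel_measurable \<pi>" using ub by (simp add: bnd_def)
  have gui: "integrable \<pi> (\<lambda>x. g x * u x)"
  proof (rule Bochner_Integration.integrable_bound)
    show "integrable \<pi> (\<lambda>x. \<bar>g x\<bar> * (b * g_abs / a))" using g_integrable by simp
    show "AE x in \<pi>. norm (g x * u x) \<le> norm (\<bar>g x\<bar> * (b * g_abs / a))"
    proof (rule AE_I2)
      fix x assume "x \<in> space \<pi>"
      then show "norm (g x * u x) \<le> norm (\<bar>g x\<bar> * (b * g_abs / a))"
        using mult_left_mono[OF ub'[of x], of "\<bar>g x\<bar>"] a_pos b_ge_1 g_abs_nonneg
        by (simp add: norm_mult abs_mult)
    qed
  qed measurable
  have \<kappa>: "complex_of_real \<kappa> = (LINT x|\<pi>. g x * u x)"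
    unfolding \<kappa>_def u_def of_real_mult[symmetric] by (rule integral_complex_of_real[symmetric])
  \<comment> \<open>\<open>w t\<close> is an arbitrary choice for each \<open>t\<close>, so its
    convergence is read off from the equation: the difference solves a Poisson equation whose
    right-hand side is small by \<open>Db\<close>.\<close>
  have wu: "bnd ((b + 1) * \<eta> t / a) (\<lambda>x. w t x / (\<i> * t) - u x)" if t: "t \<noteq> 0" for t
  proof (rule poisson_unique[OF _ _ Db[OF t]])
    have wd: "bnd (norm (1 / (\<i> * t)) * (2 * b * g_abs / a * \<bar>t\<bar>)) (\<lambda>x. (1 / (\<i> * t)) * w t x)"
      by (intro bnd_mult bnd_const w(1))
    then have wd': "bnd (norm (1 / (\<i> * t)) * (2 * b * g_abs / a * \<bar>t\<bar>)) (\<lambda>x. w t x / (\<i> * t))" by simp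
    show "bnd (norm (1 / (\<i> * t)) * (2 * b * g_abs / a * \<bar>t\<bar>) + b * g_abs / a) (\<lambda>x. w t x / (\<i> * t) - u x)"
      by (intro bnd_diff wd' ub)
    show "(LINT x|\<pi>. w t x / (\<i> * t) - u x) = 0"
      using bnd_integrable[OF wd'] bnd_integrable[OF ub] u_mean w(2)[of t] by simp
    fix x assume x: "x \<in> space \<pi>"
    have "K (\<lambda>x. w t x / (\<i> * t) - u x) x = K (\<lambda>x. (1 / (\<i> * t)) * w t x) x - K u x"
      using K_diff[OF x bnd_integrable[OF wd'] bnd_integrable[OF ub]] by simp
    also have "\<dots> = K (w t) x / (\<i> * t) - K u x" unfolding K_cmult by simp
    finally show "w t x / (\<i> * t) - u x = (K (e t) x - \<phi> t) / (\<i> * t) - G x + K (\<lambda>x. w t x / (\<i> * t) - u x) x"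
      using w(3)[OF x, of t] u_eq[OF x] by (simp add: diff_divide_distrib add_divide_distrib)
  qed
  have bound: "norm (- ((eigval t - \<phi> t) / t\<^sup>2) - \<kappa>) \<le> g_abs * ((b + 1) * \<eta> t / a) + (b * g_abs / a) * \<eta> t" if t: "t \<noteq> 0" for t
  proof -
    have "- ((eigval t - \<phi> t) / t\<^sup>2) = (LINT x|\<pi>. (e t x - 1) * w t x) / (\<i> * t)\<^sup>2"
      unfolding eigval_def by (simp add: power_mult_distrib)
    also have "\<dots> = (LINT x|\<pi>. r t x * (w t x / (\<i> * t)))"
      unfolding r_def using t by (simp add: power2_eq_square)
    finally have eq1: "- ((eigval t - \<phi> t) / t\<^sup>2) = (LINT x|\<pi>. r t x * (w t x / (\<i> * t)))" .
    have wm: "w t \<in> borel_measurable \<pi>" using w(1)[of t] by (simp add: bnd_def)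
    define c where "c = (b + 1) * \<eta> t / a"
    have c: "norm (w t x / (\<i> * t) - u x) \<le> c" if "x \<in> space \<pi>" for x
      using wu[OF t] that by (simp add: bnd_def c_def)
    define B where "B = b * g_abs / a"
    \<comment> \<open>One factor changes at a time, and in each summand one factor is estimated in
      sup norm and the other in L1.\<close>
    have pw: "norm (r t x * (w t x / (\<i> * t)) - g x * u x) \<le> \<bar>g x\<bar> * c + norm (r t x - g x) * B"
      if x: "x \<in> space \<pi>" for x
    proof -
      have "r t x * (w t x / (\<i> * t)) - g x * u x
          = r t x * (w t x / (\<i> * t) - u x) + (r t x - g x) * u x"
        by (simp add: algebra_simps)
      also have "norm \<dots> \<le> norm (r t x) * norm (w t x / (\<i> * t) - u x) + norm (r t x - g x) * norm (u x)"
        by (metis norm_mult norm_triangle_ineq)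
      also have "\<dots> \<le> \<bar>g x\<bar> * c + norm (r t x - g x) * B"
        using c[OF x] ub'[OF x] rb[of t x] by (intro add_mono mult_mono) (auto simp: B_def)
      finally show ?thesis .
    qed
    have dom: "integrable \<pi> (\<lambda>x. \<bar>g x\<bar> * c + norm (r t x - g x) * B)"
      using g_integrable di[of t] by auto
    have diff_int: "integrable \<pi> (\<lambda>x. r t x * (w t x / (\<i> * t)) - g x * u x)"
    proof (rule Bochner_Integration.integrable_bound[OF dom])
      show "AE x in \<pi>. norm (r t x * (w t x / (\<i> * t)) - g x * u x)
          \<le> norm (\<bar>g x\<bar> * c + norm (r t x - g x) * B)"
        using pw by (intro AE_I2) (smt (verit) real_norm_def)
    qed (use wm in measurable)
    have "integrable \<pi> (\<lambda>x. (r t x * (w t x / (\<i> * t)) - g x * u x) + g x * u x)"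
      using diff_int gui by (rule Bochner_Integration.integrable_add)
    then have rw: "integrable \<pi> (\<lambda>x. r t x * (w t x / (\<i> * t)))" by simp
    have "- ((eigval t - \<phi> t) / t\<^sup>2) - \<kappa> = (LINT x|\<pi>. r t x * (w t x / (\<i> * t)) - g x * u x)"
      unfolding eq1 \<kappa> using rw gui by simp
    also have "norm \<dots> \<le> (LINT x|\<pi>. norm (r t x * (w t x / (\<i> * t)) - g x * u x))"
      by (rule integral_norm_bound)
    also have "\<dots> \<le> (LINT x|\<pi>. \<bar>g x\<bar> * c + norm (r t x - g x) * B)"
      using diff_int by (intro integral_mono dom pw) auto
    also have "\<dots> = g_abs * c + B * \<eta> t"
      using g_integrable di[of t] by (simp add: g_abs_def \<eta>_def mult.commute)
    finally show ?thesis by (simp add: c_def B_def)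
  qed
  have "((\<lambda>t. - ((eigval t - \<phi> t) / t\<^sup>2) - \<kappa>) \<longlongrightarrow> 0) (at 0)"
  proof (rule Lim_null_comparison)
    show "((\<lambda>t. g_abs * ((b + 1) * \<eta> t / a) + (b * g_abs / a) * \<eta> t) \<longlongrightarrow> 0) (at 0)"
      using \<eta> a_pos by (auto intro!: tendsto_eq_intros)
  qed (use bound in \<open>auto simp: eventually_at_filter\<close>)
  from tendsto_minus[OF tendsto_add[OF this tendsto_const[of "complex_of_real \<kappa>"]]]
  show ?thesis by (intro exI[of _ \<kappa>]) simp
qed

end

subsection \<open>Slowly varying truncated second moments\<close>

definition truncated_moment :: "real measure \<Rightarrow> real \<Rightarrow> real" where
  "truncated_moment \<mu> x = (LINT y|\<mu>. y\<^sup>2 * indicator {y. \<bar>y\<bar> \<le> x} y)"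

locale slowly_varying_law = real_distribution \<mu> for \<mu> :: "real measure" +
  assumes first_moment: "integrable \<mu> (\<lambda>y. y)" and mean: "(LINT y|\<mu>. y) = 0"
    and slow: "slowly_varying (truncated_moment \<mu>)"
begin

abbreviation H :: "real \<Rightarrow> real" where "H \<equiv> truncated_moment \<mu>"

definition tail :: "real \<Rightarrow> real" where
  "tail x = (LINT y|\<mu>. \<bar>y\<bar> * indicator {y. x < \<bar>y\<bar>} y)"

lemma integrable_truncated:
  fixes f :: "real \<Rightarrow> real"
  assumes [measurable]: "f \<in> borel_measurable borel" and "\<And>y. \<bar>y\<bar> \<le> x \<Longrightarrow> \<bar>f y\<bar> \<le> B"
  shows "integrable \<mu> (\<lambda>y. f y * indicator {y. \<bar>y\<bar> \<le> x} y)"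
proof (rule integrable_const_bound[of _ "\<bar>B\<bar>"])
  show "AE y in \<mu>. norm (f y * indicator {y. \<bar>y\<bar> \<le> x} y) \<le> \<bar>B\<bar>"
    using assms(2) by (intro AE_I2) (auto simp: indicator_def intro: order_trans[OF _ abs_ge_self])
  show "(\<lambda>y. f y * indicator {y. \<bar>y\<bar> \<le> x} y) \<in> borel_measurable \<mu>" by simp
qed

lemma integrable_square: "integrable \<mu> (\<lambda>y. y\<^sup>2 * indicator {y. \<bar>y\<bar> \<le> x} y)"
proof (rule integrable_truncated[of _ _ "x\<^sup>2"])
  show "\<bar>y\<^sup>2\<bar> \<le> x\<^sup>2" if "\<bar>y\<bar> \<le> x" for y :: real using power_mono[OF that, of 2] by simp
qed measurable

lemma integrable_cube: "integrable \<mu> (\<lambda>y. \<bar>y\<bar> ^ 3 * indicator {y. \<bar>y\<bar> \<le> x} y)"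
proof (rule integrable_truncated[of _ _ "x ^ 3"])
  show "\<bar>\<bar>y\<bar> ^ 3\<bar> \<le> x ^ 3" if "\<bar>y\<bar> \<le> x" for y :: real using power_mono[OF that, of 3] by simp
qed measurable

lemma integrable_tail: "integrable \<mu> (\<lambda>y. \<bar>y\<bar> * indicator {y. x < \<bar>y\<bar>} y)"
proof (rule Bochner_Integration.integrable_bound[OF first_moment])
  show "AE y in \<mu>. norm (\<bar>y\<bar> * indicator {y. x < \<bar>y\<bar>} y) \<le> norm y"
    by (intro AE_I2) (simp add: indicator_def)
qed measurable

lemma H_mono: "x \<le> y \<Longrightarrow> H x \<le> H y"
  unfolding truncated_moment_def
  by (intro integral_mono integrable_square) (auto simp: indicator_def)

lemma H_nonneg: "0 \<le> H x"
  unfolding truncated_moment_def by (intro integral_nonneg_AE) auto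

text \<open>Below the cutoff \<open>y\<^sup>2\<close> is at most \<open>|y| * x\<close>, so the
  first moment suffices. The crude growth bound later gives \<open>V \<longlongrightarrow> 0\<close>
  and a norming sequence of at most linear growth.\<close>

lemma H_linear: "\<exists>C\<ge>0. \<forall>x\<ge>0. H x \<le> C * x"
proof (intro exI[of _ "LINT y|\<mu>. \<bar>y\<bar>"] conjI allI impI)
  show "0 \<le> (LINT y|\<mu>. \<bar>y\<bar>)" by (intro integral_nonneg_AE) auto
  fix x :: real assume x: "0 \<le> x"
  have "H x \<le> (LINT y|\<mu>. \<bar>y\<bar> * x)"
    unfolding truncated_moment_def
  proof (intro integral_mono integrable_square)
    show "y\<^sup>2 * indicator {y. \<bar>y\<bar> \<le> x} y \<le> \<bar>y\<bar> * x" for y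
      using x mult_left_mono[of "\<bar>y\<bar>" x "\<bar>y\<bar>"] by (auto simp: indicator_def power2_eq_square)
  qed (use first_moment in auto)
  then show "H x \<le> (LINT y|\<mu>. \<bar>y\<bar>) * x" by simp
qed

lemma H_pos: "\<exists>x0>0. \<forall>x\<ge>x0. 0 < H x"
proof -
  obtain x0 where "\<forall>x\<ge>x0. 0 < H x" using slow unfolding slowly_varying_def by auto
  then show ?thesis by (intro exI[of _ "max 1 x0"]) auto
qed

lemma H_ratio: "0 < c \<Longrightarrow> ((\<lambda>x. H (c * x) / H x) \<longlongrightarrow> 1) at_top"
  using slow unfolding slowly_varying_def by auto

lemma H_double:
  assumes \<epsilon>: "0 < \<epsilon>"
  shows "\<exists>x0>0. \<forall>x\<ge>x0. 0 < H x \<and> H (2 * x) \<le> (1 + \<epsilon>) * H x"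
proof -
  obtain x1 where x1: "x1 > 0" "\<And>x. x \<ge> x1 \<Longrightarrow> 0 < H x" using H_pos by blast
  have "eventually (\<lambda>x. H (2 * x) / H x < 1 + \<epsilon>) at_top"
    using order_tendstoD(2)[OF H_ratio[of 2], of "1 + \<epsilon>"] \<epsilon> by simp
  then obtain x2 where x2: "\<And>x. x \<ge> x2 \<Longrightarrow> H (2 * x) / H x < 1 + \<epsilon>"
    unfolding eventually_at_top_linorder by blast
  show ?thesis
  proof (intro exI[of _ "max x1 x2"] conjI allI impI)
    fix x assume x: "max x1 x2 \<le> x"
    show "0 < H x" using x x1 by auto
    show "H (2 * x) \<le> (1 + \<epsilon>) * H x" using x2[of x] x1(2)[of x] x by (simp add: divide_less_eq)
  qed (use x1 in auto)
qed

text \<open>A Potter-type bound from iterating \<open>H (2 * x) \<le> 2 * H x\<close>; the constant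
  2 in \<open>2 * y\<close> comes from rounding \<open>log 2 y\<close> up to an integer. Slow
  variation itself gives ratios for fixed \<open>y\<close>, while domination of the characteristic
  functions requires uniformity in \<open>y\<close>.\<close>

lemma H_potter: "\<exists>x0>0. \<forall>x\<ge>x0. \<forall>y\<ge>1. 0 < H x \<and> H (y * x) \<le> 2 * y * H x"
proof -
  obtain x0 where x0: "x0 > 0" "\<And>x. x \<ge> x0 \<Longrightarrow> 0 < H x \<and> H (2 * x) \<le> (1 + 1) * H x"
    using H_double[of 1] by auto
  have pow: "H (2 ^ n * x) \<le> 2 ^ n * H x" if "x \<ge> x0" for x n
  proof (induction n)
    case (Suc n)
    have "x0 \<le> 2 ^ n * x" using that x0(1) mult_mono[of 1 "2 ^ n" x0 x] by simp
    then have "H (2 * (2 ^ n * x)) \<le> 2 * H (2 ^ n * x)" using x0(2) by simp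
    also have "\<dots> \<le> 2 * (2 ^ n * H x)" using Suc by simp
    finally show ?case by (simp add: mult_ac)
  qed simp
  show ?thesis
  proof (intro exI[of _ x0] conjI allI impI)
    fix x y :: real assume x: "x0 \<le> x" and y: "1 \<le> y"
    show "0 < H x" using x0(2) x by auto
    define n where "n = nat \<lceil>log 2 y\<rceil>"
    have l: "0 \<le> log 2 y" using y by simp
    have "y = 2 powr log 2 y" using y by simp
    also have "\<dots> \<le> 2 powr real n" using l by (intro powr_mono) (auto simp: n_def)
    finally have 1: "y \<le> 2 ^ n" by (simp add: powr_realpow)
    have "(2::real) ^ n = 2 powr real n" by (simp add: powr_realpow)
    also have "\<dots> \<le> 2 powr (log 2 y + 1)" using l unfolding n_def by (intro powr_mono) linarith+
    also have "\<dots> = 2 * y" using y by (simp add: powr_add)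
    finally have 2: "2 ^ n \<le> 2 * y" .
    have "H (y * x) \<le> H (2 ^ n * x)" using 1 x x0 by (intro H_mono mult_right_mono) auto
    also have "\<dots> \<le> 2 ^ n * H x" by (rule pow[OF x])
    also have "\<dots> \<le> 2 * y * H x" using 2 H_nonneg[of x] by (intro mult_right_mono) auto
    finally show "H (y * x) \<le> 2 * y * H x" .
  qed (use x0 in auto)
qed

lemma tail_tendsto_0: "(tail \<longlongrightarrow> 0) at_top"
proof -
  have "((\<lambda>x. LINT y|\<mu>. \<bar>y\<bar> * indicator {y. x < \<bar>y\<bar>} y) \<longlongrightarrow> (LINT y|\<mu>. 0)) at_top"
  proof (rule integral_dominated_convergence_at_top)
    show "integrable \<mu> (\<lambda>y. \<bar>y\<bar>)" using first_moment by auto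
    show "AE y in \<mu>. ((\<lambda>x. \<bar>y\<bar> * indicator {y. x < \<bar>y\<bar>} y) \<longlongrightarrow> 0) at_top"
    proof (rule AE_I2, rule tendsto_eventually)
      show "eventually (\<lambda>x. \<bar>y\<bar> * indicator {y. x < \<bar>y\<bar>} y = 0) at_top" for y :: real
        using eventually_ge_at_top[of "\<bar>y\<bar>"] by eventually_elim auto
    qed
    show "\<forall>\<^sub>F i in at_top. AE x in \<mu>. norm (\<bar>x\<bar> * indicator {y. i < \<bar>y\<bar>} x) \<le> \<bar>x\<bar>"
      by (auto simp: indicator_def)
  qed auto
  then show ?thesis by (simp add: tail_def[abs_def])
qed

text \<open>One dyadic annulus is split off: on \<open>x < |y| \<le> 2 * x\<close> the first power
  is at most \<open>y\<^sup>2 / x\<close>.\<close>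

lemma tail_split:
  assumes x: "0 < x"
  shows "tail x \<le> (H (2 * x) - H x) / x + tail (2 * x)"
proof -
  have "tail x \<le> (LINT y|\<mu>. (y\<^sup>2 * indicator {y. \<bar>y\<bar> \<le> 2 * x} y - y\<^sup>2 * indicator {y. \<bar>y\<bar> \<le> x} y) / x
      + \<bar>y\<bar> * indicator {y. 2 * x < \<bar>y\<bar>} y)"
    unfolding tail_def
  proof (intro integral_mono integrable_tail)
    show "integrable \<mu> (\<lambda>y. (y\<^sup>2 * indicator {y. \<bar>y\<bar> \<le> 2 * x} y - y\<^sup>2 * indicator {y. \<bar>y\<bar> \<le> x} y) / x
      + \<bar>y\<bar> * indicator {y. 2 * x < \<bar>y\<bar>} y)"
      using integrable_square integrable_tail by auto
    fix y :: real
    have "x * \<bar>y\<bar> \<le> y\<^sup>2" if "x < \<bar>y\<bar>"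
      using mult_right_mono[of x "\<bar>y\<bar>" "\<bar>y\<bar>"] that by (simp add: power2_eq_square)
    then show "\<bar>y\<bar> * indicator {y. x < \<bar>y\<bar>} y \<le>
       (y\<^sup>2 * indicator {y. \<bar>y\<bar> \<le> 2 * x} y - y\<^sup>2 * indicator {y. \<bar>y\<bar> \<le> x} y) / x
      + \<bar>y\<bar> * indicator {y. 2 * x < \<bar>y\<bar>} y"
      using x by (auto simp: indicator_def field_simps)
  qed
  also have "\<dots> = (H (2 * x) - H x) / x + tail (2 * x)"
    unfolding truncated_moment_def tail_def
    using integrable_square integrable_tail by simp
  finally show ?thesis .
qed

text \<open>Sum over dyadic annuli: each costs at most \<open>\<delta> * H x / x\<close> by slow
  variation, and from one annulus to the next \<open>H x / x\<close> is nearly halved, so the costs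
  form a convergent geometric series. The tail left after n annuli vanishes because the first moment
  is finite.\<close>

lemma tail_small:
  assumes \<epsilon>: "0 < \<epsilon>"
  shows "\<exists>x0>0. \<forall>x\<ge>x0. x * tail x \<le> \<epsilon> * H x"
proof -
  \<comment> \<open>The induction with constant \<open>4 * \<delta>\<close> closes if
    \<open>(1 + 2 * \<delta>) * (1 + \<delta>) - 1 \<le> 4 * \<delta>\<close>, that is, if
    \<open>\<delta> \<le> 1/2\<close>.\<close>
  define \<delta> where "\<delta> = min (1/2) (\<epsilon> / 4)"
  have \<delta>: "0 < \<delta>" "\<delta> \<le> 1/2" "4 * \<delta> \<le> \<epsilon>" using \<epsilon> by (auto simp: \<delta>_def)
  obtain x0 where x0: "x0 > 0" "\<And>x. x \<ge> x0 \<Longrightarrow> 0 < H x \<and> H (2 * x) \<le> (1 + \<delta>) * H x"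
    using H_double[OF \<delta>(1)] by auto
  have iter: "tail x \<le> 4 * \<delta> * H x / x + tail (2 ^ n * x)" if "x \<ge> x0" for x n
    using that
  proof (induction n arbitrary: x)
    case 0
    then show ?case using \<delta> x0(1) H_nonneg[of x] by auto
  next
    case (Suc n)
    have xp: "0 < x" using Suc.prems x0 by linarith
    have H2: "H (2 * x) \<le> (1 + \<delta>) * H x" using x0(2)[OF Suc.prems] by simp
    have "tail x \<le> (H (2 * x) - H x) / x + tail (2 * x)" by (rule tail_split[OF xp])
    also have "tail (2 * x) \<le> 4 * \<delta> * H (2 * x) / (2 * x) + tail (2 ^ n * (2 * x))"
      using Suc.IH[of "2 * x"] Suc.prems xp by simp
    also have "(H (2 * x) - H x) / x + (4 * \<delta> * H (2 * x) / (2 * x) + tail (2 ^ n * (2 * x)))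
       = ((1 + 2 * \<delta>) * H (2 * x) - H x) / x + tail (2 ^ Suc n * x)"
      using xp by (simp add: field_simps)
    also have "(1 + 2 * \<delta>) * H (2 * x) - H x \<le> (1 + 2 * \<delta>) * ((1 + \<delta>) * H x) - H x"
      using H2 \<delta> by (intro diff_right_mono mult_left_mono) auto
    also have "\<dots> \<le> 4 * \<delta> * H x"
    proof -
      have "(1 + 2 * \<delta>) * (1 + \<delta>) - 1 \<le> 4 * \<delta>" using \<delta> mult_left_mono[OF \<delta>(2), of \<delta>] by (simp add: algebra_simps)
      from mult_right_mono[OF this H_nonneg[of x]] show ?thesis by (simp add: algebra_simps)
    qed
    finally show ?case using xp by (simp add: divide_right_mono)
  qed
  show ?thesis
  proof (intro exI[of _ x0] conjI allI impI)
    fix x assume x: "x0 \<le> x"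
    then have xp: "0 < x" using x0 by linarith
    have "filterlim (\<lambda>n::nat. 2 ^ n * x) at_top sequentially"
    proof (rule filterlim_at_top_mono)
      show "filterlim (\<lambda>n. x * real n) at_top sequentially"
        using xp by (intro filterlim_tendsto_pos_mult_at_top[OF tendsto_const] filterlim_real_sequentially)
      show "eventually (\<lambda>n. x * real n \<le> 2 ^ n * x) sequentially"
        using xp by (intro always_eventually allI) (simp add: mult.commute less_imp_le of_nat_less_two_power)
    qed
    then have "(\<lambda>n. 4 * \<delta> * H x / x + tail (2 ^ n * x)) \<longlonglongrightarrow> 4 * \<delta> * H x / x + 0"
      by (intro tendsto_add tendsto_const filterlim_compose[OF tail_tendsto_0])
    then have "tail x \<le> 4 * \<delta> * H x / x + 0"
      by (rule LIMSEQ_le_const) (use iter[OF x] in auto)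
    then have "x * tail x \<le> 4 * \<delta> * H x" using xp by (simp add: field_simps)
    also have "\<dots> \<le> \<epsilon> * H x" using \<delta>(3) H_nonneg by (rule mult_right_mono)
    finally show "x * tail x \<le> \<epsilon> * H x" .
  qed (use x0 in auto)
qed

text \<open>Cut at \<open>\<delta> * x\<close>: below it one factor of the cube is at most
  \<open>\<delta> * x\<close>; above it that factor is at most \<open>x\<close>, but the second
  moment between \<open>\<delta> * x\<close> and \<open>x\<close> is a small fraction of
  \<open>H x\<close> by slow variation.\<close>

lemma third_moment_small:
  assumes \<epsilon>: "0 < \<epsilon>"
  shows "\<exists>x0>0. \<forall>x\<ge>x0. (LINT y|\<mu>. \<bar>y\<bar> ^ 3 * indicator {y. \<bar>y\<bar> \<le> x} y) \<le> \<epsilon> * x * H x"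
proof -
  define \<delta> where "\<delta> = min 1 (\<epsilon> / 2)"
  have \<delta>: "0 < \<delta>" "\<delta> \<le> 1" "2 * \<delta> \<le> \<epsilon>" using \<epsilon> by (auto simp: \<delta>_def)
  obtain x1 where x1: "x1 > 0" "\<And>x. x \<ge> x1 \<Longrightarrow> 0 < H x" using H_pos by blast
  have "eventually (\<lambda>x. 1 - \<delta> < H (\<delta> * x) / H x) at_top"
    using order_tendstoD(1)[OF H_ratio[OF \<delta>(1)], of "1 - \<delta>"] \<delta> by simp
  then obtain x2 where x2: "\<And>x. x \<ge> x2 \<Longrightarrow> 1 - \<delta> < H (\<delta> * x) / H x"
    unfolding eventually_at_top_linorder by blast
  show ?thesis
  proof (intro exI[of _ "max x1 x2"] conjI allI impI)
    fix x assume "max x1 x2 \<le> x"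
    then have x: "x1 \<le> x" "x2 \<le> x" by auto
    have xp: "0 < x" using x x1 by linarith
    have "(LINT y|\<mu>. \<bar>y\<bar> ^ 3 * indicator {y. \<bar>y\<bar> \<le> x} y)
       \<le> (LINT y|\<mu>. x * (y\<^sup>2 * indicator {y. \<bar>y\<bar> \<le> x} y) - (x - \<delta> * x) * (y\<^sup>2 * indicator {y. \<bar>y\<bar> \<le> \<delta> * x} y))"
    proof (intro integral_mono integrable_cube)
      show "integrable \<mu> (\<lambda>y. x * (y\<^sup>2 * indicator {y. \<bar>y\<bar> \<le> x} y) - (x - \<delta> * x) * (y\<^sup>2 * indicator {y. \<bar>y\<bar> \<le> \<delta> * x} y))"
        using integrable_square[of x] integrable_square[of "\<delta> * x"] by auto
      fix y :: real
      have cube: "\<bar>y\<bar> ^ 3 \<le> c * y\<^sup>2" if "\<bar>y\<bar> \<le> c" for c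
        using mult_right_mono[OF that, of "y\<^sup>2"] by (simp add: power3_eq_cube power2_eq_square abs_mult[symmetric])
      have "\<delta> * x \<le> x" using \<delta> xp by simp
      then show "\<bar>y\<bar> ^ 3 * indicator {y. \<bar>y\<bar> \<le> x} y \<le>
         x * (y\<^sup>2 * indicator {y. \<bar>y\<bar> \<le> x} y) - (x - \<delta> * x) * (y\<^sup>2 * indicator {y. \<bar>y\<bar> \<le> \<delta> * x} y)"
        using cube[of x] cube[of "\<delta> * x"] by (auto simp: indicator_def algebra_simps)
    qed
    also have "\<dots> = x * H x - (x - \<delta> * x) * H (\<delta> * x)"
      unfolding truncated_moment_def using integrable_square[of x] integrable_square[of "\<delta> * x"] by simp
    also have "\<dots> \<le> x * H x - (x - \<delta> * x) * ((1 - \<delta>) * H x)"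
    proof -
      have "(1 - \<delta>) * H x \<le> H (\<delta> * x)" using x2[OF x(2)] x1(2)[OF x(1)] by (simp add: less_divide_eq)
      moreover have "0 \<le> x - \<delta> * x" using \<delta> xp by simp
      ultimately show ?thesis by (intro diff_left_mono mult_left_mono)
    qed
    also have "\<dots> = (2 * \<delta> - \<delta> * \<delta>) * (x * H x)" by (simp add: algebra_simps)
    also have "\<dots> \<le> \<epsilon> * (x * H x)"
      using \<delta> xp H_nonneg[of x] mult_nonneg_nonneg[of \<delta> \<delta>] by (intro mult_right_mono) (linarith | auto)+
    finally show "(LINT y|\<mu>. \<bar>y\<bar> ^ 3 * indicator {y. \<bar>y\<bar> \<le> x} y) \<le> \<epsilon> * x * H x" by (simp add: mult_ac)
  qed (use x1 in auto)
qed

text \<open>The cutoff decides the order of the Taylor expansion: the third-order remainder is used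
  where the cube is truncated, the first-order one beyond, where only the first moment is
  available.\<close>

lemma iexp_bound:
  "norm (iexp (t * y) - 1 - \<i> * t * y + complex_of_real (t\<^sup>2 / 2 * (y\<^sup>2 * indicator {y. \<bar>y\<bar> \<le> x} y)))
    \<le> \<bar>t\<bar> ^ 3 * (\<bar>y\<bar> ^ 3 * indicator {y. \<bar>y\<bar> \<le> x} y) + 2 * \<bar>t\<bar> * (\<bar>y\<bar> * indicator {y. x < \<bar>y\<bar>} y)"
proof (cases "\<bar>y\<bar> \<le> x")
  case True
  have "norm (iexp (t * y) - 1 - \<i> * t * y + complex_of_real (t\<^sup>2 / 2 * y\<^sup>2)) \<le> \<bar>t * y\<bar> ^ 3 / 6"
    using iexp_approx1[of "t * y" 2]
    by (simp add: numeral_2_eq_2 fact_numeral power2_eq_square algebra_simps divide_simps numeral_3_eq_3)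
  also have "\<dots> \<le> \<bar>t\<bar> ^ 3 * \<bar>y\<bar> ^ 3" by (simp add: abs_mult power_mult_distrib)
  finally show ?thesis using True by simp
next
  case False
  have "norm (iexp (t * y) - 1 - \<i> * t * y) \<le> 2 * \<bar>t * y\<bar>"
    using iexp_approx2[of "t * y" 1] by (simp add: algebra_simps)
  then show ?thesis using False by (simp add: abs_mult)
qed

text \<open>With the cutoff \<open>x = 1 / |t|\<close> both errors of \<open>iexp_bound\<close> have
  the order of the main term: \<open>|t| ^ 3\<close> meets a third moment that is small against
  \<open>x * H x\<close>, and \<open>|t|\<close> meets a tail that is small against
  \<open>H x / x\<close>. The shares \<open>\<epsilon> / 2\<close> and \<open>\<epsilon> / 4\<close>
  account for the factor 2 before the tail.\<close>

lemma char_expansion: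
  assumes \<epsilon>: "0 < \<epsilon>"
  shows "\<exists>\<delta>>0. \<forall>t. t \<noteq> 0 \<longrightarrow> \<bar>t\<bar> \<le> \<delta> \<longrightarrow>
     norm (1 - char \<mu> t - t\<^sup>2 * H (1 / \<bar>t\<bar>) / 2) \<le> \<epsilon> * (t\<^sup>2 * H (1 / \<bar>t\<bar>))"
proof -
  obtain x1 where x1: "x1 > 0" "\<And>x. x \<ge> x1 \<Longrightarrow> (LINT y|\<mu>. \<bar>y\<bar> ^ 3 * indicator {y. \<bar>y\<bar> \<le> x} y) \<le> \<epsilon> / 2 * x * H x"
    using third_moment_small[of "\<epsilon> / 2"] \<epsilon> by auto
  obtain x2 where x2: "x2 > 0" "\<And>x. x \<ge> x2 \<Longrightarrow> x * tail x \<le> \<epsilon> / 4 * H x"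
    using tail_small[of "\<epsilon> / 4"] \<epsilon> by auto
  define x0 where "x0 = max x1 x2"
  have x0: "x0 > 0" "x1 \<le> x0" "x2 \<le> x0" using x1 x2 by (auto simp: x0_def)
  show ?thesis
  proof (intro exI[of _ "1 / x0"] conjI allI impI)
    show "0 < 1 / x0" using x0 by simp
    fix t :: real assume t: "t \<noteq> 0" "\<bar>t\<bar> \<le> 1 / x0"
    define x where "x = 1 / \<bar>t\<bar>"
    have x: "x0 \<le> x" using t x0 by (simp add: x_def field_simps)
    have tx: "\<bar>t\<bar> * x = 1" using t by (simp add: x_def)
    define s where "s = (\<lambda>y. t\<^sup>2 / 2 * (y\<^sup>2 * indicator {y. \<bar>y\<bar> \<le> x} y))"
    have ii: "integrable \<mu> (\<lambda>y. iexp (t * y))" by (rule integrable_iexp) auto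
    have yi: "integrable \<mu> (\<lambda>y. \<i> * t * complex_of_real y)" using first_moment by simp
    have si: "integrable \<mu> (\<lambda>y. complex_of_real (s y))"
      unfolding s_def by (intro integrable_of_real integrable_mult_right integrable_square)
    have int: "integrable \<mu> (\<lambda>y. iexp (t * y) - 1 - \<i> * t * y + complex_of_real (s y))"
      by (intro Bochner_Integration.integrable_add Bochner_Integration.integrable_diff ii yi si) simp
    have "(LINT y|\<mu>. \<i> * t * complex_of_real y) = 0"
      using mean by simp
    moreover have "(LINT y|\<mu>. complex_of_real (s y)) = complex_of_real (t\<^sup>2 / 2 * H x)"
      unfolding s_def truncated_moment_def by (simp del: of_real_mult of_real_divide)
    moreover have one: "integrable \<mu> (\<lambda>y. 1 :: complex)" "(LINT y|\<mu>. 1 :: complex) = 1"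
      using prob_space by simp_all
    moreover have "(LINT y|\<mu>. iexp (t * y) - 1 - \<i> * t * y + complex_of_real (s y))
      = (LINT y|\<mu>. iexp (t * y)) - (LINT y|\<mu>. 1) - (LINT y|\<mu>. \<i> * t * complex_of_real y)
        + (LINT y|\<mu>. complex_of_real (s y))"
      by (simp only: ii yi si one(1) Bochner_Integration.integral_add Bochner_Integration.integral_diff
          Bochner_Integration.integrable_diff)
    ultimately have "(LINT y|\<mu>. iexp (t * y) - 1 - \<i> * t * y + complex_of_real (s y))
      = char \<mu> t - 1 + complex_of_real (t\<^sup>2 / 2 * H x)"
      by (simp add: char_def)
    moreover have "1 - char \<mu> t - t\<^sup>2 * H x / 2 = - (char \<mu> t - 1 + complex_of_real (t\<^sup>2 / 2 * H x))"
      by simp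
    ultimately have "norm (1 - char \<mu> t - t\<^sup>2 * H x / 2)
      = norm (LINT y|\<mu>. iexp (t * y) - 1 - \<i> * t * y + complex_of_real (s y))"
      by (simp only: norm_minus_cancel)
    also have "\<dots> \<le> (LINT y|\<mu>. norm (iexp (t * y) - 1 - \<i> * t * y + complex_of_real (s y)))"
      by (rule integral_norm_bound)
    also have "\<dots> \<le> (LINT y|\<mu>. \<bar>t\<bar> ^ 3 * (\<bar>y\<bar> ^ 3 * indicator {y. \<bar>y\<bar> \<le> x} y) + 2 * \<bar>t\<bar> * (\<bar>y\<bar> * indicator {y. x < \<bar>y\<bar>} y))"
      unfolding s_def
      by (intro integral_mono iexp_bound integrable_norm int[unfolded s_def]
          Bochner_Integration.integrable_add integrable_mult_right integrable_cube integrable_tail)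
    also have "\<dots> = \<bar>t\<bar> ^ 3 * (LINT y|\<mu>. \<bar>y\<bar> ^ 3 * indicator {y. \<bar>y\<bar> \<le> x} y) + 2 * \<bar>t\<bar> * tail x"
      unfolding tail_def using integrable_cube[of x] integrable_tail[of x] by simp
    also have "\<dots> \<le> \<bar>t\<bar> ^ 3 * (\<epsilon> / 2 * x * H x) + 2 * \<bar>t\<bar> * (\<bar>t\<bar> * (\<epsilon> / 4 * H x))"
    proof (intro add_mono mult_left_mono)
      show "(LINT y|\<mu>. \<bar>y\<bar> ^ 3 * indicator {y. \<bar>y\<bar> \<le> x} y) \<le> \<epsilon> / 2 * x * H x" using x1(2)[of x] x x0 by simp
      have "\<bar>t\<bar> * (x * tail x) \<le> \<bar>t\<bar> * (\<epsilon> / 4 * H x)" using x2(2)[of x] x x0 by (intro mult_left_mono) auto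
      then show "tail x \<le> \<bar>t\<bar> * (\<epsilon> / 4 * H x)" using tx by (simp add: mult.assoc[symmetric])
    qed auto
    also have "\<dots> = (\<bar>t\<bar> * x) * (\<bar>t\<bar>\<^sup>2 * (\<epsilon> / 2 * H x)) + \<bar>t\<bar>\<^sup>2 * (\<epsilon> / 2 * H x)"
    proof -
      have "\<tau> ^ 3 * (\<epsilon> / 2 * x * h) + 2 * \<tau> * (\<tau> * (\<epsilon> / 4 * h))
          = (\<tau> * x) * (\<tau>\<^sup>2 * (\<epsilon> / 2 * h)) + \<tau>\<^sup>2 * (\<epsilon> / 2 * h)" for \<tau> h
        by (simp add: power2_eq_square power3_eq_cube algebra_simps)
      then show ?thesis .
    qed
    also have "\<dots> = \<epsilon> * (t\<^sup>2 * H x)" unfolding tx by (simp add: field_simps)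
    finally show "norm (1 - char \<mu> t - t\<^sup>2 * H (1 / \<bar>t\<bar>) / 2) \<le> \<epsilon> * (t\<^sup>2 * H (1 / \<bar>t\<bar>))"
      by (simp add: x_def)
  qed
qed

end

subsection \<open>Normalizing sequences\<close>

text \<open>Exact equality holds although \<open>K\<close> may jump, because a monotone function
  jumps only upwards: at the supremum of all \<open>x\<close> with
  \<open>x\<^sup>2 \<le> n * K x\<close>, approach from the left gives one inequality and approach
  from the right the other. Linear growth bounds that set, and positivity at \<open>x0\<close> puts
  every fixed \<open>x \<ge> x0\<close> into it for large n, so \<open>b\<close> diverges.\<close>

lemma normalizing_sequence:
  fixes K :: "real \<Rightarrow> real"
  assumes mono: "\<And>x y. x \<le> y \<Longrightarrow> K x \<le> K y" and lin: "\<And>x. 1 \<le> x \<Longrightarrow> K x \<le> C * x"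
    and pos: "1 \<le> x0" "0 < K x0"
  shows "\<exists>b :: nat \<Rightarrow> real. filterlim b at_top sequentially \<and>
    eventually (\<lambda>n. real n * K (b n) = (b n)\<^sup>2) sequentially"
proof -
  define A where "A n = {x. x0 \<le> x \<and> x\<^sup>2 \<le> real n * K x}" for n
  define b where "b n = Sup (A n)" for n
  have bdd: "bdd_above (A n)" for n
  proof (rule bdd_aboveI)
    fix x assume x: "x \<in> A n"
    then have x1: "1 \<le> x" using pos by (auto simp: A_def)
    have "x * x \<le> real n * K x" using x by (simp add: A_def power2_eq_square)
    also have "\<dots> \<le> real n * (C * x)" using lin[OF x1] by (intro mult_left_mono) auto
    finally have "x * x \<le> (real n * C) * x" by (simp add: mult.assoc)
    then show "x \<le> real n * C" using x1 by (simp add: mult_le_cancel_right)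
  qed
  have inA: "x \<in> A n" if "x0 \<le> x" "x\<^sup>2 / K x0 \<le> real n" for x n
  proof -
    have "x\<^sup>2 \<le> real n * K x0" using that(2) pos by (simp add: field_simps)
    also have "\<dots> \<le> real n * K x" using mono[OF that(1)] by (intro mult_left_mono) auto
    finally show ?thesis using that(1) by (simp add: A_def)
  qed
  have "filterlim b at_top sequentially"
    unfolding filterlim_at_top
  proof
    fix Z :: real
    define x where "x = max x0 Z"
    have "eventually (\<lambda>n. x\<^sup>2 / K x0 \<le> real n) sequentially"
      using filterlim_real_sequentially by (simp add: filterlim_at_top)
    then show "eventually (\<lambda>n. Z \<le> b n) sequentially"
    proof eventually_elim
      case (elim n)
      have "x \<in> A n" using elim by (intro inA) (auto simp: x_def)
      then have "x \<le> b n" unfolding b_def using bdd by (rule cSup_upper)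
      then show ?case by (simp add: x_def)
    qed
  qed
  moreover have "eventually (\<lambda>n. real n * K (b n) = (b n)\<^sup>2) sequentially"
  proof -
    have "eventually (\<lambda>n. x0\<^sup>2 / K x0 \<le> real n) sequentially"
      using filterlim_real_sequentially by (simp add: filterlim_at_top)
    then show ?thesis
    proof eventually_elim
      case (elim n)
      have x0A: "x0 \<in> A n" using elim by (intro inA) auto
      then have bx: "x0 \<le> b n" unfolding b_def using bdd by (rule cSup_upper)
      have le1: "x\<^sup>2 \<le> real n * K (b n)" if x: "x0 \<le> x" "x < b n" for x
      proof -
        obtain y where y: "y \<in> A n" "x < y"
          using less_cSup_iff[OF _ bdd[of n], of x] x(2) x0A unfolding b_def by blast
        have "y \<le> b n" unfolding b_def using y(1) bdd by (rule cSup_upper)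
        have "x\<^sup>2 \<le> y\<^sup>2" using x pos y by (intro power_mono) auto
        also have "\<dots> \<le> real n * K y" using y by (simp add: A_def)
        also have "\<dots> \<le> real n * K (b n)" using mono[OF \<open>y \<le> b n\<close>] by (intro mult_left_mono) auto
        finally show ?thesis .
      qed
      have "(b n)\<^sup>2 \<le> real n * K (b n)"
      proof (cases "x0 = b n")
        case True then show ?thesis using x0A by (simp add: A_def)
      next
        case False
        then have lt: "x0 < b n" using bx by simp
        show ?thesis
        proof (rule tendsto_upperbound)
          show "((\<lambda>x. x\<^sup>2) \<longlongrightarrow> (b n)\<^sup>2) (at_left (b n))" by (intro tendsto_intros)
          show "eventually (\<lambda>x. x\<^sup>2 \<le> real n * K (b n)) (at_left (b n))"
            using eventually_at_left_real[OF lt] by eventually_elim (auto intro: le1)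
        qed simp
      qed
      moreover have "real n * K (b n) \<le> (b n)\<^sup>2"
      proof (rule tendsto_lowerbound)
        show "((\<lambda>x. x\<^sup>2) \<longlongrightarrow> (b n)\<^sup>2) (at_right (b n))" by (intro tendsto_intros)
        have "b n < b n + 1" by simp
        from eventually_at_right_real[OF this]
        show "eventually (\<lambda>x. real n * K (b n) \<le> x\<^sup>2) (at_right (b n))"
        proof eventually_elim
          case (elim x)
          then have x: "b n < x" by simp
          have "x \<notin> A n" using x cSup_upper[OF _ bdd, of x n] by (auto simp: b_def)
          then have "real n * K x < x\<^sup>2" using x bx by (auto simp: A_def)
          moreover have "real n * K (b n) \<le> real n * K x" using x by (intro mult_left_mono mono) auto
          ultimately show ?case by simp
        qed
      qed simp
      ultimately show ?case by simp
    qed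
  qed
  ultimately show ?thesis by blast
qed

subsection \<open>Fejer kernel smoothing and a local limit criterion\<close>

definition triangle :: "real \<Rightarrow> real" where
  "triangle t = max 0 (1 - \<bar>t\<bar>)"

text \<open>Normalised to total mass one; the value at 0 is the continuous extension. Up to the
  factor \<open>2 * pi\<close> it is the Fourier transform of \<open>triangle\<close>.\<close>

definition fejer :: "real \<Rightarrow> real" where
  "fejer x = (if x = 0 then 1 / (2 * pi) else (1 - cos x) / (pi * x\<^sup>2))"

lemma triangle_measurable [measurable]: "triangle \<in> borel_measurable borel"
  unfolding triangle_def by measurable

lemma fejer_measurable [measurable]: "fejer \<in> borel_measurable borel"
  unfolding fejer_def by measurable

lemma triangle_bounds: "0 \<le> triangle t" "triangle t \<le> 1" "\<bar>t\<bar> \<ge> 1 \<Longrightarrow> triangle t = 0"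
  by (auto simp: triangle_def)

lemma fejer_nonneg: "0 \<le> fejer x"
  by (simp add: fejer_def)

lemma fejer_even: "fejer (- x) = fejer x"
  by (simp add: fejer_def)

lemma fejer_ge: "(1 - cos x) / (pi * (2 + 2 * x\<^sup>2)) \<le> fejer x"
  by (auto simp: fejer_def intro!: divide_left_mono mult_left_mono mult_pos_pos add_pos_nonneg)

lemma fejer_le: "x \<noteq> 0 \<Longrightarrow> fejer x \<le> 2 / (pi * x\<^sup>2)"
  using cos_ge_minus_one[of x] by (auto simp: fejer_def intro!: divide_right_mono)

lemma fejer_fourier: "has_bochner_integral lborel (\<lambda>t. triangle t * cos (t * x)) (2 * pi * fejer x)"
proof -
  define F where "F t = (if x = 0 then t - t\<^sup>2 / 2 else (1 - t) * sin (t * x) / x - cos (t * x) / x\<^sup>2)" for t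
  have "has_bochner_integral lborel (\<lambda>t. ((1 - t) * cos (t * x)) * indicator {0..1} t) (F 1 - F 0)"
  proof (rule has_bochner_integral_FTC_Icc_real)
    show "DERIV F t :> (1 - t) * cos (t * x)" for t
      unfolding F_def
      by (cases "x = 0") (auto intro!: derivative_eq_intros simp: field_simps power2_eq_square)
  qed auto
  moreover have "F 1 - F 0 = pi * fejer x"
    by (simp add: F_def fejer_def field_simps)
  moreover have "(\<lambda>t. ((1 - t) * cos (t * x)) * indicator {0..1} t) = (\<lambda>t. indicator {0..} t *\<^sub>R (triangle t * cos (t * x)))"
    by (auto simp: fun_eq_iff triangle_def indicator_def)
  ultimately have "has_bochner_integral lborel (\<lambda>t. indicator {0..} t *\<^sub>R (triangle t * cos (t * x))) (pi * fejer x)"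
    by simp
  from has_bochner_integral_even_function[OF this] show ?thesis
    by (simp add: triangle_def mult.assoc)
qed

text \<open>Integration by parts leads to the sine integral: \<open>F\<close> differentiates to
  \<open>fejer\<close> on the positive axis, its boundary term \<open>(1 - cos x) / x\<close>
  vanishes at 0 and at infinity, and \<open>Si\<close> tends to \<open>pi / 2\<close>. Each half
  line therefore carries mass \<open>1/2\<close>.\<close>

lemma fejer_integral: "has_bochner_integral lborel fejer 1"
proof -
  define F where "F x = (Si x - (1 - cos x) / x) / pi" for x
  have cosx: "((\<lambda>x. (1 - cos x) / x) \<longlongrightarrow> 0) (at (0::real))"
  proof -
    have "DERIV cos 0 :> - sin (0::real)" by (rule DERIV_cos)
    then have "((\<lambda>x. - ((cos x - 1) / x)) \<longlongrightarrow> - 0) (at (0::real))"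
      unfolding has_field_derivative_iff by (intro tendsto_minus) simp
    then show ?thesis by (simp add: minus_divide_left)
  qed
  have cosinf: "((\<lambda>x. (1 - cos x) / x) \<longlongrightarrow> 0) (at_top :: real filter)"
  proof (rule Lim_null_comparison)
    show "((\<lambda>x. 2 / x) \<longlongrightarrow> 0) (at_top :: real filter)" by real_asymp
    show "eventually (\<lambda>x::real. norm ((1 - cos x) / x) \<le> 2 / x) at_top"
      using eventually_gt_at_top[of 0]
    proof eventually_elim
      case (elim x)
      have "\<bar>1 - cos x\<bar> \<le> 2" using cos_le_one[of x] cos_ge_minus_one[of x] by linarith
      then show ?case using elim by (simp add: divide_right_mono)
    qed
  qed
  have deriv: "DERIV F x :> fejer x" "isCont fejer x" if "0 < ereal x" for x
  proof -
    have x: "0 < x" using that by simp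
    have "(Si has_real_derivative sin x / x) (at x)" using DERIV_Si[of x] x by simp
    then have "(F has_real_derivative ((sin x / x - (sin x * x - (1 - cos x)) / (x * x)) / pi)) (at x)"
      unfolding F_def using x by (auto intro!: derivative_eq_intros)
    moreover have "(sin x / x - (sin x * x - (1 - cos x)) / (x * x)) / pi = fejer x"
      using x by (simp add: fejer_def field_simps power2_eq_square)
    ultimately show "DERIV F x :> fejer x" by simp
    have "isCont (\<lambda>x. (1 - cos x) / (pi * x\<^sup>2)) x" using x by (intro continuous_intros) auto
    moreover have "eventually (\<lambda>y. fejer y = (1 - cos y) / (pi * y\<^sup>2)) (nhds x)"
      using eventually_nhds_in_open[of "{0<..}" x] x by (auto elim!: eventually_mono simp: fejer_def)
    ultimately show "isCont fejer x" by (simp add: isCont_cong)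
  qed
  have nn: "AE x in lborel. 0 < ereal x \<longrightarrow> ereal x < \<infinity> \<longrightarrow> 0 \<le> fejer x" by (simp add: fejer_nonneg)
  have "(Si \<longlongrightarrow> 0) (at 0)" using isCont_Si[of 0] by (simp add: isCont_def Si_def zero_ereal_def[symmetric])
  then have "(F \<longlongrightarrow> (0 - 0) / pi) (at 0)" unfolding F_def by (intro tendsto_intros cosx) auto
  then have "(F \<longlongrightarrow> 0) (at_right 0)" by (simp add: filterlim_at_split)
  then have F0: "((F \<circ> real_of_ereal) \<longlongrightarrow> 0) (at_right 0)"
    using ereal_tendsto_simps(2)[of F 0 0] by (simp add: zero_ereal_def)
  have "(F \<longlongrightarrow> (pi / 2 - 0) / pi) at_top" unfolding F_def by (intro tendsto_intros Si_at_top cosinf) auto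
  then have Finf: "((F \<circ> real_of_ereal) \<longlongrightarrow> 1/2) (at_left \<infinity>)"
    by (simp add: ereal_tendsto_simps)
  note FTC = interval_integral_FTC_nonneg[OF _ deriv nn F0 Finf]
  have "einterval 0 \<infinity> = {0<..}" by (auto simp: einterval_def)
  then have "has_bochner_integral lborel (\<lambda>x. indicator {0<..} x *\<^sub>R fejer x) (1/2)"
    using FTC unfolding has_bochner_integral_iff interval_lebesgue_integral_def set_integrable_def set_lebesgue_integral_def
    by simp
  moreover have "AE x in lborel. (indicator {0<..} x *\<^sub>R fejer x :: real) = indicator {0..} x *\<^sub>R fejer x"
    using AE_lborel_singleton[of 0] by eventually_elim (auto simp: indicator_def)
  ultimately have "has_bochner_integral lborel (\<lambda>x. indicator {0..} x *\<^sub>R fejer x) (1/2)"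
    by (subst (asm) has_bochner_integral_cong_AE) auto
  from has_bochner_integral_even_function[OF this] show ?thesis by (simp add: fejer_even)
qed

text \<open>The kernel vanishes at the nonzero multiples of \<open>2 * pi\<close>, so one copy
  cannot dominate \<open>1 / (1 + x\<^sup>2)\<close>. A copy shifted by 1 fills these gaps: the two
  cosines never add up to more than \<open>2 * cos (1/2)\<close>. In this way a weighted error is
  later controlled by two Fejer expectations.\<close>

lemma fejer_shift_ge: "(1 - cos (1/2)) / pi * (1 / (1 + x\<^sup>2)) \<le> fejer x + fejer (x + 1)"
proof -
  have "cos x + cos (x + 1) = 2 * cos (x + 1/2) * cos (1/2)"
  proof -
    have "(x + (x + 1)) / 2 = x + 1/2" "(x - (x + 1)) / 2 = - (1/2)" by auto
    then show ?thesis using cos_plus_cos[of x "x + 1"] by (simp only: cos_minus)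
  qed
  also have "\<dots> \<le> 2 * 1 * cos (1/2)"
    using cos_gt_zero_pi[of "1/2"] pi_gt3 by (intro mult_right_mono mult_left_mono) auto
  finally have cc: "2 * (1 - cos (1/2)) \<le> (1 - cos x) + (1 - cos (x + 1))" by simp
  have "0 \<le> (x - 1)\<^sup>2" by simp
  then have q: "(x + 1)\<^sup>2 \<le> 2 + 2 * x\<^sup>2" by (simp add: power2_eq_square algebra_simps)
  have "(1 - cos (1/2)) / pi * (1 / (1 + x\<^sup>2)) = 2 * (1 - cos (1/2)) / (pi * (2 + 2 * x\<^sup>2))"
  proof -
    have "2 + 2 * x\<^sup>2 = 2 * (1 + x\<^sup>2)" by simp
    then show ?thesis by (simp only: times_divide_times_eq mult.left_commute[of pi 2] mult_divide_mult_cancel_left_if) simp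
  qed
  also have "\<dots> \<le> ((1 - cos x) + (1 - cos (x + 1))) / (pi * (2 + 2 * x\<^sup>2))"
    using cc by (intro divide_right_mono) auto
  also have "\<dots> = (1 - cos x) / (pi * (2 + 2 * x\<^sup>2)) + (1 - cos (x + 1)) / (pi * (2 + 2 * x\<^sup>2))"
    by (rule add_divide_distrib)
  also have "(1 - cos (x + 1)) / (pi * (2 + 2 * x\<^sup>2)) \<le> fejer (x + 1)"
  proof (cases "x + 1 = 0")
    case False
    have "(1 - cos (x + 1)) / (pi * (2 + 2 * x\<^sup>2)) \<le> (1 - cos (x + 1)) / (pi * (x + 1)\<^sup>2)"
      using q False by (intro divide_left_mono mult_left_mono mult_pos_pos) (auto intro: add_pos_nonneg)
    then show ?thesis using False by (simp add: fejer_def)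
  qed (simp add: fejer_def)
  also have "(1 - cos x) / (pi * (2 + 2 * x\<^sup>2)) \<le> fejer x" by (rule fejer_ge)
  finally show ?thesis by simp
qed

text \<open>The scaled kernel \<^term>\<open>\<lambda>x. T * fejer (T * x)\<close> has a Fourier transform supported in
  \<^term>\<open>{-T..T}\<close>, so its expectation only involves the characteristic function there.\<close>

lemma fejer_scaled_fourier:
  assumes "0 < c"
  shows "has_bochner_integral lborel (\<lambda>s. triangle (s / c) * cos (s * x)) (2 * pi * (c * fejer (c * x)))"
proof -
  have "has_bochner_integral lborel (\<lambda>s. triangle (0 + (1/c) * s) * cos ((0 + (1/c) * s) * (c * x))) ((2 * pi * fejer (c * x)) /\<^sub>R \<bar>1/c\<bar>)"
    using assms by (intro lborel_has_bochner_integral_real_affine_iff[THEN iffD1] fejer_fourier) auto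
  moreover have "triangle (0 + (1/c) * s) * cos ((0 + (1/c) * s) * (c * x)) = triangle (s / c) * cos (s * x)" for s
    using assms by simp
  ultimately show ?thesis using assms by (simp add: mult_ac)
qed

text \<open>Here \<open>s\<close> is the frequency on the scale of \<open>b\<close>, so the triangle
  cuts off at original frequency \<open>T\<close>. No shift occurs in the formula, which is the
  source of uniformity in \<open>u\<close>.\<close>

definition char_error :: "real measure \<Rightarrow> real \<Rightarrow> real \<Rightarrow> real" where
  "char_error \<nu> b T = (LINT s|lborel. norm (triangle (s / (b * T)) * char \<nu> (s / b) - complex_of_real (exp (- (s\<^sup>2 / 2)))))"

lemma gaussian_integrable: "integrable lborel (\<lambda>s::real. exp (- (s\<^sup>2 / 2)))"
  and gaussian_fourier: "(CLINT s|lborel. iexp (- (s * v)) * complex_of_real (exp (- (s\<^sup>2 / 2)))) = sqrt (2 * pi) * exp (- (v\<^sup>2 / 2))"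
proof -
  have eq: "sqrt (2 * pi) * std_normal_density s = exp (- (s\<^sup>2 / 2))" for s
    by (simp add: std_normal_density_def)
  have "integrable lborel (\<lambda>s. sqrt (2 * pi) * std_normal_density s)"
    by (intro integrable_mult_right integrable_normal_density) simp
  then show "integrable lborel (\<lambda>s::real. exp (- (s\<^sup>2 / 2)))" by (simp only: eq)
  have "char std_normal_distribution (- v) = (CLINT s|lborel. std_normal_density s *\<^sub>R iexp (- v * s))"
    unfolding char_def
  proof (rule integral_density)
    show "(\<lambda>s. iexp (- v * s)) \<in> borel_measurable lborel" by measurable
  qed auto
  then have "(CLINT s|lborel. std_normal_density s *\<^sub>R iexp (- v * s)) = exp (- (v\<^sup>2 / 2))"
    by (simp add: char_std_normal_distribution)
  then have "complex_of_real (sqrt (2 * pi) * exp (- (v\<^sup>2 / 2)))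
      = sqrt (2 * pi) * (CLINT s|lborel. std_normal_density s *\<^sub>R iexp (- v * s))"
    by (simp only: of_real_mult)
  also have "\<dots> = (CLINT s|lborel. complex_of_real (sqrt (2 * pi)) * (std_normal_density s *\<^sub>R iexp (- v * s)))"
    by (rule integral_mult_right_zero[symmetric])
  also have "(\<lambda>s. complex_of_real (sqrt (2 * pi)) * (std_normal_density s *\<^sub>R iexp (- v * s)))
     = (\<lambda>s. iexp (- (s * v)) * complex_of_real (exp (- (s\<^sup>2 / 2))))"
  proof
    fix s
    have "complex_of_real (sqrt (2 * pi)) * (std_normal_density s *\<^sub>R iexp (- v * s))
      = complex_of_real (sqrt (2 * pi) * std_normal_density s) * iexp (- v * s)"
      by (simp only: scaleR_conv_of_real of_real_mult mult.assoc)
    also note eq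
    finally show "complex_of_real (sqrt (2 * pi)) * (std_normal_density s *\<^sub>R iexp (- v * s))
      = iexp (- (s * v)) * complex_of_real (exp (- (s\<^sup>2 / 2)))" by (simp add: mult_ac)
  qed
  finally show "(CLINT s|lborel. iexp (- (s * v)) * complex_of_real (exp (- (s\<^sup>2 / 2)))) = sqrt (2 * pi) * exp (- (v\<^sup>2 / 2))"
    by simp
qed

lemma triangle_integrable:
  assumes "0 < c" shows "integrable lborel (\<lambda>s. triangle (s / c))"
  using has_bochner_integral_integrable fejer_scaled_fourier[OF assms, of 0] by (auto simp: has_bochner_integral_iff)

text \<open>By Fubini the expectation becomes an integral of the characteristic function against the
  triangle. The shift \<open>v\<close> contributes the same unimodular factor to this integral and
  to the Gaussian one, hence it disappears when the difference is estimated in absolute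
  value.\<close>

lemma fejer_expectation:
  assumes \<nu>: "real_distribution \<nu>" and b: "0 < b" and T: "0 < T"
  shows "\<bar>sqrt (2 * pi) * b * (LINT x|\<nu>. T * fejer (T * (x - v))) - exp (- (v\<^sup>2 / (2 * b\<^sup>2)))\<bar>
    \<le> char_error \<nu> b T"
proof -
  interpret real_distribution \<nu> by fact
  define c where "c = b * T"
  have c: "0 < c" using b T by (simp add: c_def)
  have kint: "2 * pi * (b * (T * fejer (T * (x - v)))) = (LINT s|lborel. triangle (s / c) * cos (s * ((x - v) / b)))" for x
    using has_bochner_integral_integral_eq[OF fejer_scaled_fourier[OF c, of "(x - v) / b"]] b
    by (simp add: c_def mult_ac)
  define h where "h x s = triangle (s / c) * iexp (s * ((x - v) / b))" for x s
  have hm [measurable]: "(\<lambda>(x, s). h x s) \<in> borel_measurable (\<nu> \<Otimes>\<^sub>M lborel)"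
    unfolding h_def by measurable
  have hn: "norm (h x s) = triangle (s / c)" for x s by (simp add: h_def norm_mult triangle_bounds)
  have hm' [measurable]: "h x \<in> borel_measurable lborel" for x unfolding h_def by measurable
  have hi: "integrable lborel (h x)" for x
    by (rule Bochner_Integration.integrable_bound[OF triangle_integrable[OF c] hm']) (simp add: hn triangle_bounds)
  interpret P: pair_sigma_finite \<nu> lborel ..
  have hpair: "integrable (\<nu> \<Otimes>\<^sub>M lborel) (\<lambda>(x, s). h x s)"
    by (rule P.Fubini_integrable[OF hm]) (auto simp: hn hi)
  have "2 * pi * (b * (LINT x|\<nu>. T * fejer (T * (x - v)))) = (LINT x|\<nu>. 2 * pi * (b * (T * fejer (T * (x - v)))))"
    by simp
  also have "\<dots> = (LINT x|\<nu>. Re (CLINT s|lborel. h x s))"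
  proof (rule Bochner_Integration.integral_cong[OF refl])
    fix x
    have "Re (CLINT s|lborel. h x s) = (LINT s|lborel. Re (h x s))" by (rule integral_Re[symmetric, OF hi])
    also have "(\<lambda>s. Re (h x s)) = (\<lambda>s. triangle (s / c) * cos (s * ((x - v) / b)))"
      by (simp add: h_def Re_exp del: of_real_mult of_real_divide of_real_diff)
    finally show "2 * pi * (b * (T * fejer (T * (x - v)))) = Re (CLINT s|lborel. h x s)" by (simp add: kint)
  qed
  also have "\<dots> = Re (CLINT x|\<nu>. CLINT s|lborel. h x s)"
    using P.integrable_fst[OF hpair] by (intro integral_Re) simp
  also have "(CLINT x|\<nu>. CLINT s|lborel. h x s) = (CLINT s|lborel. CLINT x|\<nu>. h x s)"
    using P.Fubini_integral[OF hpair] by simp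
  also have "(\<lambda>s. CLINT x|\<nu>. h x s) = (\<lambda>s. iexp (- (s * (v / b))) * (triangle (s / c) * char \<nu> (s / b)))"
  proof
    fix s
    have "(CLINT x|\<nu>. h x s) = (CLINT x|\<nu>. (iexp (- (s * (v / b))) * triangle (s / c)) * iexp (s / b * x))"
      unfolding h_def by (intro Bochner_Integration.integral_cong refl)
        (simp add: exp_add[symmetric] diff_divide_distrib algebra_simps)
    also have "\<dots> = (iexp (- (s * (v / b))) * triangle (s / c)) * char \<nu> (s / b)"
      unfolding char_def by (rule integral_mult_right_zero)
    finally show "(CLINT x|\<nu>. h x s) = iexp (- (s * (v / b))) * (triangle (s / c) * char \<nu> (s / b))"
      by (simp only: mult.assoc)
  qed
  finally have eq1: "2 * pi * (b * (LINT x|\<nu>. T * fejer (T * (x - v))))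
     = Re (CLINT s|lborel. iexp (- (s * (v / b))) * (triangle (s / c) * char \<nu> (s / b)))" .
  have eq2: "sqrt (2 * pi) * exp (- (v\<^sup>2 / (2 * b\<^sup>2)))
     = Re (CLINT s|lborel. iexp (- (s * (v / b))) * complex_of_real (exp (- (s\<^sup>2 / 2))))"
    unfolding gaussian_fourier by (simp add: power_divide mult.commute)
  have fm [measurable]: "(\<lambda>s. char \<nu> (s / b)) \<in> borel_measurable lborel" by measurable
  define p where "p s = iexp (- (s * (v / b))) * (triangle (s / c) * char \<nu> (s / b))" for s
  define q where "q s = iexp (- (s * (v / b))) * complex_of_real (exp (- (s\<^sup>2 / 2)))" for s
  have p: "integrable lborel p"
  proof (rule Bochner_Integration.integrable_bound[OF triangle_integrable[OF c]])
    show "p \<in> borel_measurable lborel" unfolding p_def by measurable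
    show "AE s in lborel. norm (p s) \<le> norm (triangle (s / c))"
      using cmod_char_le_1 triangle_bounds by (intro AE_I2) (simp add: p_def norm_mult mult_left_le)
  qed
  have q: "integrable lborel q"
  proof (rule Bochner_Integration.integrable_bound[OF gaussian_integrable])
    show "q \<in> borel_measurable lborel" unfolding q_def by measurable
  qed (simp add: q_def norm_mult del: of_real_exp)
  have pq: "norm (p s - q s) = norm (triangle (s / (b * T)) * char \<nu> (s / b) - complex_of_real (exp (- (s\<^sup>2 / 2))))" for s
    unfolding p_def q_def right_diff_distrib[symmetric] norm_mult by (simp add: c_def)
  have "\<bar>2 * pi * (b * (LINT x|\<nu>. T * fejer (T * (x - v)))) - sqrt (2 * pi) * exp (- (v\<^sup>2 / (2 * b\<^sup>2)))\<bar>
      = \<bar>Re (CLINT s|lborel. p s - q s)\<bar>"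
    unfolding eq1[folded p_def] eq2[folded q_def] using p q by simp
  also have "\<dots> \<le> norm (CLINT s|lborel. p s - q s)" by (rule abs_Re_le_cmod)
  also have "\<dots> \<le> (LINT s|lborel. norm (p s - q s))" by (rule integral_norm_bound)
  also have "\<dots> = char_error \<nu> b T" unfolding char_error_def pq ..
  finally have fin: "\<bar>2 * pi * (b * (LINT x|\<nu>. T * fejer (T * (x - v)))) - sqrt (2 * pi) * exp (- (v\<^sup>2 / (2 * b\<^sup>2)))\<bar>
      \<le> char_error \<nu> b T" .
  \<comment> \<open>Inversion gives \<open>2 * pi = r * r\<close> before the expectation and
    \<open>r\<close> before the Gaussian; dividing by \<open>r \<ge> 1\<close> keeps the
    bound.\<close>
  define r where "r = sqrt (2 * pi)"
  have r: "1 \<le> r" "2 * pi = r * r" using pi_gt3 by (auto simp: r_def)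
  define z where "z = r * b * (LINT x|\<nu>. T * fejer (T * (x - v))) - exp (- (v\<^sup>2 / (2 * b\<^sup>2)))"
  have "r * z = r * r * (b * (LINT x|\<nu>. T * fejer (T * (x - v)))) - r * exp (- (v\<^sup>2 / (2 * b\<^sup>2)))"
    by (simp only: z_def right_diff_distrib mult.assoc)
  then have "\<bar>r * z\<bar> \<le> char_error \<nu> b T"
    using fin r(1) unfolding r_def[symmetric] r(2) by (simp add: abs_of_nonneg)
  then have "r * \<bar>z\<bar> \<le> char_error \<nu> b T" using r(1) by (simp add: abs_mult)
  moreover have "1 * \<bar>z\<bar> \<le> r * \<bar>z\<bar>" using r by (intro mult_right_mono) auto
  ultimately show ?thesis by (simp add: z_def r_def)
qed

text \<open>Three ranges of original frequency: up to \<open>\<delta>\<close> dominated convergence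
  applies, between \<open>\<delta>\<close> and \<open>T\<close> the rate \<open>r n\<close> is
  multiplied by an interval of length \<open>2 * T * b n\<close>, and beyond \<open>T\<close> the
  triangle vanishes.\<close>

lemma char_error_tendsto_0:
  fixes \<mu> :: "nat \<Rightarrow> real measure" and b :: "nat \<Rightarrow> real"
  assumes \<mu>: "\<And>n. real_distribution (\<mu> n)" and b: "filterlim b at_top sequentially" and T: "0 < T"
    and lim: "\<And>s. (\<lambda>n. char (\<mu> n) (s / b n)) \<longlonglongrightarrow> complex_of_real (exp (- (s\<^sup>2 / 2)))"
    and \<delta>: "0 < \<delta>" and G: "integrable lborel G"
    and dom: "eventually (\<lambda>n. \<forall>s. \<bar>s\<bar> \<le> \<delta> * b n \<longrightarrow> norm (char (\<mu> n) (s / b n)) \<le> G s) sequentially"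
    and away: "eventually (\<lambda>n. \<forall>t. \<delta> \<le> \<bar>t\<bar> \<and> \<bar>t\<bar> \<le> T \<longrightarrow> norm (char (\<mu> n) t) \<le> r n) sequentially"
    and r0: "\<And>n. 0 \<le> r n" and r: "(\<lambda>n. b n * r n) \<longlonglongrightarrow> 0"
  shows "(\<lambda>n. char_error (\<mu> n) (b n) T) \<longlonglongrightarrow> 0"
proof -
  define E :: "real \<Rightarrow> complex" where "E s = complex_of_real (exp (- (s\<^sup>2 / 2)))" for s
  define f where "f n s = norm (triangle (s / (b n * T)) * char (\<mu> n) (s / b n) - E s)" for n s
  have Em [measurable]: "E \<in> borel_measurable borel" unfolding E_def by measurable
  have nE: "norm (E s) = exp (- (s\<^sup>2 / 2))" for s by (simp add: E_def del: of_real_exp)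
  have cm [measurable]: "char (\<mu> n) \<in> borel_measurable borel" for n
    using \<mu>[of n] by (rule real_distribution.char_measurable)
  have fm [measurable]: "f n \<in> borel_measurable borel" for n unfolding f_def by measurable
  \<comment> \<open>Outside the dominated range the Gaussian alone is kept, so \<open>A n\<close>
    has an integrable majorant and tends to 0 pointwise; the characteristic function removed there
    is estimated by \<open>r n\<close>.\<close>
  define A where "A n s = (if \<bar>s\<bar> \<le> \<delta> * b n then f n s else norm (E s))" for n s
  have Am [measurable]: "A n \<in> borel_measurable borel" for n unfolding A_def by measurable
  have bpos: "eventually (\<lambda>n. 0 < b n) sequentially"
    using b by (simp add: filterlim_at_top_dense)
  have tri: "norm (triangle u * char (\<mu> n) t) \<le> norm (char (\<mu> n) t)" for u t n
    using triangle_bounds[of u] by (simp add: norm_mult mult_left_le_one_le)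
  have dom': "eventually (\<lambda>n. AE s in lborel. norm (A n s) \<le> \<bar>G s\<bar> + exp (- (s\<^sup>2 / 2))) sequentially"
    using dom
  proof eventually_elim
    case (elim n)
    show ?case
    proof (rule AE_I2)
      fix s
      have "f n s \<le> norm (char (\<mu> n) (s / b n)) + exp (- (s\<^sup>2 / 2))"
        unfolding f_def nE[symmetric] by (rule order_trans[OF norm_triangle_ineq4]) (simp add: tri)
      moreover have "norm (char (\<mu> n) (s / b n)) \<le> \<bar>G s\<bar>" if "\<bar>s\<bar> \<le> \<delta> * b n"
        using elim that order_trans[OF _ abs_ge_self] by blast
      moreover have "0 \<le> f n s" by (simp add: f_def)
      ultimately show "norm (A n s) \<le> \<bar>G s\<bar> + exp (- (s\<^sup>2 / 2))"
        by (cases "\<bar>s\<bar> \<le> \<delta> * b n") (fastforce simp: A_def nE simp del: of_real_exp)+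
    qed
  qed
  have limA: "AE s in lborel. (\<lambda>n. A n s) \<longlonglongrightarrow> 0"
  proof (rule AE_I2)
    fix s
    have "((\<lambda>n. s / (b n * T)) \<longlongrightarrow> 0) sequentially"
      using b T by (intro tendsto_divide_0[OF tendsto_const] filterlim_at_top_imp_at_infinity
          filterlim_at_top_mult_tendsto_pos[OF tendsto_const]) auto
    then have "(\<lambda>n. triangle (s / (b n * T))) \<longlonglongrightarrow> max 0 (1 - \<bar>0\<bar>)"
      unfolding triangle_def by (intro tendsto_intros)
    then have "(\<lambda>n. triangle (s / (b n * T)) * char (\<mu> n) (s / b n) - E s) \<longlonglongrightarrow> complex_of_real (max 0 (1 - \<bar>0\<bar>)) * E s - E s"
      unfolding E_def by (intro tendsto_intros lim)
    then have "(\<lambda>n. f n s) \<longlonglongrightarrow> norm (complex_of_real (max 0 (1 - \<bar>0\<bar>)) * E s - E s)"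
      unfolding f_def by (rule tendsto_norm)
    then have f0: "(\<lambda>n. f n s) \<longlonglongrightarrow> 0" by simp
    have "eventually (\<lambda>n. \<bar>s\<bar> / \<delta> \<le> b n) sequentially" using b by (simp add: filterlim_at_top)
    then have "eventually (\<lambda>n. f n s = A n s) sequentially"
      by eventually_elim (use \<delta> in \<open>simp add: A_def field_simps\<close>)
    then show "(\<lambda>n. A n s) \<longlonglongrightarrow> 0" using f0 by (rule Lim_transform_eventually[rotated])
  qed
  have Gi: "integrable lborel (\<lambda>s. \<bar>G s\<bar> + exp (- (s\<^sup>2 / 2)))" using G gaussian_integrable by auto
  \<comment> \<open>Domination holds only from some index on, while dominated convergence asks for
    all n; hence the shift of the sequence by \<open>N\<close>.\<close>
  obtain N where N: "\<And>n. n \<ge> N \<Longrightarrow> AE s in lborel. norm (A n s) \<le> \<bar>G s\<bar> + exp (- (s\<^sup>2 / 2))"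
    using dom' unfolding eventually_sequentially by blast
  have "(\<lambda>n. LINT s|lborel. A (n + N) s) \<longlonglongrightarrow> (LINT s|(lborel :: real measure). 0)"
  proof (rule integral_dominated_convergence[where w="\<lambda>s. \<bar>G s\<bar> + exp (- (s\<^sup>2 / 2))"])
    show "AE s in lborel. (\<lambda>n. A (n + N) s) \<longlonglongrightarrow> 0"
      using limA by eventually_elim (rule LIMSEQ_ignore_initial_segment)
  qed (use N Gi in auto)
  then have "(\<lambda>n. LINT s|lborel. A n s) \<longlonglongrightarrow> (LINT s|(lborel :: real measure). 0)" by (rule LIMSEQ_offset)
  then have lim1: "(\<lambda>n. (LINT s|lborel. A n s) + 2 * T * (b n * r n)) \<longlonglongrightarrow> 0 + 2 * T * 0"
    by (intro tendsto_intros r) simp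
  have "eventually (\<lambda>n. norm (char_error (\<mu> n) (b n) T) \<le> (LINT s|lborel. A n s) + 2 * T * (b n * r n)) sequentially"
    using dom' away bpos
  proof eventually_elim
    case (elim n)
    have Ai: "integrable lborel (A n)"
      by (rule Bochner_Integration.integrable_bound[OF Gi]) (use elim(1) in \<open>auto elim!: eventually_mono\<close>)
    have bT: "0 < b n * T" using elim T by simp
    have ii: "integrable lborel (\<lambda>s. r n * indicator {- (b n * T)..b n * T} s)"
      by (intro integrable_mult_right integrable_real_indicator) (auto simp: emeasure_lborel_Icc_eq)
    have fle: "f n s \<le> A n s + r n * indicator {- (b n * T)..b n * T} s" for s
    proof (cases "\<bar>s\<bar> \<le> \<delta> * b n")
      case True
      have "0 \<le> r n * indicator {- (b n * T)..b n * T} s" using r0 by simp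
      then show ?thesis using True by (simp add: A_def)
    next
      case False
      have "norm (triangle (s / (b n * T)) * char (\<mu> n) (s / b n)) \<le> r n * indicator {- (b n * T)..b n * T} s"
      proof (cases "\<bar>s\<bar> \<le> b n * T")
        case True
        then have "norm (char (\<mu> n) (s / b n)) \<le> r n"
          using False elim(2,3) by (auto simp: field_simps)
        then show ?thesis using tri[of "s / (b n * T)" n "s / b n"] True by (auto simp: indicator_def)
      next
        case False
        then have "triangle (s / (b n * T)) = 0" using bT by (intro triangle_bounds) (simp add: field_simps)
        then show ?thesis using False by (auto simp: indicator_def)
      qed
      then show ?thesis using False norm_triangle_ineq4[of "triangle (s / (b n * T)) * char (\<mu> n) (s / b n)" "E s"]
        by (simp add: A_def f_def)
    qed
    have "char_error (\<mu> n) (b n) T = (LINT s|lborel. f n s)" by (simp add: char_error_def f_def E_def)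
    also have "\<dots> \<le> (LINT s|lborel. A n s + r n * indicator {- (b n * T)..b n * T} s)"
    proof (rule integral_mono)
      show si: "integrable lborel (\<lambda>s. A n s + r n * indicator {- (b n * T)..b n * T} s)"
        using Ai ii by (rule Bochner_Integration.integrable_add)
      show "integrable lborel (f n)"
        by (rule Bochner_Integration.integrable_bound[OF si])
          (use fle in \<open>auto simp: f_def intro: order_trans[OF _ abs_ge_self]\<close>)
    qed (rule fle)
    also have "\<dots> = (LINT s|lborel. A n s) + 2 * T * (b n * r n)"
      using Ai ii bT by simp
    finally show ?case by (simp add: char_error_def integral_nonneg_AE)
  qed
  from Lim_null_comparison[OF this] lim1 show ?thesis by simp
qed

section \<open>Approximation of compactly supported functions by Fejer means\<close>

lemma fejer_tail_tendsto_0: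
  "((\<lambda>R. LINT w|lborel. fejer w * indicator {w. R < \<bar>w\<bar>} w) \<longlongrightarrow> 0) at_top"
proof -
  have "((\<lambda>R. LINT w|lborel. fejer w * indicator {w. R < \<bar>w\<bar>} w) \<longlongrightarrow> (LINT w|(lborel :: real measure). 0)) at_top"
  proof (rule integral_dominated_convergence_at_top)
    show "integrable lborel fejer" using fejer_integral by (simp add: has_bochner_integral_iff)
    show "AE w in lborel. ((\<lambda>R. fejer w * indicator {w. R < \<bar>w\<bar>} w) \<longlongrightarrow> 0) at_top"
    proof (rule AE_I2, rule tendsto_eventually)
      show "eventually (\<lambda>R. fejer w * indicator {w. R < \<bar>w\<bar>} w = 0) at_top" for w :: real
        using eventually_ge_at_top[of "\<bar>w\<bar>"] by eventually_elim auto
    qed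
    show "\<forall>\<^sub>F R in at_top. AE w in lborel. norm (fejer w * indicator {w. R < \<bar>w\<bar>} w) \<le> fejer w"
      by (auto simp: indicator_def fejer_nonneg)
  qed auto
  then show ?thesis by simp
qed

lemma fejer_scaled_integral:
  assumes "0 < T"
  shows "has_bochner_integral lborel (\<lambda>y. T * fejer (T * (x - y))) 1"
proof -
  have "has_bochner_integral lborel (\<lambda>y. fejer (T * x + (- T) * y)) (1 /\<^sub>R \<bar>- T\<bar>)"
    using assms by (intro lborel_has_bochner_integral_real_affine_iff[THEN iffD1] fejer_integral) auto
  from has_bochner_integral_mult_right[OF this, of T] show ?thesis
    using assms by (simp add: algebra_simps)
qed

lemma compact_support_bounded:
  fixes h :: "real \<Rightarrow> real"
  assumes h: "continuous_on UNIV h" and supp: "compact (closure {x. h x \<noteq> 0})"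
  shows "\<exists>A B. 1 \<le> A \<and> 1 \<le> B \<and> (\<forall>x. A < \<bar>x\<bar> \<longrightarrow> h x = 0) \<and> (\<forall>x. \<bar>h x\<bar> \<le> B) \<and>
    uniformly_continuous_on UNIV h"
proof -
  have "bounded {x. h x \<noteq> 0}" using compact_imp_bounded[OF supp] bounded_subset closure_subset by blast
  then obtain A0 where A0: "\<And>x. h x \<noteq> 0 \<Longrightarrow> \<bar>x\<bar> \<le> A0" unfolding bounded_iff by auto
  define A where "A = max 1 A0"
  have A: "1 \<le> A" "\<And>x. A < \<bar>x\<bar> \<Longrightarrow> h x = 0" using A0 by (force simp: A_def)+
  have "bounded (h ` {- A..A})"
    by (intro compact_imp_bounded compact_continuous_image continuous_on_subset[OF h]) auto
  then obtain B0 where B0: "\<And>x. x \<in> {- A..A} \<Longrightarrow> \<bar>h x\<bar> \<le> B0"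
    unfolding bounded_iff by (metis imageI real_norm_def)
  define B where "B = max 1 B0"
  have B: "1 \<le> B" "\<bar>h x\<bar> \<le> B" for x
    using B0[of x] A(2)[of x] by (cases "A < \<bar>x\<bar>"; force simp: B_def)+
  \<comment> \<open>The margin 2 serves pairs at distance below 1: either both points lie in this
    interval, or both lie outside \<open>{- A..A}\<close>, where \<open>h\<close> vanishes.\<close>
  have "uniformly_continuous_on {- (A + 2)..A + 2} h"
    by (intro compact_uniformly_continuous continuous_on_subset[OF h]) auto
  then have "uniformly_continuous_on UNIV h"
    unfolding uniformly_continuous_on_def
  proof (intro allI impI)
    fix e :: real assume e: "0 < e"
      and uc: "\<forall>e>0. \<exists>d>0. \<forall>x\<in>{- (A + 2)..A + 2}. \<forall>x'\<in>{- (A + 2)..A + 2}. dist x' x < d \<longrightarrow> dist (h x') (h x) < e"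
    from uc e obtain d where d: "d > 0" "\<And>x x'. x\<in>{- (A + 2)..A + 2} \<Longrightarrow> x'\<in>{- (A + 2)..A + 2} \<Longrightarrow> dist x' x < d \<Longrightarrow> dist (h x') (h x) < e"
      by blast
    show "\<exists>d>0. \<forall>x\<in>UNIV. \<forall>x'\<in>UNIV. dist x' x < d \<longrightarrow> dist (h x') (h x) < e"
    proof (intro exI[of _ "min d 1"] conjI ballI impI)
      fix x x' :: real assume dx: "dist x' x < min d 1"
      show "dist (h x') (h x) < e"
      proof (cases "\<bar>x\<bar> \<le> A + 1")
        case True
        then show ?thesis using dx by (intro d(2)) (auto simp: dist_real_def)
      next
        case False
        then have "h x = 0" "h x' = 0" using dx by (auto intro!: A(2) simp: dist_real_def)
        then show ?thesis using e by simp
      qed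
    qed (use d in auto)
  qed
  with A B show ?thesis by blast
qed

lemma fejer_le_1: "fejer x \<le> 1"
proof -
  have "2 * pi * fejer x = (LINT t|lborel. triangle t * cos (t * x))"
    using has_bochner_integral_integral_eq[OF fejer_fourier] by simp
  also have "\<dots> \<le> (LINT t|lborel. triangle t * cos (t * 0))"
  proof (rule integral_mono)
    show "integrable lborel (\<lambda>t. triangle t * cos (t * y))" for y
      using fejer_fourier[of y] by (simp add: has_bochner_integral_iff)
    then show "integrable lborel (\<lambda>t. triangle t * cos (t * 0))" .
    show "triangle t * cos (t * x) \<le> triangle t * cos (t * 0)" for t
      using triangle_bounds[of t] by (intro mult_left_mono) auto
  qed
  also have "\<dots> = 1" using has_bochner_integral_integral_eq[OF fejer_fourier, of 0] by (simp add: fejer_def)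
  finally have "2 * pi * fejer x \<le> 1" .
  moreover have "fejer x \<le> 2 * pi * fejer x"
    using pi_gt3 fejer_nonneg[of x] mult_right_mono[of 1 "2 * pi" "fejer x"] by simp
  ultimately show ?thesis by linarith
qed

definition fejer_smooth :: "(real \<Rightarrow> real) \<Rightarrow> real \<Rightarrow> real \<Rightarrow> real" where
  "fejer_smooth h T x = (LINT y|lborel. h y * (T * fejer (T * (x - y))))"

text \<open>A merely uniform error would be useless, since the expectation is later multiplied by
  \<open>b n\<close>. The weight \<open>1 / (1 + x\<^sup>2)\<close> makes the error comparable to
  Fejer kernels. On \<open>|x| \<le> 2 * A\<close> it follows from uniform continuity, further out
  from the quadratic decay of the kernel.\<close>

lemma fejer_smooth_error:
  fixes h :: "real \<Rightarrow> real"
  assumes h: "continuous_on UNIV h" and supp: "compact (closure {x. h x \<noteq> 0})" and \<epsilon>: "0 < \<epsilon>"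
  shows "\<exists>T>0. \<forall>x. \<bar>fejer_smooth h T x - h x\<bar> \<le> \<epsilon> * (1 / (1 + x\<^sup>2))"
proof -
  obtain A B where A1: "1 \<le> A" and B1: "1 \<le> B" and A2: "\<And>x. A < \<bar>x\<bar> \<Longrightarrow> h x = 0" and B2: "\<And>x. \<bar>h x\<bar> \<le> B"
    and uc: "uniformly_continuous_on UNIV h" using compact_support_bounded[OF h supp] by blast
  note A = A1 A2 and B = B1 B2
  have hm [measurable]: "h \<in> borel_measurable borel" using h by (rule borel_measurable_continuous_onI)
  \<comment> \<open>On the inner range \<open>|x| \<le> 2 * A\<close> the weight is at least
    \<open>1 / (1 + 4 * A\<^sup>2)\<close>.\<close>
  define \<epsilon>1 where "\<epsilon>1 = \<epsilon> / (1 + 4 * A\<^sup>2)"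
  have \<epsilon>1: "0 < \<epsilon>1" using \<epsilon> by (simp add: \<epsilon>1_def add_pos_nonneg)
  obtain \<delta> where \<delta>: "\<delta> > 0" "\<And>x y. \<bar>x - y\<bar> < \<delta> \<Longrightarrow> \<bar>h x - h y\<bar> < \<epsilon>1 / 2"
    using uc[unfolded uniformly_continuous_on_def, rule_format, of "\<epsilon>1 / 2"] \<epsilon>1
    by (auto simp: dist_real_def)
  have "eventually (\<lambda>R. (LINT w|lborel. fejer w * indicator {w. R < \<bar>w\<bar>} w) < \<epsilon>1 / (4 * B)) at_top"
    using order_tendstoD(2)[OF fejer_tail_tendsto_0, of "\<epsilon>1 / (4 * B)"] \<epsilon>1 B by simp
  then obtain R0 where R0: "\<And>R. R \<ge> R0 \<Longrightarrow> (LINT w|lborel. fejer w * indicator {w. R < \<bar>w\<bar>} w) < \<epsilon>1 / (4 * B)"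
    unfolding eventually_at_top_linorder by blast
  \<comment> \<open>The second entry makes the kernel mass beyond distance
    \<open>\<delta> / 2\<close> small, the third makes the far bound
    \<open>16 * A * B / (pi * T)\<close> at most \<open>\<epsilon> / 2\<close>; the remaining factor
    2 pays for \<open>1 + x\<^sup>2 \<le> 2 * x\<^sup>2\<close>.\<close>
  define T where "T = Max {1, 2 * R0 / \<delta>, 32 * A * B / (pi * \<epsilon>)}"
  have T: "1 \<le> T" "2 * R0 / \<delta> \<le> T" "32 * A * B / (pi * \<epsilon>) \<le> T" by (auto simp: T_def)
  define I where "I = (LINT w|lborel. fejer w * indicator {w. T * \<delta> / 2 < \<bar>w\<bar>} w)"
  have I: "I < \<epsilon>1 / (4 * B)"
    unfolding I_def using T(2) \<delta>(1) by (intro R0) (simp add: field_simps)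
  have fi: "integrable lborel fejer" using fejer_integral by (simp add: has_bochner_integral_iff)
  have ki: "integrable lborel (\<lambda>y. T * fejer (T * (x - y)))" "(LINT y|lborel. T * fejer (T * (x - y))) = 1" for x
    using fejer_scaled_integral[of T x] T(1) by (simp_all add: has_bochner_integral_iff)
  have ti: "has_bochner_integral lborel (\<lambda>y. T * fejer (T * (x - y)) * indicator {y. \<delta> / 2 < \<bar>x - y\<bar>} y) I" for x
  proof -
    have "has_bochner_integral lborel (\<lambda>w. fejer w * indicator {w. T * \<delta> / 2 < \<bar>w\<bar>} w) I"
      unfolding has_bochner_integral_iff I_def
      by (auto intro!: Bochner_Integration.integrable_bound[OF fi] simp: indicator_def)
    then have "has_bochner_integral lborel (\<lambda>y. fejer (T * x + (- T) * y) * indicator {w. T * \<delta> / 2 < \<bar>w\<bar>} (T * x + (- T) * y)) (I /\<^sub>R \<bar>- T\<bar>)"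
      using T(1) by (intro lborel_has_bochner_integral_real_affine_iff[THEN iffD1]) auto
    from has_bochner_integral_mult_right[OF this, of T]
    have "has_bochner_integral lborel (\<lambda>y. T * (fejer (T * x + (- T) * y) * indicator {w. T * \<delta> / 2 < \<bar>w\<bar>} (T * x + (- T) * y))) (T * (I /\<^sub>R \<bar>- T\<bar>))"
      by simp
    moreover have "T * (I /\<^sub>R \<bar>- T\<bar>) = I" using T(1) by simp
    moreover have "T * (fejer (T * x + (- T) * y) * indicator {w. T * \<delta> / 2 < \<bar>w\<bar>} (T * x + (- T) * y))
       = T * fejer (T * (x - y)) * indicator {y. \<delta> / 2 < \<bar>x - y\<bar>} y" for y
    proof -
      have "T * x + (- T) * y = T * (x - y)" by (simp add: algebra_simps)
      moreover have "T * \<delta> / 2 < \<bar>T * (x - y)\<bar> \<longleftrightarrow> \<delta> / 2 < \<bar>x - y\<bar>"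
      proof -
        have "\<bar>T * (x - y)\<bar> = T * \<bar>x - y\<bar>" using T(1) by (simp only: abs_mult)
        then show ?thesis using mult_less_cancel_left_pos[of T "\<delta> / 2" "\<bar>x - y\<bar>"] T(1) by simp
      qed
      ultimately show ?thesis by (simp add: indicator_def)
    qed
    ultimately show ?thesis by (simp only:)
  qed
  have si: "integrable lborel (\<lambda>y. h y * (T * fejer (T * (x - y))))" for x
    by (rule Bochner_Integration.integrable_bound[OF integrable_mult_right[OF ki(1)[of x], of B]])
      (use B T(1) in \<open>auto simp: abs_mult fejer_nonneg intro!: mult_right_mono\<close>)
  have near: "\<bar>fejer_smooth h T x - h x\<bar> \<le> \<epsilon>1" for x
  proof -
    have "fejer_smooth h T x - h x = (LINT y|lborel. (h y - h x) * (T * fejer (T * (x - y))))"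
      unfolding fejer_smooth_def left_diff_distrib using si[of x] ki[of x] by simp
    also have "\<bar>\<dots>\<bar> \<le> (LINT y|lborel. \<bar>(h y - h x) * (T * fejer (T * (x - y)))\<bar>)"
      by (rule integral_abs_bound)
    also have "\<dots> \<le> (LINT y|lborel. \<epsilon>1 / 2 * (T * fejer (T * (x - y))) + 2 * B * (T * fejer (T * (x - y)) * indicator {y. \<delta> / 2 < \<bar>x - y\<bar>} y))"
    proof (rule integral_mono)
      show "integrable lborel (\<lambda>y. \<bar>(h y - h x) * (T * fejer (T * (x - y)))\<bar>)"
        unfolding left_diff_distrib using si[of x] ki(1)[of x] by auto
      show "integrable lborel (\<lambda>y. \<epsilon>1 / 2 * (T * fejer (T * (x - y))) + 2 * B * (T * fejer (T * (x - y)) * indicator {y. \<delta> / 2 < \<bar>x - y\<bar>} y))"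
        using ki(1)[of x] ti[of x] by (intro Bochner_Integration.integrable_add integrable_mult_right) (auto simp: has_bochner_integral_iff)
      fix y
      define k where "k = T * fejer (T * (x - y))"
      have k: "0 \<le> k" using T(1) fejer_nonneg by (simp add: k_def)
      have "\<bar>h y - h x\<bar> \<le> \<epsilon>1 / 2 + 2 * B * indicator {y. \<delta> / 2 < \<bar>x - y\<bar>} y"
      proof (cases "\<delta> / 2 < \<bar>x - y\<bar>")
        case True
        then show ?thesis using B(2)[of x] B(2)[of y] \<epsilon>1 by (simp add: abs_if split: if_splits)
      next
        case False
        then show ?thesis using \<delta>(2)[of y x] \<delta>(1) by (simp add: abs_minus_commute)
      qed
      from mult_right_mono[OF this k]
      have "\<bar>(h y - h x) * k\<bar> \<le> \<epsilon>1 / 2 * k + 2 * B * (k * indicator {y. \<delta> / 2 < \<bar>x - y\<bar>} y)"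
        unfolding abs_mult abs_of_nonneg[OF k] by (simp only: distrib_right distrib_left mult_ac)
      then show "\<bar>(h y - h x) * (T * fejer (T * (x - y)))\<bar> \<le> \<epsilon>1 / 2 * (T * fejer (T * (x - y))) + 2 * B * (T * fejer (T * (x - y)) * indicator {y. \<delta> / 2 < \<bar>x - y\<bar>} y)"
        by (simp add: k_def)
    qed
    also have "\<dots> = \<epsilon>1 / 2 * 1 + 2 * B * I"
      using ki[of x] ti[of x] unfolding has_bochner_integral_iff by simp
    also have "\<dots> \<le> \<epsilon>1 / 2 + \<epsilon>1 / 2" using I B(1) by (simp add: field_simps)
    finally show ?thesis by simp
  qed
  have far: "\<bar>fejer_smooth h T x\<bar> \<le> 16 * A * B / (pi * T * x\<^sup>2)" if x: "2 * A < \<bar>x\<bar>" for x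
  proof -
    have "\<bar>fejer_smooth h T x\<bar> \<le> (LINT y|lborel. \<bar>h y * (T * fejer (T * (x - y)))\<bar>)"
      unfolding fejer_smooth_def by (rule integral_abs_bound)
    also have "\<dots> \<le> (LINT y|lborel. 8 * B / (pi * T * x\<^sup>2) * indicator {- A..A} y)"
    proof (rule integral_mono)
      show "integrable lborel (\<lambda>y. \<bar>h y * (T * fejer (T * (x - y)))\<bar>)" using si[of x] by auto
      show "integrable lborel (\<lambda>y. 8 * B / (pi * T * x\<^sup>2) * indicator {- A..A} y)"
        by (intro integrable_mult_right integrable_real_indicator) (auto simp: emeasure_lborel_Icc_eq)
      fix y
      show "\<bar>h y * (T * fejer (T * (x - y)))\<bar> \<le> 8 * B / (pi * T * x\<^sup>2) * indicator {- A..A} y"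
      proof (cases "\<bar>y\<bar> \<le> A")
        case True
        have xy: "\<bar>x\<bar> / 2 \<le> \<bar>x - y\<bar>" using x True by linarith
        have x0: "0 < \<bar>x\<bar>" using x A(1) by linarith
        then have "x - y \<noteq> 0" using xy by auto
        then have "T * fejer (T * (x - y)) \<le> T * (2 / (pi * (T * (x - y))\<^sup>2))"
          using T(1) by (intro mult_left_mono fejer_le) auto
        also have "\<dots> = 2 / (pi * T * \<bar>x - y\<bar>\<^sup>2)"
          using T(1) by (simp add: power2_eq_square)
        also have "\<dots> \<le> 2 / (pi * T * (\<bar>x\<bar> / 2)\<^sup>2)"
          using T(1) x0 xy by (intro divide_left_mono mult_left_mono power_mono mult_pos_pos) auto
        also have "\<dots> = 8 / (pi * T * x\<^sup>2)" by (simp add: power_divide)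
        finally have "\<bar>h y\<bar> * (T * fejer (T * (x - y))) \<le> B * (8 / (pi * T * x\<^sup>2))"
          using B T(1) fejer_nonneg by (intro mult_mono) auto
        then show ?thesis using True T(1) fejer_nonneg[of "T * (x - y)"] by (simp add: abs_mult abs_le_iff mult_ac)
      next
        case False
        then show ?thesis using A(2)[of y] by (auto simp: indicator_def)
      qed
    qed
    also have "\<dots> = 16 * A * B / (pi * T * x\<^sup>2)" using A(1) by simp
    finally show ?thesis .
  qed
  have "\<bar>fejer_smooth h T x - h x\<bar> \<le> \<epsilon> * (1 / (1 + x\<^sup>2))" for x
  proof (cases "2 * A < \<bar>x\<bar>")
    case True
    then have x1: "1 \<le> \<bar>x\<bar>" using A(1) by linarith
    then have "1\<^sup>2 \<le> \<bar>x\<bar>\<^sup>2" by (intro power_mono) auto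
    then have x2: "1 + x\<^sup>2 \<le> 2 * x\<^sup>2" "0 < x\<^sup>2" by auto
    have "32 * A * B \<le> \<epsilon> * (pi * T)" using T(3) \<epsilon> by (simp add: field_simps)
    then have le: "16 * A * B / (pi * T) \<le> \<epsilon> / 2" using T(1) by (simp add: field_simps)
    have "h x = 0" using True A(1) by (intro A(2)) linarith
    then have "\<bar>fejer_smooth h T x - h x\<bar> \<le> 16 * A * B / (pi * T * x\<^sup>2)" using far[OF True] by simp
    also have "\<dots> = 16 * A * B / (pi * T) / x\<^sup>2" by simp
    also have "\<dots> \<le> \<epsilon> / 2 / x\<^sup>2" using le by (intro divide_right_mono) auto
    also have "\<dots> = \<epsilon> * (1 / (2 * x\<^sup>2))" by simp
    also have "\<dots> \<le> \<epsilon> * (1 / (1 + x\<^sup>2))"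
      using x2 \<epsilon> by (intro mult_left_mono divide_left_mono mult_pos_pos) (auto intro: add_pos_nonneg)
    finally show ?thesis .
  next
    case False
    then have "\<bar>x\<bar>\<^sup>2 \<le> (2 * A)\<^sup>2" by (intro power_mono) auto
    then have "1 + x\<^sup>2 \<le> 1 + 4 * A\<^sup>2" by (simp add: power_mult_distrib)
    then have "\<epsilon>1 \<le> \<epsilon> / (1 + x\<^sup>2)"
      unfolding \<epsilon>1_def using \<epsilon> by (intro divide_left_mono mult_pos_pos) (auto intro: add_pos_nonneg)
    then show ?thesis using near[of x] by simp
  qed
  then show ?thesis using T(1) by (intro exI[of _ T]) auto
qed

lemma gaussian_lipschitz: "\<bar>exp (- (x\<^sup>2 / 2)) - exp (- (y\<^sup>2 / 2))\<bar> \<le> \<bar>x - y\<bar>" for x y :: real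
proof -
  have "norm (exp (- (x\<^sup>2 / 2)) - exp (- (y\<^sup>2 / 2))) \<le> 1 * norm (x - y)"
  proof (rule field_differentiable_bound[where S = UNIV and f' = "\<lambda>z. - z * exp (- (z\<^sup>2 / 2))"])
    fix z :: real
    show "((\<lambda>z. exp (- (z\<^sup>2 / 2))) has_field_derivative - z * exp (- (z\<^sup>2 / 2))) (at z within UNIV)"
      by (auto intro!: derivative_eq_intros)
    have "\<bar>z\<bar> \<le> 1 + z\<^sup>2 / 2" using zero_le_power2[of "\<bar>z\<bar> - 1"] by (simp add: power2_eq_square algebra_simps)
    also have "\<dots> \<le> exp (z\<^sup>2 / 2)" by (rule exp_ge_add_one_self)
    finally show "norm (- z * exp (- (z\<^sup>2 / 2))) \<le> 1"
      by (simp add: abs_mult exp_minus field_simps)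
  qed auto
  then show ?thesis by simp
qed

text \<open>The Fejer mean of \<open>h\<close> is a superposition of shifted Fejer kernels, so
  Fubini reduces it to \<open>fejer_expectation\<close>; replacing the shift \<open>u + y\<close> by
  \<open>u\<close> costs at most \<open>A / b n\<close>, because the Gaussian is Lipschitz and
  \<open>h\<close> lives on \<open>|y| \<le> A\<close>. The smoothing error is dominated by two
  kernels of bandwidth 1, whose normalised expectations stay bounded uniformly in the shift.\<close>

theorem local_limit_criterion:
  fixes \<mu> :: "nat \<Rightarrow> real measure" and b :: "nat \<Rightarrow> real" and h :: "real \<Rightarrow> real"
  assumes \<mu>: "\<And>n. real_distribution (\<mu> n)" and b: "filterlim b at_top sequentially"
    and err: "\<And>T. 0 < T \<Longrightarrow> (\<lambda>n. char_error (\<mu> n) (b n) T) \<longlonglongrightarrow> 0"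
    and h: "continuous_on UNIV h" and supp: "compact (closure {x. h x \<noteq> 0})" and \<epsilon>: "0 < \<epsilon>"
  shows "eventually (\<lambda>n. \<forall>u. \<bar>sqrt (2 * pi) * b n * (LINT x|\<mu> n. h (x - u))
    - exp (- (u\<^sup>2 / (2 * (b n)\<^sup>2))) * (LINT x|lborel. h x)\<bar> \<le> \<epsilon>) sequentially"
proof -
  obtain A B where A1: "1 \<le> A" and B1: "1 \<le> B" and A2: "\<And>x. A < \<bar>x\<bar> \<Longrightarrow> h x = 0" and B2: "\<And>x. \<bar>h x\<bar> \<le> B"
    and uc: "uniformly_continuous_on UNIV h" using compact_support_bounded[OF h supp] by blast
  note A = A1 A2 and B = B1 B2
  have hm [measurable]: "h \<in> borel_measurable borel" using h by (rule borel_measurable_continuous_onI)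
  have hi: "integrable lborel h"
  proof (rule Bochner_Integration.integrable_bound)
    show "integrable lborel (\<lambda>y. B * indicator {- A..A} y)"
      by (intro integrable_mult_right integrable_real_indicator) (auto simp: emeasure_lborel_Icc_eq)
    show "AE x in lborel. norm (h x) \<le> norm (B * indicator {- A..A} x)"
      using A(2) B by (intro AE_I2) (auto simp: indicator_def abs_le_iff not_le)
  qed simp
  define N where "N = (LINT y|lborel. \<bar>h y\<bar>)"
  have N: "0 \<le> N" by (simp add: N_def)
  define c0 where "c0 = (1 - cos (1/2)) / pi"
  have c0: "0 < c0" using cos_monotone_0_pi[of 0 "1/2"] pi_gt3 by (simp add: c0_def)
  \<comment> \<open>Two kernel expectations, each at most 2 after normalisation, give
    \<open>4 * \<eta> / c0 = \<epsilon> / 2\<close>.\<close>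
  define \<eta> where "\<eta> = \<epsilon> * c0 / 8"
  have \<eta>: "0 < \<eta>" using \<epsilon> c0 by (simp add: \<eta>_def)
  obtain T where T: "0 < T" and sm: "\<And>x. \<bar>fejer_smooth h T x - h x\<bar> \<le> \<eta> * (1 / (1 + x\<^sup>2))"
    using fejer_smooth_error[OF h supp \<eta>] by blast
  \<comment> \<open>Bandwidth 1 belongs to the error weight: with the Gaussian at most 1, it bounds
    the normalised expectations by 2.\<close>
  have ev1: "eventually (\<lambda>n. char_error (\<mu> n) (b n) 1 < 1) sequentially"
    using order_tendstoD(2)[OF err[of 1], of 1] by simp
  have "(\<lambda>n. (char_error (\<mu> n) (b n) T + A / b n) * N) \<longlonglongrightarrow> (0 + 0) * N"
    using b by (intro tendsto_intros err T tendsto_divide_0[OF tendsto_const] filterlim_at_top_imp_at_infinity)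
  then have ev2: "eventually (\<lambda>n. (char_error (\<mu> n) (b n) T + A / b n) * N < \<epsilon> / 2) sequentially"
    using order_tendstoD(2)[of _ 0 sequentially "\<epsilon> / 2"] \<epsilon> by simp
  have ev3: "eventually (\<lambda>n. 0 < b n) sequentially" using b by (simp add: filterlim_at_top_dense)
  show ?thesis
    using ev1 ev2 ev3
  proof eventually_elim
    case (elim n)
    interpret real_distribution "\<mu> n" by (rule \<mu>)
    define s where "s = sqrt (2 * pi) * b n"
    have s: "0 < s" using elim by (simp add: s_def)
    define \<gamma> where "\<gamma> v = exp (- (v\<^sup>2 / (2 * (b n)\<^sup>2)))" for v
    have \<gamma>1: "0 \<le> \<gamma> v" "\<gamma> v \<le> 1" for v by (auto simp: \<gamma>_def)
    define k where "k T v = (LINT x|\<mu> n. T * fejer (T * (x - v)))" for T v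
    have kerr: "\<bar>s * k T v - \<gamma> v\<bar> \<le> char_error (\<mu> n) (b n) T" if "0 < T" for T v
      unfolding s_def k_def \<gamma>_def using fejer_expectation[OF \<mu> elim(3) that] .
    have fint: "integrable (\<mu> n) (\<lambda>x. fejer (c * x + d))" for c d
      using fejer_le_1 fejer_nonneg by (intro integrable_const_bound[of _ 1]) auto
    show ?case
    proof
      fix u
      have hint: "integrable (\<mu> n) (\<lambda>x. h (x - u))"
        using B by (intro integrable_const_bound[of _ B]) auto
      define H where "H x y = h y * (T * fejer (T * (x - u - y)))" for x y
      have Hm [measurable]: "(\<lambda>(x, y). H x y) \<in> borel_measurable (\<mu> n \<Otimes>\<^sub>M lborel)"
        unfolding H_def by measurable
      have Hb: "\<bar>H x y\<bar> \<le> T * \<bar>h y\<bar>" for x y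
        using T fejer_nonneg[of "T * (x - u - y)"] mult_left_mono[OF fejer_le_1[of "T * (x - u - y)"], of "T * \<bar>h y\<bar>"]
        by (simp add: H_def abs_mult mult_ac)
      interpret P: pair_sigma_finite "\<mu> n" lborel ..
      have "integrable (\<mu> n \<Otimes>\<^sub>M lborel) (\<lambda>(x :: real, y). T * \<bar>h y\<bar>)"
        using hi by (intro P.Fubini_integrable) auto
      then have Hi: "integrable (\<mu> n \<Otimes>\<^sub>M lborel) (\<lambda>(x, y). H x y)"
        by (rule Bochner_Integration.integrable_bound[OF _ Hm])
          (use T in \<open>auto intro!: AE_I2 order_trans[OF Hb] simp: abs_mult\<close>)
      have sint: "integrable (\<mu> n) (\<lambda>x. fejer_smooth h T (x - u))"
        using P.integrable_fst[OF Hi] by (simp add: fejer_smooth_def H_def)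
      have "s * (LINT x|\<mu> n. fejer_smooth h T (x - u)) = s * (LINT x|\<mu> n. LINT y|lborel. H x y)"
        by (simp add: fejer_smooth_def H_def)
      also have "\<dots> = s * (LINT y|lborel. LINT x|\<mu> n. H x y)" using P.Fubini_integral[OF Hi] by simp
      also have "\<dots> = (LINT y|lborel. h y * (s * k T (u + y)))"
        unfolding H_def k_def by (simp add: diff_diff_add mult_ac)
      finally have eq1: "s * (LINT x|\<mu> n. fejer_smooth h T (x - u)) = (LINT y|lborel. h y * (s * k T (u + y)))" .
      have main: "\<bar>s * (LINT x|\<mu> n. fejer_smooth h T (x - u)) - \<gamma> u * (LINT y|lborel. h y)\<bar>
          \<le> (char_error (\<mu> n) (b n) T + A / b n) * N"
      proof -
        have "integrable lborel (\<lambda>y. LINT x|\<mu> n. H x y)" using P.integrable_snd[OF Hi] by simp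
        then have "integrable lborel (\<lambda>y. h y * k T (u + y))"
          by (simp add: H_def k_def diff_diff_add)
        from integrable_mult_right[OF this, of s]
        have ki: "integrable lborel (\<lambda>y. h y * (s * k T (u + y)))" by (simp add: mult_ac)
        have pw: "\<bar>h y * (s * k T (u + y)) - h y * \<gamma> u\<bar> \<le> \<bar>h y\<bar> * (char_error (\<mu> n) (b n) T + A / b n)" for y
        proof (cases "A < \<bar>y\<bar>")
          case True
          then show ?thesis by (simp add: A(2))
        next
          case False
          have "\<gamma> v = exp (- ((v / b n)\<^sup>2 / 2))" for v by (simp add: \<gamma>_def power_divide)
          then have "\<bar>\<gamma> (u + y) - \<gamma> u\<bar> \<le> \<bar>(u + y) / b n - u / b n\<bar>" by (simp only: gaussian_lipschitz)
          also have "\<dots> = \<bar>y\<bar> / b n" using elim(3) by (simp add: add_divide_distrib)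
          also have "\<dots> \<le> A / b n" using False elim(3) by (intro divide_right_mono) auto
          finally have "\<bar>s * k T (u + y) - \<gamma> u\<bar> \<le> char_error (\<mu> n) (b n) T + A / b n"
            using kerr[OF T, of "u + y"] by linarith
          from mult_left_mono[OF this abs_ge_zero[of "h y"]] show ?thesis
            by (simp only: right_diff_distrib[symmetric] abs_mult)
        qed
        have "s * (LINT x|\<mu> n. fejer_smooth h T (x - u)) - \<gamma> u * (LINT y|lborel. h y)
            = (LINT y|lborel. h y * (s * k T (u + y)) - h y * \<gamma> u)"
          unfolding eq1 using ki hi by simp
        also have "\<bar>\<dots>\<bar> \<le> (LINT y|lborel. \<bar>h y * (s * k T (u + y)) - h y * \<gamma> u\<bar>)"
          by (rule integral_abs_bound)
        also have "\<dots> \<le> (LINT y|lborel. \<bar>h y\<bar> * (char_error (\<mu> n) (b n) T + A / b n))"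
          by (rule integral_mono[OF _ _ pw]) (use ki hi in auto)
        also have "\<dots> = (char_error (\<mu> n) (b n) T + A / b n) * N" by (simp add: N_def mult.commute)
        finally show ?thesis .
      qed
      have "\<bar>(LINT x|\<mu> n. h (x - u)) - (LINT x|\<mu> n. fejer_smooth h T (x - u))\<bar> \<le> \<eta> / c0 * (k 1 u + k 1 (u - 1))"
      proof -
        have fi: "integrable (\<mu> n) (\<lambda>x. fejer (x - v))" for v using fint[of 1 "- v"] by simp
        have pw: "\<bar>h (x - u) - fejer_smooth h T (x - u)\<bar> \<le> \<eta> / c0 * (fejer (x - u) + fejer (x - (u - 1)))" for x
        proof -
          have "\<bar>h (x - u) - fejer_smooth h T (x - u)\<bar> \<le> \<eta> * (1 / (1 + (x - u)\<^sup>2))"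
            using sm[of "x - u"] by (simp add: abs_minus_commute)
          also have "\<dots> = \<eta> / c0 * (c0 * (1 / (1 + (x - u)\<^sup>2)))" using c0 by simp
          also have "\<dots> \<le> \<eta> / c0 * (fejer (x - u) + fejer (x - u + 1))"
            using fejer_shift_ge[of "x - u"] \<eta> c0 unfolding c0_def[symmetric] by (intro mult_left_mono) auto
          also have "x - u + 1 = x - (u - 1)" by simp
          finally show ?thesis .
        qed
        have "\<bar>(LINT x|\<mu> n. h (x - u)) - (LINT x|\<mu> n. fejer_smooth h T (x - u))\<bar>
            = \<bar>LINT x|\<mu> n. h (x - u) - fejer_smooth h T (x - u)\<bar>"
          using hint sint by simp
        also have "\<dots> \<le> (LINT x|\<mu> n. \<bar>h (x - u) - fejer_smooth h T (x - u)\<bar>)" by (rule integral_abs_bound)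
        also have "\<dots> \<le> (LINT x|\<mu> n. \<eta> / c0 * (fejer (x - u) + fejer (x - (u - 1))))"
          by (rule integral_mono[OF _ _ pw]) (use hint sint fi in auto)
        also have "\<dots> = \<eta> / c0 * (k 1 u + k 1 (u - 1))" using fi by (simp add: k_def)
        finally show ?thesis .
      qed
      then have "s * \<bar>(LINT x|\<mu> n. h (x - u)) - (LINT x|\<mu> n. fejer_smooth h T (x - u))\<bar> \<le> s * (\<eta> / c0 * (k 1 u + k 1 (u - 1)))"
        using s by (intro mult_left_mono) auto
      also have "\<dots> = \<eta> / c0 * (s * k 1 u + s * k 1 (u - 1))" by (simp add: algebra_simps)
      also have "\<dots> \<le> \<eta> / c0 * (2 + 2)"
      proof -
        have "s * k 1 v \<le> 2" for v using kerr[of 1 v] \<gamma>1[of v] elim(1) by linarith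
        then show ?thesis using \<eta> c0 by (intro mult_left_mono add_mono) auto
      qed
      also have "\<dots> = \<epsilon> / 2" using c0 by (simp add: \<eta>_def)
      finally have "\<bar>s * (LINT x|\<mu> n. h (x - u)) - s * (LINT x|\<mu> n. fejer_smooth h T (x - u))\<bar> \<le> \<epsilon> / 2"
        using s by (simp add: right_diff_distrib[symmetric] abs_mult)
      then have "\<bar>s * (LINT x|\<mu> n. h (x - u)) - \<gamma> u * (LINT y|lborel. h y)\<bar> \<le> \<epsilon>"
        using main elim(2) by linarith
      then show "\<bar>sqrt (2 * pi) * b n * (LINT x|\<mu> n. h (x - u))
        - exp (- (u\<^sup>2 / (2 * (b n)\<^sup>2))) * (LINT x|lborel. h x)\<bar> \<le> \<epsilon>"
        by (simp only: s_def \<gamma>_def)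
    qed
  qed
qed

subsection \<open>The perturbed eigenvalue under slow variation\<close>

text \<open>The function \<open>g\<close> extends \<open>Ln (1 + w) / w\<close> continuously to 0,
  so \<open>l n ^ n\<close> can be written with the exponent
  \<open>n * (l n - 1) * g (l n - 1)\<close> even when \<open>l n = 1\<close>.\<close>

lemma power_tendsto_exp:
  fixes l :: "nat \<Rightarrow> complex" and z :: complex
  assumes z: "(\<lambda>n. of_nat n * (l n - 1)) \<longlonglongrightarrow> z"
  shows "(\<lambda>n. l n ^ n) \<longlonglongrightarrow> exp z"
proof -
  define g where "g w = (if w = 0 then 1 else Ln (1 + w) / w)" for w :: complex
  have "((\<lambda>w. Ln w) has_field_derivative inverse 1) (at 1)" by (rule has_field_derivative_Ln) simp
  then have Ln1: "((\<lambda>w. Ln (1 + w) / w) \<longlongrightarrow> 1) (at 0)" by (simp add: DERIV_def)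
  have "(g \<longlongrightarrow> 1) (at 0)"
    by (rule Lim_transform_eventually[OF Ln1]) (auto simp: g_def eventually_at_filter)
  then have gc: "isCont g 0" by (simp add: isCont_def g_def)
  have "(\<lambda>n. (1 / of_nat n) * (of_nat n * (l n - 1))) \<longlonglongrightarrow> 0"
    using tendsto_mult[OF lim_1_over_n z] by (simp only: mult_zero_left)
  then have w0: "(\<lambda>n. l n - 1) \<longlonglongrightarrow> 0"
    by (rule Lim_transform_eventually) (auto simp: eventually_sequentially intro!: exI[of _ 1])
  have "(\<lambda>n. (of_nat n * (l n - 1)) * g (l n - 1)) \<longlonglongrightarrow> z * g 0"
    by (intro tendsto_mult z isCont_tendsto_compose[OF gc w0])
  then have lim: "(\<lambda>n. exp ((of_nat n * (l n - 1)) * g (l n - 1))) \<longlonglongrightarrow> exp z"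
    by (intro tendsto_exp) (simp add: g_def)
  have "(\<lambda>n. 1 + (l n - 1)) \<longlonglongrightarrow> 1 + 0" by (intro tendsto_intros w0)
  then have "eventually (\<lambda>n. l n \<noteq> 0) sequentially"
    using tendsto_imp_eventually_ne[of l 1 sequentially 0] by simp
  then have "eventually (\<lambda>n. exp ((of_nat n * (l n - 1)) * g (l n - 1)) = l n ^ n) sequentially"
  proof eventually_elim
    case (elim n)
    have "(l n - 1) * g (l n - 1) = Ln (l n)" by (simp add: g_def)
    then have "exp ((of_nat n * (l n - 1)) * g (l n - 1)) = exp (of_nat n * Ln (l n))" by (simp add: mult.assoc)
    then show ?case using elim by (simp add: exp_of_nat_mult)
  qed
  with lim show ?thesis by (rule Lim_transform_eventually)
qed

lemma integrable_exp_neg_abs: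
  assumes c: "0 < c" shows "integrable lborel (\<lambda>s::real. exp (- (c * \<bar>s\<bar>)))"
proof -
  define f where "f s = indicator {0<..} s *\<^sub>R exp (- (s * c))" for s :: real
  have f: "integrable lborel f"
    using integrable_I0i_exp_mscale[OF c] by (simp add: set_integrable_def f_def[abs_def])
  have f': "integrable lborel (\<lambda>s. f (- s))" using lborel_integrable_real_affine[OF f, of "-1" 0] by simp
  show ?thesis
  proof (rule Bochner_Integration.integrable_bound[OF Bochner_Integration.integrable_add[OF f f']])
    show "AE s in lborel. norm (exp (- (c * \<bar>s\<bar>))) \<le> norm (f s + f (- s))"
      using AE_lborel_singleton[of 0]
      by eventually_elim (auto simp: f_def indicator_def mult.commute)
  qed measurable
qed

lemma half_power_bound:
  assumes q: "0 < q" "q < 1"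
  shows "q ^ (n div 2) \<le> sqrt q ^ n / sqrt q"
proof -
  have p: "0 < sqrt q" "sqrt q < 1" using q by auto
  have "sqrt q * q ^ (n div 2) = sqrt q ^ Suc (2 * (n div 2))" using q by (simp add: power_mult)
  also have "\<dots> \<le> sqrt q ^ n" using p by (intro power_decreasing) auto
  finally show ?thesis using p by (simp add: field_simps)
qed

locale slowly_varying_kernel = kernel_observable +
  assumes slow: "slowly_varying (truncated_moment (distr \<pi> borel g))"
    and aperiodic: "\<And>t. t \<noteq> 0 \<Longrightarrow> norm (\<phi> t) < 1"
begin

lemma law: "slowly_varying_law (distr \<pi> borel g)"
proof -
  interpret D: prob_space "distr \<pi> borel g" by (rule prob_space_distr) simp
  show ?thesis
    by unfold_locales (use slow g_integrable g_mean in \<open>auto simp: integrable_distr_eq integral_distr\<close>)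
qed

sublocale L: slowly_varying_law "distr \<pi> borel g" by (rule law)

lemma char_law: "char (distr \<pi> borel g) = \<phi>"
  by (rule ext) (simp add: char_def \<phi>_def e_def integral_distr)

abbreviation H :: "real \<Rightarrow> real" where "H \<equiv> truncated_moment (distr \<pi> borel g)"

text \<open>The substitute for variance times \<open>t\<^sup>2\<close>: to leading order
  \<open>1 - \<phi> t\<close> is \<open>V t / 2\<close>, and all errors near 0 are measured against
  \<open>V\<close>.\<close>

definition V :: "real \<Rightarrow> real" where "V t = t\<^sup>2 * H (1 / \<bar>t\<bar>)"

lemma V_nonneg: "0 \<le> V t"
  by (simp add: V_def L.H_nonneg)

lemma filterlim_inverse_abs: "filterlim (\<lambda>t. 1 / \<bar>t\<bar>) at_top (at (0::real))"
  by (rule filterlim_compose[OF filterlim_inverse_at_top_right, of "\<lambda>t. \<bar>t\<bar>", simplified inverse_eq_divide])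
    (auto simp: filterlim_at eventually_at_filter intro!: tendsto_eq_intros)

lemma at_0_of_at_top: "eventually p at_top \<Longrightarrow> eventually (\<lambda>t. p (1 / \<bar>t\<bar>)) (at (0::real))"
  by (rule eventually_compose_filterlim[OF _ filterlim_inverse_abs])

text \<open>\<open>H\<close> stays above a positive constant, so an error of order
  o(\<open>t\<^sup>2\<close>) from the covariance term is also negligible against \<open>V\<close>,
  whether or not the variance is finite.\<close>

lemma square_le_V: "\<exists>c>0. eventually (\<lambda>t. t\<^sup>2 \<le> c * V t) (at 0)"
proof -
  obtain x0 where x0: "\<And>x. x \<ge> x0 \<Longrightarrow> 0 < H x" "x0 > 0" using L.H_pos by blast
  have "eventually (\<lambda>x. x0 \<le> x) at_top" by (rule eventually_ge_at_top)
  from at_0_of_at_top[OF this] have "eventually (\<lambda>t. t\<^sup>2 \<le> (1 / H x0) * V t) (at 0)"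
  proof eventually_elim
    case (elim t)
    have "t\<^sup>2 * H x0 \<le> V t" unfolding V_def using elim by (intro mult_left_mono L.H_mono) auto
    then show ?case using x0 by (simp add: field_simps)
  qed
  then show ?thesis using x0 by (intro exI[of _ "1 / H x0"]) auto
qed

lemma V_tendsto_0: "(V \<longlongrightarrow> 0) (at 0)"
proof -
  obtain C where C: "C \<ge> 0" "\<And>x. 0 \<le> x \<Longrightarrow> H x \<le> C * x" using L.H_linear by blast
  show ?thesis
  proof (rule Lim_null_comparison)
    show "eventually (\<lambda>t. norm (V t) \<le> C * \<bar>t\<bar>) (at 0)"
      unfolding eventually_at_filter
    proof (intro always_eventually allI impI)
      fix t :: real assume t: "t \<noteq> 0"
      have "V t \<le> t\<^sup>2 * (C * (1 / \<bar>t\<bar>))" unfolding V_def by (intro mult_left_mono C) auto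
      also have "\<dots> = C * \<bar>t\<bar>" using t by (simp add: power2_eq_square field_simps)
      finally show "norm (V t) \<le> C * \<bar>t\<bar>" using V_nonneg[of t] by simp
    qed
    show "((\<lambda>t. C * \<bar>t\<bar>) \<longlongrightarrow> 0) (at 0)" by (auto intro!: tendsto_eq_intros)
  qed
qed

lemma \<phi>_expansion:
  assumes "0 < \<epsilon>" shows "eventually (\<lambda>t. norm (1 - \<phi> t - V t / 2) \<le> \<epsilon> * V t) (at 0)"
proof -
  obtain \<delta> where \<delta>: "\<delta> > 0" "\<And>t. t \<noteq> 0 \<Longrightarrow> \<bar>t\<bar> \<le> \<delta> \<Longrightarrow>
     norm (1 - \<phi> t - t\<^sup>2 * H (1 / \<bar>t\<bar>) / 2) \<le> \<epsilon> * (t\<^sup>2 * H (1 / \<bar>t\<bar>))"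
    using L.char_expansion[OF assms] unfolding char_law by blast
  then show ?thesis
    unfolding eventually_at V_def by (intro exI[of _ \<delta>]) (auto simp: dist_real_def)
qed

definition \<kappa> :: real where "\<kappa> = (SOME \<kappa>. ((\<lambda>t. (eigval t - \<phi> t) / t\<^sup>2) \<longlongrightarrow> - complex_of_real \<kappa>) (at 0))"

lemma \<kappa>: "((\<lambda>t. (eigval t - \<phi> t) / t\<^sup>2) \<longlongrightarrow> - complex_of_real \<kappa>) (at 0)"
  unfolding \<kappa>_def by (rule someI_ex[OF eigenvalue_second_order])

lemma eigval_expansion:
  assumes \<epsilon>: "0 < \<epsilon>"
  shows "eventually (\<lambda>t. norm (1 - eigval t - complex_of_real (V t / 2 + \<kappa> * t\<^sup>2)) \<le> \<epsilon> * V t) (at 0)"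
proof -
  obtain c where c: "c > 0" "eventually (\<lambda>t. t\<^sup>2 \<le> c * V t) (at 0)" using square_le_V by blast
  define \<epsilon>1 where "\<epsilon>1 = \<epsilon> / (2 * c)"
  have \<epsilon>1: "0 < \<epsilon>1" using \<epsilon> c by (simp add: \<epsilon>1_def)
  have "eventually (\<lambda>t. dist ((eigval t - \<phi> t) / t\<^sup>2) (- complex_of_real \<kappa>) < \<epsilon>1) (at 0)"
    by (rule tendstoD[OF \<kappa> \<epsilon>1])
  moreover have "eventually (\<lambda>t. t \<noteq> 0) (at (0::real))" by (simp add: eventually_at_filter)
  moreover have "eventually (\<lambda>t. norm (1 - \<phi> t - V t / 2) \<le> \<epsilon> / 2 * V t) (at 0)"
    using \<epsilon> by (intro \<phi>_expansion) simp
  ultimately show ?thesis using c(2)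
  proof eventually_elim
    case (elim t)
    have "eigval t - \<phi> t + \<kappa> * t\<^sup>2 = ((eigval t - \<phi> t) / t\<^sup>2 + \<kappa>) * t\<^sup>2"
      using elim(2) by (simp add: distrib_right)
    then have "norm (eigval t - \<phi> t + \<kappa> * t\<^sup>2) = dist ((eigval t - \<phi> t) / t\<^sup>2) (- complex_of_real \<kappa>) * t\<^sup>2"
      by (simp add: norm_mult norm_power dist_norm)
    also have "\<dots> \<le> \<epsilon>1 * (c * V t)"
      using elim \<epsilon>1 by (intro mult_mono) auto
    also have "\<dots> = \<epsilon> / 2 * V t" using c(1) by (simp add: \<epsilon>1_def)
    finally have 1: "norm (eigval t - \<phi> t + \<kappa> * t\<^sup>2) \<le> \<epsilon> / 2 * V t" .
    have "1 - eigval t - complex_of_real (V t / 2 + \<kappa> * t\<^sup>2) = (1 - \<phi> t - V t / 2) - (eigval t - \<phi> t + \<kappa> * t\<^sup>2)"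
      by simp
    then have "norm (1 - eigval t - complex_of_real (V t / 2 + \<kappa> * t\<^sup>2))
        \<le> norm (1 - \<phi> t - V t / 2) + norm (eigval t - \<phi> t + \<kappa> * t\<^sup>2)"
      by (simp only: norm_triangle_ineq4)
    then show ?case using 1 elim(3) by (simp add: field_simps)
  qed
qed

definition R :: "real \<Rightarrow> real" where "R t = \<bar>t\<bar> ^ 3 + \<bar>t\<bar> * norm (1 - \<phi> t)"

lemma R_nonneg: "0 \<le> R t" by (simp add: R_def)

text \<open>The eigenfunction error is smaller than \<open>V\<close> by a factor \<open>|t|\<close>.
  Along the norming sequence n times \<open>V\<close> is bounded, hence n times \<open>R\<close>
  tends to 0.\<close>

lemma R_le: "\<exists>c>0. eventually (\<lambda>t. R t \<le> c * \<bar>t\<bar> * V t) (at 0)"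
proof -
  obtain c where c: "c > 0" "eventually (\<lambda>t. t\<^sup>2 \<le> c * V t) (at 0)" using square_le_V by blast
  have "eventually (\<lambda>t. norm (1 - \<phi> t - V t / 2) \<le> 1 / 2 * V t) (at 0)" by (intro \<phi>_expansion) simp
  with c(2) have "eventually (\<lambda>t. R t \<le> (c + 1) * \<bar>t\<bar> * V t) (at 0)"
  proof eventually_elim
    case (elim t)
    have "norm (1 - \<phi> t) \<le> norm (complex_of_real (V t / 2)) + norm (1 - \<phi> t - complex_of_real (V t / 2))"
      by (rule norm_triangle_sub)
    also have "norm (complex_of_real (V t / 2)) = V t / 2" using V_nonneg[of t] by (simp only: norm_of_real)
    finally have "norm (1 - \<phi> t) \<le> V t" using elim(2) by simp
    moreover have "\<bar>t\<bar> ^ 3 = \<bar>t\<bar> * t\<^sup>2" by (simp add: power3_eq_cube power2_eq_square mult.assoc)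
    ultimately have "R t \<le> \<bar>t\<bar> * (c * V t) + \<bar>t\<bar> * V t"
      unfolding R_def using elim(1) by (simp only:) (intro add_mono mult_left_mono abs_ge_zero)
    then show ?case by (simp add: algebra_simps)
  qed
  then show ?thesis using c by (intro exI[of _ "c + 1"]) auto
qed

definition E where "E = (SOME C. 0 \<le> C \<and> (\<forall>t. \<bar>t\<bar> \<le> 1 \<longrightarrow> (\<exists>v. bnd (C * \<bar>t\<bar>) (\<lambda>x. v x - 1) \<and>
     bnd (C * (\<bar>t\<bar> ^ 3 + \<bar>t\<bar> * norm (1 - \<phi> t))) (\<lambda>x. P t v x - eigval t * v x))))"

lemma E_nonneg: "0 \<le> E"
  and approx_eigen: "\<bar>t\<bar> \<le> 1 \<Longrightarrow> \<exists>v. bnd (E * \<bar>t\<bar>) (\<lambda>x. v x - 1) \<and> bnd (E * R t) (\<lambda>x. P t v x - eigval t * v x)"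
proof -
  have "\<exists>C. 0 \<le> C \<and> (\<forall>t. \<bar>t\<bar> \<le> 1 \<longrightarrow> (\<exists>v. bnd (C * \<bar>t\<bar>) (\<lambda>x. v x - 1) \<and>
     bnd (C * (\<bar>t\<bar> ^ 3 + \<bar>t\<bar> * norm (1 - \<phi> t))) (\<lambda>x. P t v x - eigval t * v x)))"
    using approximate_eigenfunction by blast
  from someI_ex[OF this]
  show "0 \<le> E" "\<bar>t\<bar> \<le> 1 \<Longrightarrow> \<exists>v. bnd (E * \<bar>t\<bar>) (\<lambda>x. v x - 1) \<and> bnd (E * R t) (\<lambda>x. P t v x - eigval t * v x)"
    unfolding E_def[symmetric] R_def by auto
qed

lemma P_diff: "x \<in> space \<pi> \<Longrightarrow> bnd C F \<Longrightarrow> bnd D G \<Longrightarrow> P t (\<lambda>y. F y - G y) x = P t F x - P t G x"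
  unfolding P_def right_diff_distrib using bnd_e_mult bnd_integrable by (intro K_diff) blast+

lemma P_cmult: "P t (\<lambda>y. c * F y) x = c * P t F x"
  unfolding P_def K_cmult[symmetric] by (simp add: mult_ac)

text \<open>Two steps of \<open>P t\<close> multiply the approximate eigenfunction by about the
  squared eigenvalue, yet shrink its sup norm by the contraction factor. The error enters three
  times: once transported by \<open>P t\<close> and twice through the eigenvalue of modulus at most
  2. Dividing by the sup norm, which is at least \<open>1 / 2\<close>, doubles this to 6.\<close>

lemma eigval_square_le:
  assumes t: "\<bar>t\<bar> \<le> 1" "E * \<bar>t\<bar> \<le> 1 / 2" and l: "norm (eigval t) \<le> 2"
  shows "(norm (eigval t))\<^sup>2 \<le> 1 - a\<^sup>2 * (1 - norm (\<phi> t)) + 6 * (E * R t)"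
proof -
  obtain v where v1: "bnd (E * \<bar>t\<bar>) (\<lambda>x. v x - 1)" and r: "bnd (E * R t) (\<lambda>x. P t v x - eigval t * v x)"
    using approx_eigen[OF t(1)] by blast
  define S where "S = (\<lambda>x. norm (v x)) ` space \<pi>"
  have vb: "bnd (E * \<bar>t\<bar> + 1) v" using bnd_add[OF v1 bnd_const[of 1]] by simp
  have ne: "S \<noteq> {}" using not_empty by (simp add: S_def)
  have bdd: "bdd_above S" using vb by (auto simp: S_def bnd_def intro!: bdd_aboveI)
  \<comment> \<open>The exact supremum is required: the contraction bound for \<open>v\<close> is
    compared with the least bound of \<open>v\<close>, and an upper estimate for it would not allow
    \<open>N\<close> to be cancelled.\<close>
  define N where "N = Sup S"
  have vN: "norm (v x) \<le> N" if "x \<in> space \<pi>" for x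
    unfolding N_def using that bdd by (intro cSup_upper) (auto simp: S_def)
  have bN: "bnd N v" using vb vN by (simp add: bnd_def)
  obtain x where x: "x \<in> space \<pi>" using not_empty by auto
  have "1 = norm (v x - (v x - 1))" by simp
  also have "\<dots> \<le> norm (v x) + norm (v x - 1)" by (rule norm_triangle_ineq4)
  also have "norm (v x - 1) \<le> 1 / 2" using v1 x t(2) by (force simp: bnd_def)
  finally have N: "1 / 2 \<le> N" using vN[OF x] by simp
  define q where "q = 1 - a\<^sup>2 * (1 - norm (\<phi> t))"
  define l where "l = norm (eigval t)"
  have l0: "0 \<le> l" "l \<le> 2" using l by (simp_all add: l_def)
  have ER: "0 \<le> E * R t" using E_nonneg R_nonneg by simp
  have "norm (v x) * l\<^sup>2 \<le> q * N + 3 * (E * R t)" if x: "x \<in> space \<pi>" for x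
  proof -
    have "P t (\<lambda>x. P t v x - eigval t * v x) x = P t (P t v) x - eigval t * P t v x"
      using P_diff[OF x bnd_P[OF vb] bnd_mult[OF bnd_const[of "eigval t"] vb], of t t] by (simp only: P_cmult)
    then have "eigval t * (eigval t * v x) = P t (P t v) x - P t (\<lambda>x. P t v x - eigval t * v x) x - eigval t * (P t v x - eigval t * v x)"
      by (simp add: algebra_simps)
    moreover have "norm (A - B - C) \<le> norm A + norm B + norm C" for A B C :: complex
      by (smt (verit) norm_triangle_ineq4)
    ultimately have "norm (eigval t * (eigval t * v x)) \<le> norm (P t (P t v) x) + norm (P t (\<lambda>x. P t v x - eigval t * v x) x) + norm (eigval t * (P t v x - eigval t * v x))"
      by metis
    also have "norm (P t (P t v) x) \<le> q * N" using P_two_step[OF bN, of t] x by (simp add: bnd_def q_def)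
    also have "norm (P t (\<lambda>x. P t v x - eigval t * v x) x) \<le> E * R t" using bnd_P[OF r, of t] x by (simp add: bnd_def)
    also have "norm (eigval t * (P t v x - eigval t * v x)) \<le> 2 * (E * R t)"
      unfolding norm_mult using l0 r x by (intro mult_mono) (auto simp: l_def bnd_def)
    finally show ?thesis by (simp add: norm_mult l_def power2_eq_square mult_ac)
  qed
  then have "norm (v x) \<le> (q * N + 3 * (E * R t)) / l\<^sup>2" if "x \<in> space \<pi>" "0 < l" for x
    using that by (simp add: field_simps)
  then have "N \<le> (q * N + 3 * (E * R t)) / l\<^sup>2" if "0 < l"
    unfolding N_def using ne that by (intro cSup_least) (auto simp: S_def N_def)
  moreover have "0 \<le> q * N + 3 * (E * R t)"
    using N two_step_factor(1)[of t] ER by (auto simp: q_def intro!: add_nonneg_nonneg mult_nonneg_nonneg)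
  ultimately have le: "l\<^sup>2 * N \<le> q * N + 3 * (E * R t)"
    using l0 by (cases "l = 0") (auto simp: field_simps)
  also have "\<dots> \<le> (q + 6 * (E * R t)) * N"
    using mult_left_mono[OF N, of "6 * (E * R t)"] ER by (simp add: algebra_simps)
  finally show ?thesis using N by (simp add: q_def l_def mult_le_cancel_right)
qed

text \<open>The expansion gives \<open>1 - 2 * Re (1 - eigval t)\<close> as a lower bound of the
  squared modulus, the contraction an upper bound with
  \<open>a\<^sup>2 * (1 - norm (\<phi> t))\<close>, about \<open>a\<^sup>2 * V t / 2\<close>.
  Comparing both shows that a negative \<open>\<kappa>\<close> cannot cancel the quadratic
  term.\<close>

lemma variance_lower: "eventually (\<lambda>t. a\<^sup>2 / 4 * V t \<le> V t + 2 * \<kappa> * t\<^sup>2) (at 0)"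
proof -
  \<comment> \<open>The errors sum to at most \<open>9 * \<epsilon>\<close>, and
    \<open>9 / 64\<close> is below the gap between \<open>a\<^sup>2 / 2\<close> and
    \<open>a\<^sup>2 / 4\<close>.\<close>
  define \<epsilon> where "\<epsilon> = a\<^sup>2 / 64"
  have \<epsilon>: "0 < \<epsilon>" using a_pos by (simp add: \<epsilon>_def)
  have a2: "a\<^sup>2 \<le> 1" using a_pos a_le_1 by (simp add: power_le_one)
  obtain c where c: "c > 0" "eventually (\<lambda>t. R t \<le> c * \<bar>t\<bar> * V t) (at 0)" using R_le by blast
  have "((\<lambda>t. C * \<bar>t\<bar>) \<longlongrightarrow> 0) (at (0::real))" for C by (auto intro!: tendsto_eq_intros)
  note small = order_tendstoD(2)[OF this]
  have s1: "eventually (\<lambda>t. 1 * \<bar>t\<bar> < 1) (at (0::real))" by (rule small) simp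
  have s2: "eventually (\<lambda>t. E * \<bar>t\<bar> < 1/2) (at 0)" by (rule small) simp
  have s3: "eventually (\<lambda>t. E * c * \<bar>t\<bar> < \<epsilon>) (at 0)" by (rule small[OF \<epsilon>])
  have "eventually (\<lambda>t. V t < 1) (at 0)" by (rule order_tendstoD(2)[OF V_tendsto_0]) simp
  moreover have "((\<lambda>t. \<bar>V t / 2 + \<kappa> * t\<^sup>2\<bar>) \<longlongrightarrow> \<bar>0 / 2 + \<kappa> * 0\<^sup>2\<bar>) (at 0)"
    by (intro tendsto_intros V_tendsto_0) simp
  then have "eventually (\<lambda>t. \<bar>V t / 2 + \<kappa> * t\<^sup>2\<bar> < 1 / 2) (at 0)" by (rule order_tendstoD(2)) simp
  ultimately show ?thesis
    using eigval_expansion[OF \<epsilon>] \<phi>_expansion[OF \<epsilon>] c(2) s1 s2 s3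
  proof eventually_elim
    case (elim t)
    have m: "norm (1 - eigval t) \<le> \<bar>V t / 2 + \<kappa> * t\<^sup>2\<bar> + \<epsilon> * V t"
      using norm_triangle_sub[of "1 - eigval t" "complex_of_real (V t / 2 + \<kappa> * t\<^sup>2)"] elim(3)
      by (simp only: norm_of_real)
    have "\<epsilon> * V t \<le> 1 / 2 * 1" using \<epsilon> elim(1) V_nonneg[of t] a2 by (intro mult_mono) (auto simp: \<epsilon>_def)
    then have l: "norm (eigval t) \<le> 2"
      using m elim(2) norm_triangle_ineq4[of 1 "1 - eigval t"] by simp
    have sq: "(norm (eigval t))\<^sup>2 \<le> 1 - a\<^sup>2 * (1 - norm (\<phi> t)) + 6 * (E * R t)"
      using elim(6,7) l by (intro eigval_square_le) auto
    define x where "x = Re (1 - eigval t)"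
    have "1 - 2 * x \<le> (1 - x)\<^sup>2" by (simp add: power2_eq_square algebra_simps)
    also have "\<dots> \<le> (norm (eigval t))\<^sup>2"
      using abs_Re_le_cmod[of "eigval t"] by (simp add: x_def cmod_power2)
    finally have 1: "a\<^sup>2 * (1 - norm (\<phi> t)) \<le> 2 * x + 6 * (E * R t)" using sq by linarith
    have "x - (V t / 2 + \<kappa> * t\<^sup>2) = Re (1 - eigval t - complex_of_real (V t / 2 + \<kappa> * t\<^sup>2))" by (simp add: x_def)
    also have "\<dots> \<le> \<epsilon> * V t" using elim(3) complex_Re_le_cmod order_trans by blast
    finally have 2: "2 * x \<le> V t + 2 * \<kappa> * t\<^sup>2 + 2 * \<epsilon> * V t" by simp
    have "norm (\<phi> t) \<le> norm (complex_of_real (1 - V t / 2)) + norm (complex_of_real (1 - V t / 2) - \<phi> t)"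
      by (metis norm_triangle_sub norm_minus_commute)
    also have "norm (complex_of_real (1 - V t / 2)) = 1 - V t / 2" using elim(1) V_nonneg[of t] by (simp only: norm_of_real)
    also have "norm (complex_of_real (1 - V t / 2) - \<phi> t) \<le> \<epsilon> * V t" using elim(4) by (simp add: algebra_simps)
    finally have "(1/2 - \<epsilon>) * V t \<le> 1 - norm (\<phi> t)" by (simp add: algebra_simps)
    from mult_left_mono[OF this, of "a\<^sup>2"]
    have 3: "a\<^sup>2 * ((1/2 - \<epsilon>) * V t) \<le> a\<^sup>2 * (1 - norm (\<phi> t))" by simp
    have "E * R t \<le> E * (c * \<bar>t\<bar> * V t)" using elim(5) E_nonneg by (intro mult_left_mono)
    also have "\<dots> = (E * c * \<bar>t\<bar>) * V t" by simp
    also have "\<dots> \<le> \<epsilon> * V t" using elim(8) V_nonneg by (intro mult_right_mono) auto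
    finally have 4: "6 * (E * R t) \<le> 6 * \<epsilon> * V t" by simp
    have "a\<^sup>2 * \<epsilon> \<le> 1 * \<epsilon>" using a2 \<epsilon> by (intro mult_right_mono) auto
    moreover have "a\<^sup>2 = 64 * \<epsilon>" by (simp add: \<epsilon>_def)
    moreover have "a\<^sup>2 * (1/2 - \<epsilon>) = a\<^sup>2 / 2 - a\<^sup>2 * \<epsilon>" by (simp add: algebra_simps)
    ultimately have "a\<^sup>2 / 4 \<le> a\<^sup>2 * (1/2 - \<epsilon>) - 8 * \<epsilon>" using \<epsilon> by linarith
    from mult_right_mono[OF this V_nonneg[of t]]
    have "a\<^sup>2 / 4 * V t \<le> a\<^sup>2 * ((1/2 - \<epsilon>) * V t) - 8 * \<epsilon> * V t" by (simp add: algebra_simps)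
    then show ?case using 1 2 3 4 by (simp add: algebra_simps)
  qed
qed

end

section \<open>Norming sequence and characteristic functions on its scale\<close>

context slowly_varying_kernel
begin

text \<open>Only the one-variable second moment is truncated; the covariance sum enters in full. For
  finite variance this tends to the usual asymptotic variance of the sums.\<close>

definition long_run_variance :: "real \<Rightarrow> real" where "long_run_variance x = H x + 2 * \<kappa>"

lemma long_run_variance_lower: "\<exists>x0>0. \<forall>x\<ge>x0. 0 < H x \<and> a\<^sup>2 / 4 * H x \<le> long_run_variance x"
proof -
  have "filterlim (\<lambda>x::real. 1 / x) (at 0) at_top"
    by (auto simp: filterlim_at eventually_at_top_dense intro!: exI[of _ 0] tendsto_divide_0[OF tendsto_const]
        filterlim_at_top_imp_at_infinity filterlim_ident)
  from eventually_compose_filterlim[OF variance_lower this]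
  have "eventually (\<lambda>x. a\<^sup>2 / 4 * H x \<le> long_run_variance x) at_top"
    using eventually_gt_at_top[of 0]
  proof eventually_elim
    case (elim x)
    have "V (1 / x) = H x / x\<^sup>2" using elim(2) by (simp add: V_def power_divide)
    then have "a\<^sup>2 / 4 * (H x / x\<^sup>2) \<le> H x / x\<^sup>2 + 2 * \<kappa> * (1 / x)\<^sup>2" using elim(1) by simp
    then have "(a\<^sup>2 / 4 * H x) / x\<^sup>2 \<le> long_run_variance x / x\<^sup>2"
      by (simp add: long_run_variance_def power_divide add_divide_distrib)
    then show ?case unfolding divide_le_cancel using elim(2) by simp
  qed
  then obtain x1 where x1: "\<And>x. x \<ge> x1 \<Longrightarrow> a\<^sup>2 / 4 * H x \<le> long_run_variance x" unfolding eventually_at_top_linorder by blast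
  obtain x2 where x2: "x2 > 0" "\<And>x. x \<ge> x2 \<Longrightarrow> 0 < H x" using L.H_pos by blast
  show ?thesis by (intro exI[of _ "max x1 x2"]) (use x1 x2 in auto)
qed

lemma long_run_variance_linear: "\<exists>C\<ge>0. \<forall>x\<ge>1. long_run_variance x \<le> C * x"
proof -
  obtain C where C: "C \<ge> 0" "\<And>x. 0 \<le> x \<Longrightarrow> H x \<le> C * x" using L.H_linear by blast
  show ?thesis
  proof (intro exI[of _ "C + 2 * \<bar>\<kappa>\<bar>"] conjI allI impI)
    fix x :: real assume x: "1 \<le> x"
    have "2 * \<kappa> \<le> 2 * \<bar>\<kappa>\<bar> * x" using x mult_left_mono[OF x, of "2 * \<bar>\<kappa>\<bar>"] by simp
    then show "long_run_variance x \<le> (C + 2 * \<bar>\<kappa>\<bar>) * x" using C(2)[of x] x by (simp add: long_run_variance_def algebra_simps)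
  qed (use C in auto)
qed

lemma norming_exists: "\<exists>b :: nat \<Rightarrow> real. filterlim b at_top sequentially \<and>
    eventually (\<lambda>n. real n * long_run_variance (b n) = (b n)\<^sup>2) sequentially"
proof -
  obtain x0 where x0: "x0 > 0" "\<And>x. x \<ge> x0 \<Longrightarrow> 0 < H x \<and> a\<^sup>2 / 4 * H x \<le> long_run_variance x" using long_run_variance_lower by blast
  obtain C where C: "\<And>x. 1 \<le> x \<Longrightarrow> long_run_variance x \<le> C * x" using long_run_variance_linear by blast
  show ?thesis
  proof (rule normalizing_sequence[OF _ C])
    show "long_run_variance x \<le> long_run_variance y" if "x \<le> y" for x y using L.H_mono[OF that] by (simp add: long_run_variance_def)
    show "1 \<le> max 1 x0" by simp
    have "0 < H (max 1 x0)" "a\<^sup>2 / 4 * H (max 1 x0) \<le> long_run_variance (max 1 x0)" using x0(2)[of "max 1 x0"] by auto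
    moreover have "0 < a\<^sup>2 / 4 * H (max 1 x0)" using a_pos calculation(1) by simp
    ultimately show "0 < long_run_variance (max 1 x0)" by linarith
  qed
qed

definition f :: "nat \<Rightarrow> real \<Rightarrow> complex" where
  "f n t = (LINT x|\<pi>. (P t ^^ n) (\<lambda>_. 1) x)"

lemma norm_f_le: "norm (f n t) \<le> (1 - a\<^sup>2 * (1 - norm (\<phi> t))) ^ (n div 2)"
  unfolding f_def by (rule norm_integral_bnd[OF P_power_bound])

lemma bnd_P_power: "bnd C F \<Longrightarrow> bnd C ((P t ^^ n) F)"
  by (induction n) (auto intro: bnd_P)

lemma P_power_diff:
  "bnd C F \<Longrightarrow> bnd D G \<Longrightarrow> x \<in> space \<pi> \<Longrightarrow>
    (P t ^^ n) (\<lambda>y. F y - G y) x = (P t ^^ n) F x - (P t ^^ n) G x"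
proof (induction n arbitrary: x)
  case (Suc n)
  have "(P t ^^ Suc n) (\<lambda>y. F y - G y) x = P t (\<lambda>y. (P t ^^ n) F y - (P t ^^ n) G y) x"
    unfolding funpow.simps o_apply P_def[of t "(P t ^^ n) (\<lambda>y. F y - G y)"] P_def[of t "\<lambda>y. (P t ^^ n) F y - (P t ^^ n) G y"]
    using Suc by (intro K_cong) auto
  also have "\<dots> = (P t ^^ Suc n) F x - (P t ^^ Suc n) G x"
    using P_diff[OF Suc.prems(3) bnd_P_power[OF Suc.prems(1)] bnd_P_power[OF Suc.prems(2)]] by simp
  finally show ?case .
qed simp

text \<open>Three replacements: \<open>1\<close> by \<open>v\<close> inside the iterate, the iterate
  of \<open>v\<close> by the power of the eigenvalue times \<open>v\<close>, and \<open>v\<close> by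
  \<open>1\<close> again. The outer two cost \<open>E * |t|\<close>, the last with a factor
  \<open>m\<close>; the middle one telescopes into n errors of size \<open>E * R t\<close>.\<close>

lemma f_minus_eigval_power:
  fixes n :: nat
  assumes t: "\<bar>t\<bar> \<le> 1"
  defines "m \<equiv> exp (real n * norm (eigval t - 1))"
  shows "norm (f n t - eigval t ^ n) \<le> E * \<bar>t\<bar> + m * (E * \<bar>t\<bar>) + real n * m * (E * R t)"
proof -
  obtain v where v1: "bnd (E * \<bar>t\<bar>) (\<lambda>x. v x - 1)" and r: "bnd (E * R t) (\<lambda>x. P t v x - eigval t * v x)"
    using approx_eigen[OF t] by blast
  have vb: "bnd (E * \<bar>t\<bar> + 1) v" using bnd_add[OF v1 bnd_const[of 1]] by simp
  have one: "bnd 1 (\<lambda>x. 1)" using bnd_const[of 1] by simp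
  \<comment> \<open>A bound for the eigenvalue that is at least 1, so its powers increase and all
    are controlled by \<open>m\<close>, which stays bounded while n times
    \<open>eigval t - 1\<close> converges.\<close>
  define M where "M = 1 + norm (eigval t - 1)"
  have M: "1 \<le> M" by (simp add: M_def)
  have lM: "norm (eigval t) \<le> M" using norm_triangle_ineq[of 1 "eigval t - 1"] by (simp add: M_def)
  have "M \<le> exp (norm (eigval t - 1))" unfolding M_def by (rule exp_ge_add_one_self)
  then have "M ^ n \<le> exp (norm (eigval t - 1)) ^ n" using M by (intro power_mono) auto
  then have Mm: "M ^ n \<le> m" by (simp add: m_def exp_of_nat_mult)
  have ER: "0 \<le> E * R t" using E_nonneg R_nonneg by simp
  have lk: "norm (eigval t ^ k) \<le> M ^ k" for k unfolding norm_power by (intro power_mono lM) simp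
  have iter: "bnd (real k * M ^ k * (E * R t)) (\<lambda>x. (P t ^^ k) v x - eigval t ^ k * v x)" for k
  proof (induction k)
    case 0
    then show ?case using bnd_const[of 0] by simp
  next
    case (Suc k)
    define D where "D = (\<lambda>x. (P t ^^ k) v x - eigval t ^ k * v x)"
    have lv: "bnd (M ^ k * (E * \<bar>t\<bar> + 1)) (\<lambda>x. eigval t ^ k * v x)"
      using lk by (intro bnd_mult vb bnd_mono[OF bnd_const]) auto
    have eq: "(P t ^^ Suc k) v x - eigval t ^ Suc k * v x = P t D x + eigval t ^ k * (P t v x - eigval t * v x)"
      if x: "x \<in> space \<pi>" for x
    proof -
      have "P t D x = P t ((P t ^^ k) v) x - eigval t ^ k * P t v x"
        unfolding D_def by (simp only: P_diff[OF x bnd_P_power[OF vb] lv] P_cmult)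
      then show ?thesis by (simp add: algebra_simps)
    qed
    have b: "bnd (real k * M ^ k * (E * R t) + M ^ k * (E * R t)) (\<lambda>x. P t D x + eigval t ^ k * (P t v x - eigval t * v x))"
      using Suc lk by (intro bnd_add bnd_P bnd_mult r bnd_mono[OF bnd_const]) (auto simp: D_def)
    have "M ^ k \<le> M ^ Suc k" using M by simp
    then have "real (Suc k) * M ^ k * (E * R t) \<le> real (Suc k) * M ^ Suc k * (E * R t)"
      using ER by (intro mult_right_mono mult_left_mono) auto
    then have le: "real k * M ^ k * (E * R t) + M ^ k * (E * R t) \<le> real (Suc k) * M ^ Suc k * (E * R t)"
      by (simp add: algebra_simps)
    show ?case
      unfolding bnd_def
    proof (intro conjI ballI)
      show "(\<lambda>x. (P t ^^ Suc k) v x - eigval t ^ Suc k * v x) \<in> borel_measurable \<pi>"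
        using bnd_P_power[OF vb, of "Suc k" t] vb unfolding bnd_def
        by (intro borel_measurable_diff borel_measurable_times borel_measurable_const) auto
      show "norm ((P t ^^ Suc k) v x - eigval t ^ Suc k * v x) \<le> real (Suc k) * M ^ Suc k * (E * R t)"
        if x: "x \<in> space \<pi>" for x
        using bnd_mono[OF b le] x unfolding eq[OF x] bnd_def by blast
    qed
  qed
  have int: "integrable \<pi> ((P t ^^ n) v)" "integrable \<pi> v" "integrable \<pi> ((P t ^^ n) (\<lambda>_. 1))"
    using bnd_integrable[OF bnd_P_power[OF vb]] bnd_integrable[OF vb] bnd_integrable[OF bnd_P_power[OF one]] by auto
  have "bnd (E * \<bar>t\<bar>) ((P t ^^ n) (\<lambda>x. v x - 1))" by (rule bnd_P_power[OF v1])
  then have d1: "bnd (E * \<bar>t\<bar>) (\<lambda>x. (P t ^^ n) v x - (P t ^^ n) (\<lambda>_. 1) x)"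
    using P_power_diff[OF vb one] int by (auto simp: bnd_def)
  define A1 A2 A3 where "A1 = (LINT x|\<pi>. (P t ^^ n) v x - (P t ^^ n) (\<lambda>_. 1) x)"
    and "A2 = (LINT x|\<pi>. (P t ^^ n) v x - eigval t ^ n * v x)" and "A3 = (LINT x|\<pi>. v x - 1)"
  have eqf: "f n t - eigval t ^ n = A2 - A1 + eigval t ^ n * A3"
    unfolding f_def A1_def A2_def A3_def using int by (simp add: prob_space algebra_simps)
  have "norm (f n t - eigval t ^ n) \<le> norm A2 + norm A1 + norm (eigval t ^ n * A3)"
    unfolding eqf
    using norm_triangle_ineq[of "A2 - A1" "eigval t ^ n * A3"] norm_triangle_ineq4[of A2 A1] by linarith
  also have "norm A2 \<le> real n * M ^ n * (E * R t)" unfolding A2_def by (rule norm_integral_bnd[OF iter])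
  also have "real n * M ^ n * (E * R t) \<le> real n * m * (E * R t)" using Mm ER by (intro mult_right_mono mult_left_mono) auto
  also have "norm A1 \<le> E * \<bar>t\<bar>" unfolding A1_def by (rule norm_integral_bnd[OF d1])
  also have "norm (eigval t ^ n * A3) \<le> m * (E * \<bar>t\<bar>)"
    unfolding norm_mult A3_def using lk[of n] Mm norm_integral_bnd[OF v1] E_nonneg
    by (intro mult_mono) (auto simp: m_def)
  finally show ?thesis by simp
qed

context
  fixes bn :: "nat \<Rightarrow> real"
  assumes bn: "filterlim bn at_top sequentially"
    and bn_eq: "eventually (\<lambda>n. real n * long_run_variance (bn n) = (bn n)\<^sup>2) sequentially"
begin

lemma bn_pos: "eventually (\<lambda>n. 0 < bn n) sequentially"
  using bn by (simp add: filterlim_at_top_dense)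

lemma bn_ge: "eventually (\<lambda>n. c \<le> bn n) sequentially"
  using bn by (simp add: filterlim_at_top)

lemma t_tendsto: "s \<noteq> 0 \<Longrightarrow> filterlim (\<lambda>n. s / bn n) (at 0) sequentially"
  using bn_pos by (auto simp: filterlim_at elim!: eventually_mono
      intro!: tendsto_divide_0[OF tendsto_const] filterlim_at_top_imp_at_infinity[OF bn])

text \<open>The quantifier over \<open>s\<close> stands inside the eventuality, as the domination
  argument lets \<open>s\<close> range up to a multiple of \<open>bn n\<close>.\<close>

lemma nV_eq: "eventually (\<lambda>n. \<forall>s. s \<noteq> 0 \<longrightarrow> real n * V (s / bn n) = s\<^sup>2 * H (bn n / \<bar>s\<bar>) / long_run_variance (bn n)) sequentially"
proof -
  obtain x0 where x0: "x0 > 0" "\<And>x. x \<ge> x0 \<Longrightarrow> 0 < H x \<and> a\<^sup>2 / 4 * H x \<le> long_run_variance x" using long_run_variance_lower by blast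
  show ?thesis
    using bn_eq bn_ge[of x0]
  proof eventually_elim
    case (elim n)
    have b: "0 < bn n" using elim x0 by linarith
    have "0 < a\<^sup>2 / 4 * H (bn n)" using x0(2)[OF elim(2)] a_pos by simp
    then have K: "0 < long_run_variance (bn n)" using x0(2)[OF elim(2)] by linarith
    have "real n / (bn n)\<^sup>2 = 1 / long_run_variance (bn n)" using elim(1) b K by (subst frac_eq_eq) auto
    moreover have "real n * V (s / bn n) = s\<^sup>2 * H (bn n / \<bar>s\<bar>) * (real n / (bn n)\<^sup>2)" for s
      using b by (simp add: V_def power_divide)
    ultimately show ?case by simp
  qed
qed

lemma ratio_tendsto:
  assumes s: "s \<noteq> 0" shows "(\<lambda>n. H (bn n / \<bar>s\<bar>) / H (bn n)) \<longlonglongrightarrow> 1"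
proof -
  have "((\<lambda>x. H (1 / \<bar>s\<bar> * x) / H x) \<longlongrightarrow> 1) at_top" using s by (intro L.H_ratio) simp
  from filterlim_compose[OF this bn] show ?thesis by simp
qed

lemma H_over_long_run_variance: "eventually (\<lambda>n. 0 < H (bn n) \<and> 0 < long_run_variance (bn n) \<and> H (bn n) / long_run_variance (bn n) \<le> 4 / a\<^sup>2) sequentially"
proof -
  obtain x0 where x0: "x0 > 0" "\<And>x. x \<ge> x0 \<Longrightarrow> 0 < H x \<and> a\<^sup>2 / 4 * H x \<le> long_run_variance x" using long_run_variance_lower by blast
  show ?thesis
    using bn_ge[of x0]
  proof eventually_elim
    case (elim n)
    have "0 < a\<^sup>2 / 4 * H (bn n)" using x0(2)[OF elim] a_pos by simp
    then have K: "0 < long_run_variance (bn n)" using x0(2)[OF elim] by linarith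
    have "H (bn n) / long_run_variance (bn n) \<le> 4 / a\<^sup>2" using K x0(2)[OF elim] a_pos by (simp add: field_simps)
    then show ?case using K x0(2)[OF elim] by simp
  qed
qed

lemma nV_bounded:
  assumes s: "s \<noteq> 0" shows "eventually (\<lambda>n. real n * V (s / bn n) \<le> 8 * s\<^sup>2 / a\<^sup>2) sequentially"
proof -
  have "eventually (\<lambda>n. H (bn n / \<bar>s\<bar>) / H (bn n) < 2) sequentially"
    by (rule order_tendstoD(2)[OF ratio_tendsto[OF s]]) simp
  with nV_eq H_over_long_run_variance show ?thesis
  proof eventually_elim
    case (elim n)
    have "real n * V (s / bn n) = s\<^sup>2 * ((H (bn n / \<bar>s\<bar>) / H (bn n)) * (H (bn n) / long_run_variance (bn n)))"
      using elim s by simp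
    also have "\<dots> \<le> s\<^sup>2 * (2 * (4 / a\<^sup>2))"
      using elim a_pos by (intro mult_left_mono mult_mono) auto
    finally show ?case by (simp add: mult_ac)
  qed
qed

text \<open>The norming equation turns the left side into \<open>s\<^sup>2 / 2\<close> times the
  ratio of \<open>H (bn n / |s|) + 2 * \<kappa>\<close> to \<open>long_run_variance (bn n)\<close>.
  Its distance from 1 is the relative change of \<open>H\<close>, which vanishes by slow variation,
  times a factor bounded by \<open>4 / a\<^sup>2\<close>.\<close>

lemma n_mean_tendsto:
  assumes s: "s \<noteq> 0"
  shows "(\<lambda>n. real n * (V (s / bn n) / 2 + \<kappa> * (s / bn n)\<^sup>2)) \<longlonglongrightarrow> s\<^sup>2 / 2"
proof -
  have "(\<lambda>n. (H (bn n / \<bar>s\<bar>) / H (bn n) - 1) * (H (bn n) / long_run_variance (bn n))) \<longlonglongrightarrow> 0"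
  proof (rule Lim_null_comparison)
    show "eventually (\<lambda>n. norm ((H (bn n / \<bar>s\<bar>) / H (bn n) - 1) * (H (bn n) / long_run_variance (bn n)))
        \<le> \<bar>H (bn n / \<bar>s\<bar>) / H (bn n) - 1\<bar> * (4 / a\<^sup>2)) sequentially"
      using H_over_long_run_variance
    proof eventually_elim
      case (elim n)
      then show ?case unfolding real_norm_def abs_mult by (intro mult_left_mono) auto
    qed
    have "(\<lambda>n. \<bar>H (bn n / \<bar>s\<bar>) / H (bn n) - 1\<bar> * (4 / a\<^sup>2)) \<longlonglongrightarrow> \<bar>1 - 1\<bar> * (4 / a\<^sup>2)"
      by (intro tendsto_intros ratio_tendsto s)
    then show "(\<lambda>n. \<bar>H (bn n / \<bar>s\<bar>) / H (bn n) - 1\<bar> * (4 / a\<^sup>2)) \<longlonglongrightarrow> 0" by simp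
  qed
  then have "(\<lambda>n. s\<^sup>2 / 2 * (1 + (H (bn n / \<bar>s\<bar>) / H (bn n) - 1) * (H (bn n) / long_run_variance (bn n)))) \<longlonglongrightarrow> s\<^sup>2 / 2 * (1 + 0)"
    by (intro tendsto_intros)
  moreover have "eventually (\<lambda>n. s\<^sup>2 / 2 * (1 + (H (bn n / \<bar>s\<bar>) / H (bn n) - 1) * (H (bn n) / long_run_variance (bn n)))
      = real n * (V (s / bn n) / 2 + \<kappa> * (s / bn n)\<^sup>2)) sequentially"
    using nV_eq H_over_long_run_variance bn_eq bn_pos
  proof eventually_elim
    case (elim n)
    have K: "0 < long_run_variance (bn n)" "0 < H (bn n)" "0 < bn n" using elim by auto
    have n: "real n = (bn n)\<^sup>2 / long_run_variance (bn n)" using elim(3) K by (simp add: field_simps)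
    have "real n * (V (s / bn n) / 2 + \<kappa> * (s / bn n)\<^sup>2) = (real n * V (s / bn n)) / 2 + \<kappa> * s\<^sup>2 * (real n / (bn n)\<^sup>2)"
      by (simp add: algebra_simps power_divide)
    also have "real n / (bn n)\<^sup>2 = 1 / long_run_variance (bn n)" using K by (simp add: n)
    also have "real n * V (s / bn n) = s\<^sup>2 * H (bn n / \<bar>s\<bar>) / long_run_variance (bn n)" using elim s by simp
    also have "s\<^sup>2 * H (bn n / \<bar>s\<bar>) / long_run_variance (bn n) / 2 + \<kappa> * s\<^sup>2 * (1 / long_run_variance (bn n)) = s\<^sup>2 / 2 * ((H (bn n / \<bar>s\<bar>) + 2 * \<kappa>) / long_run_variance (bn n))"
      by (simp add: add_divide_distrib algebra_simps)
    also have "(H (bn n / \<bar>s\<bar>) + 2 * \<kappa>) / long_run_variance (bn n) = 1 + (H (bn n / \<bar>s\<bar>) / H (bn n) - 1) * (H (bn n) / long_run_variance (bn n))"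
    proof -
      have "(H (bn n / \<bar>s\<bar>) / H (bn n) - 1) * (H (bn n) / long_run_variance (bn n)) = (H (bn n / \<bar>s\<bar>) - H (bn n)) / long_run_variance (bn n)"
        using K by (simp add: left_diff_distrib diff_divide_distrib)
      moreover have "H (bn n / \<bar>s\<bar>) + 2 * \<kappa> = long_run_variance (bn n) + (H (bn n / \<bar>s\<bar>) - H (bn n))" by (simp add: long_run_variance_def)
      ultimately show ?thesis using K(1) by (simp only: add_divide_distrib) simp
    qed
    finally show ?case by simp
  qed
  ultimately show ?thesis using Lim_transform_eventually by fastforce
qed

lemma n_eigval_tendsto:
  assumes s: "s \<noteq> 0"
  shows "(\<lambda>n. of_nat n * (eigval (s / bn n) - 1)) \<longlonglongrightarrow> complex_of_real (- (s\<^sup>2 / 2))"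
proof -
  define B where "B = 8 * s\<^sup>2 / a\<^sup>2"
  have B: "0 < B" using s a_pos by (simp add: B_def)
  define z where "z n = 1 - eigval (s / bn n) - complex_of_real (V (s / bn n) / 2 + \<kappa> * (s / bn n)\<^sup>2)" for n
  have "(\<lambda>n. of_nat n * z n) \<longlonglongrightarrow> 0"
  proof (rule tendstoI)
    fix r :: real assume r: "0 < r"
    define \<epsilon> where "\<epsilon> = r / (2 * B)"
    have \<epsilon>: "0 < \<epsilon>" using r B by (simp add: \<epsilon>_def)
    have "eventually (\<lambda>n. norm (z n) \<le> \<epsilon> * V (s / bn n)) sequentially"
      unfolding z_def by (rule eventually_compose_filterlim[OF eigval_expansion[OF \<epsilon>] t_tendsto[OF s]])
    with nV_bounded[OF s] show "eventually (\<lambda>n. dist (of_nat n * z n) 0 < r) sequentially"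
    proof eventually_elim
      case (elim n)
      have "norm (of_nat n * z n) \<le> real n * (\<epsilon> * V (s / bn n))"
        unfolding norm_mult norm_of_nat using elim by (intro mult_left_mono) auto
      also have "\<dots> = \<epsilon> * (real n * V (s / bn n))" by simp
      also have "\<dots> \<le> \<epsilon> * B" using elim \<epsilon> by (intro mult_left_mono) (auto simp: B_def)
      also have "\<dots> < r" using r B by (simp add: \<epsilon>_def)
      finally show ?case by (simp add: dist_norm)
    qed
  qed
  moreover have "(\<lambda>n. complex_of_real (real n * (V (s / bn n) / 2 + \<kappa> * (s / bn n)\<^sup>2))) \<longlonglongrightarrow> complex_of_real (s\<^sup>2 / 2)"
    by (intro tendsto_of_real n_mean_tendsto s)
  ultimately have lim: "(\<lambda>n. - (of_nat n * z n) - complex_of_real (real n * (V (s / bn n) / 2 + \<kappa> * (s / bn n)\<^sup>2)))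
     \<longlonglongrightarrow> - 0 - complex_of_real (s\<^sup>2 / 2)"
    by (intro tendsto_diff tendsto_minus)
  have eq: "- (of_nat n * z n) - complex_of_real (real n * (V (s / bn n) / 2 + \<kappa> * (s / bn n)\<^sup>2))
      = of_nat n * (eigval (s / bn n) - 1)" for n
  proof -
    define m where "m = complex_of_real (V (s / bn n) / 2 + \<kappa> * (s / bn n)\<^sup>2)"
    have "complex_of_real (real n * (V (s / bn n) / 2 + \<kappa> * (s / bn n)\<^sup>2)) = of_nat n * m"
      by (simp only: of_real_mult of_real_of_nat_eq m_def)
    then show ?thesis by (simp only: z_def m_def[symmetric]) (simp add: algebra_simps)
  qed
  show ?thesis using lim unfolding eq by (simp only: minus_zero diff_0 of_real_minus)
qed

lemma f_tendsto: "(\<lambda>n. f n (s / bn n)) \<longlonglongrightarrow> complex_of_real (exp (- (s\<^sup>2 / 2)))"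
\<comment> \<open>The expansions hold along the punctured filter \<open>at 0\<close>, so frequency 0
  is treated directly.\<close>
proof (cases "s = 0")
  case True
  have "(P 0 ^^ n) (\<lambda>_. 1) x = 1" if "x \<in> space \<pi>" for n x
    using that
  proof (induction n arbitrary: x)
    case (Suc n)
    have "(P 0 ^^ Suc n) (\<lambda>_. 1) x = K (\<lambda>y. e 0 y * (P 0 ^^ n) (\<lambda>_. 1) y) x" by (simp add: P_def)
    also have "\<dots> = K (\<lambda>y. 1) x" using Suc by (intro K_cong) (auto simp: e_def)
    finally show ?case using K_const[OF Suc.prems] by simp
  qed simp
  then have "f n 0 = (LINT x|\<pi>. 1)" for n unfolding f_def by (intro Bochner_Integration.integral_cong) auto
  then show ?thesis using True by (simp add: prob_space)
next
  case s: False
  define t where "t n = s / bn n" for n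
  have tl: "filterlim t (at 0) sequentially" unfolding t_def by (rule t_tendsto[OF s])
  then have t0: "t \<longlonglongrightarrow> 0" by (simp add: filterlim_at)
  have nl: "(\<lambda>n. of_nat n * (eigval (t n) - 1)) \<longlonglongrightarrow> complex_of_real (- (s\<^sup>2 / 2))"
    unfolding t_def by (rule n_eigval_tendsto[OF s])
  have "(\<lambda>n. eigval (t n) ^ n) \<longlonglongrightarrow> exp (complex_of_real (- (s\<^sup>2 / 2)))" by (rule power_tendsto_exp[OF nl])
  then have pw: "(\<lambda>n. eigval (t n) ^ n) \<longlonglongrightarrow> complex_of_real (exp (- (s\<^sup>2 / 2)))" by (simp only: exp_of_real)
  define m where "m n = exp (real n * norm (eigval (t n) - 1))" for n
  have "(\<lambda>n. exp (norm (of_nat n * (eigval (t n) - 1)))) \<longlonglongrightarrow> exp (norm (complex_of_real (- (s\<^sup>2 / 2))))"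
    by (intro tendsto_exp tendsto_norm nl)
  then have m: "m \<longlonglongrightarrow> exp (norm (complex_of_real (- (s\<^sup>2 / 2))))" by (simp add: m_def[abs_def] norm_mult)
  have nR: "(\<lambda>n. real n * R (t n)) \<longlonglongrightarrow> 0"
  proof -
    obtain c where c: "c > 0" "eventually (\<lambda>t. R t \<le> c * \<bar>t\<bar> * V t) (at 0)" using R_le by blast
    show ?thesis
    proof (rule Lim_null_comparison)
      show "eventually (\<lambda>n. norm (real n * R (t n)) \<le> c * \<bar>t n\<bar> * (8 * s\<^sup>2 / a\<^sup>2)) sequentially"
        using eventually_compose_filterlim[OF c(2) tl] nV_bounded[OF s]
      proof eventually_elim
        case (elim n)
        have "real n * R (t n) \<le> real n * (c * \<bar>t n\<bar> * V (t n))" using elim(1) by (intro mult_left_mono) auto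
        also have "\<dots> = c * \<bar>t n\<bar> * (real n * V (t n))" by simp
        also have "\<dots> \<le> c * \<bar>t n\<bar> * (8 * s\<^sup>2 / a\<^sup>2)" using elim(2) c by (intro mult_left_mono) (auto simp: t_def)
        finally show ?case using R_nonneg[of "t n"] by simp
      qed
      have "(\<lambda>n. c * \<bar>t n\<bar> * (8 * s\<^sup>2 / a\<^sup>2)) \<longlonglongrightarrow> c * \<bar>0\<bar> * (8 * s\<^sup>2 / a\<^sup>2)" by (intro tendsto_intros t0)
      then show "(\<lambda>n. c * \<bar>t n\<bar> * (8 * s\<^sup>2 / a\<^sup>2)) \<longlonglongrightarrow> 0" by simp
    qed
  qed
  have "(\<lambda>n. E * \<bar>t n\<bar> + m n * (E * \<bar>t n\<bar>) + m n * (E * (real n * R (t n)))) \<longlonglongrightarrow>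
     E * \<bar>0\<bar> + exp (norm (complex_of_real (- (s\<^sup>2 / 2)))) * (E * \<bar>0\<bar>) + exp (norm (complex_of_real (- (s\<^sup>2 / 2)))) * (E * 0)"
    by (intro tendsto_add tendsto_mult tendsto_const m nR tendsto_rabs t0)
  then have err: "(\<lambda>n. E * \<bar>t n\<bar> + m n * (E * \<bar>t n\<bar>) + m n * (E * (real n * R (t n)))) \<longlonglongrightarrow> 0" by simp
  have "eventually (\<lambda>t. \<bar>t\<bar> \<le> 1) (at (0::real))"
    unfolding eventually_at by (intro exI[of _ 1]) (auto simp: dist_real_def)
  from eventually_compose_filterlim[OF this tl]
  have "eventually (\<lambda>n. norm (f n (t n) - eigval (t n) ^ n) \<le> E * \<bar>t n\<bar> + m n * (E * \<bar>t n\<bar>) + m n * (E * (real n * R (t n)))) sequentially"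
  proof eventually_elim
    case (elim n)
    then show ?case using f_minus_eigval_power[OF elim, of n] by (simp add: m_def mult_ac)
  qed
  from Lim_null_comparison[OF this err]
  have "(\<lambda>n. (f n (t n) - eigval (t n) ^ n) + eigval (t n) ^ n) \<longlonglongrightarrow> 0 + complex_of_real (exp (- (s\<^sup>2 / 2)))"
    by (intro tendsto_add pw)
  then show ?thesis by (simp add: t_def)
qed

text \<open>The contraction gives decay in n times \<open>V (s / bn n)\<close>, and the Potter bound
  with \<open>y = |s|\<close> shows that this quantity grows at least linearly in
  \<open>|s|\<close>, which makes the majorant integrable.\<close>

lemma f_dominated: "\<exists>\<delta>>0. \<exists>G. integrable lborel G \<and>
   eventually (\<lambda>n. \<forall>s. \<bar>s\<bar> \<le> \<delta> * bn n \<longrightarrow> norm (f n (s / bn n)) \<le> G s) sequentially"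
proof -
  obtain \<delta>1 where \<delta>1: "\<delta>1 > 0" "\<And>t. t \<noteq> 0 \<Longrightarrow> \<bar>t\<bar> < \<delta>1 \<Longrightarrow> norm (1 - \<phi> t - V t / 2) \<le> 1 / 4 * V t"
    using \<phi>_expansion[of "1/4"] unfolding eventually_at by (auto simp: dist_real_def)
  obtain \<delta>2 where \<delta>2: "\<delta>2 > 0" "\<And>t. t \<noteq> 0 \<Longrightarrow> \<bar>t\<bar> < \<delta>2 \<Longrightarrow> V t < 1"
    using order_tendstoD(2)[OF V_tendsto_0, of 1] unfolding eventually_at by (auto simp: dist_real_def)
  obtain x0 where x0: "x0 > 0" "\<And>x y. x \<ge> x0 \<Longrightarrow> 1 \<le> y \<Longrightarrow> 0 < H x \<and> H (y * x) \<le> 2 * y * H x"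
    using L.H_potter by blast
  \<comment> \<open>Halving turns the strict neighbourhoods into a closed one; \<open>1 / x0\<close>
    guarantees \<open>bn n / |s| \<ge> x0\<close>, the range of the Potter bound.\<close>
  define \<delta> where "\<delta> = min (min \<delta>1 \<delta>2 / 2) (1 / x0)"
  have \<delta>: "0 < \<delta>" "\<delta> < \<delta>1" "\<delta> < \<delta>2" "\<delta> \<le> 1 / x0" using \<delta>1(1) \<delta>2(1) x0(1) by (auto simp: \<delta>_def min_def)
  have decay: "V t / 4 \<le> 1 - norm (\<phi> t)" if t: "t \<noteq> 0" "\<bar>t\<bar> \<le> \<delta>" for t
  proof -
    have v: "norm (1 - \<phi> t - V t / 2) \<le> 1 / 4 * V t" "V t < 1" using t \<delta> \<delta>1(2)[of t] \<delta>2(2)[of t] by auto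
    have "norm (\<phi> t) \<le> norm (complex_of_real (1 - V t / 2)) + norm (complex_of_real (1 - V t / 2) - \<phi> t)"
      by (metis norm_triangle_sub norm_minus_commute)
    also have "norm (complex_of_real (1 - V t / 2)) = 1 - V t / 2" using v(2) V_nonneg[of t] by (simp only: norm_of_real)
    also have "norm (complex_of_real (1 - V t / 2) - \<phi> t) \<le> 1 / 4 * V t" using v(1) by (simp add: algebra_simps)
    finally show ?thesis by simp
  qed
  \<comment> \<open>Since \<open>H\<close> is at least \<open>H x0\<close> beyond \<open>x0\<close>,
    \<open>2 * \<kappa>\<close> is absorbed there: \<open>long_run_variance\<close> is at most
    \<open>c1 * H\<close>.\<close>
  define c1 where "c1 = 1 + 2 * \<bar>\<kappa>\<bar> / H x0"
  have Hx0: "0 < H x0" using x0(2)[of x0 1] by simp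
  have c1: "1 \<le> c1" using Hx0 by (simp add: c1_def)
  \<comment> \<open>24 is the product of 3 from \<open>n \<le> 3 * (n div 2)\<close>, 4 from
    \<open>decay\<close> and 2 from the Potter bound.\<close>
  define c where "c = a\<^sup>2 / (24 * c1)"
  have c: "0 < c" using a_pos c1 by (simp add: c_def)
  \<comment> \<open>The factor \<open>exp c\<close> makes \<open>G\<close> at least 1 on
    \<open>|s| \<le> 1\<close>, where only the trivial bound is used.\<close>
  define G where "G s = exp c * exp (- (c * \<bar>s\<bar>))" for s :: real
  have "eventually (\<lambda>n. \<forall>s. \<bar>s\<bar> \<le> \<delta> * bn n \<longrightarrow> norm (f n (s / bn n)) \<le> G s) sequentially"
    using nV_eq bn_pos bn_ge[of x0] H_over_long_run_variance eventually_ge_at_top[of 2]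
  proof eventually_elim
    case (elim n)
    show ?case
    proof (intro allI impI)
      fix s assume s: "\<bar>s\<bar> \<le> \<delta> * bn n"
      define t where "t = s / bn n"
      have t: "\<bar>t\<bar> \<le> \<delta>" using s elim(2) by (simp add: t_def abs_div pos_divide_le_eq)
      define q where "q = a\<^sup>2 * (1 - norm (\<phi> t))"
      have q: "0 \<le> 1 - q" "0 \<le> q" using two_step_factor(1)[of t] norm_\<phi>_le[of t] by (auto simp: q_def)
      have "norm (f n t) \<le> (1 - q) ^ (n div 2)" unfolding q_def by (rule norm_f_le)
      also have "\<dots> \<le> exp (- q) ^ (n div 2)" using q exp_ge_add_one_self[of "- q"] by (intro power_mono) auto
      also have "\<dots> = exp (- (real (n div 2) * q))" by (simp add: exp_of_nat_mult[symmetric])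
      finally have fle: "norm (f n t) \<le> exp (- (real (n div 2) * q))" .
      show "norm (f n (s / bn n)) \<le> G s"
      proof (cases "\<bar>s\<bar> \<le> 1")
        case True
        have "exp (- (real (n div 2) * q)) \<le> 1" using q by simp
        then have "norm (f n t) \<le> 1" using fle by linarith
        also have "\<dots> \<le> G s" using True c by (simp add: G_def exp_add[symmetric] mult_left_le)
        finally show ?thesis by (simp add: t_def)
      next
        case False
        then have s0: "s \<noteq> 0" "1 \<le> \<bar>s\<bar>" by auto
        have t0: "t \<noteq> 0" using s0 elim(2) by (simp add: t_def)
        have bs: "x0 \<le> bn n / \<bar>s\<bar>"
        proof -
          have "\<bar>s\<bar> * x0 \<le> (\<delta> * bn n) * x0" using s x0(1) by (intro mult_right_mono) auto
          also have "\<dots> \<le> (1 / x0 * bn n) * x0" using \<delta>(4) elim(2) x0(1) by (intro mult_right_mono) auto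
          also have "\<dots> = bn n" using x0(1) by simp
          finally show ?thesis using s0 by (simp add: field_simps)
        qed
        have H1: "H (bn n) \<le> 2 * \<bar>s\<bar> * H (bn n / \<bar>s\<bar>)"
          using x0(2)[OF bs s0(2)] s0 by simp
        have K1: "long_run_variance (bn n) \<le> c1 * H (bn n)"
        proof -
          have "2 * \<kappa> \<le> 2 * \<bar>\<kappa>\<bar> / H x0 * H x0" using Hx0 by simp
          also have "\<dots> \<le> 2 * \<bar>\<kappa>\<bar> / H x0 * H (bn n)" using Hx0 elim(3) by (intro mult_left_mono L.H_mono) auto
          finally show ?thesis by (simp add: long_run_variance_def c1_def distrib_right)
        qed
        have "\<bar>s\<bar> / (2 * c1) \<le> real n * V t"
        proof -
          have "\<bar>s\<bar> * long_run_variance (bn n) \<le> \<bar>s\<bar> * (c1 * (2 * \<bar>s\<bar> * H (bn n / \<bar>s\<bar>)))"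
            using K1 H1 c1 by (intro mult_left_mono order_trans[OF K1]) auto
          also have "\<dots> = (2 * c1) * (s\<^sup>2 * H (bn n / \<bar>s\<bar>))" by (simp add: power2_eq_square mult_ac)
          finally have "\<bar>s\<bar> / (2 * c1) \<le> s\<^sup>2 * H (bn n / \<bar>s\<bar>) / long_run_variance (bn n)"
            using elim(4) c1 by (simp add: field_simps)
          then show ?thesis using elim(1) s0 by (simp add: t_def)
        qed
        then have nV: "\<bar>s\<bar> / (2 * c1) * (a\<^sup>2 / 12) \<le> real n * V t * (a\<^sup>2 / 12)" by (intro mult_right_mono) auto
        have "n \<le> 3 * (n div 2)" using elim(5) by presburger
        then have "real n \<le> real (3 * (n div 2))" by (simp only: of_nat_le_iff)
        then have "real n \<le> 3 * real (n div 2)" by simp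
        then have "real n / 3 * (a\<^sup>2 * (V t / 4)) \<le> real (n div 2) * (a\<^sup>2 * (1 - norm (\<phi> t)))"
          using decay[OF t0 t] V_nonneg[of t] by (intro mult_mono) auto
        then have "c * \<bar>s\<bar> \<le> real (n div 2) * q" using nV by (simp add: q_def c_def field_simps)
        then have "exp (- (real (n div 2) * q)) \<le> exp (- (c * \<bar>s\<bar>))" by simp
        then have "norm (f n t) \<le> exp (- (c * \<bar>s\<bar>))" using fle by linarith
        also have "\<dots> \<le> G s" using c by (simp add: G_def)
        finally show ?thesis by (simp add: t_def)
      qed
    qed
  qed
  moreover have "integrable lborel G" unfolding G_def by (intro integrable_mult_right integrable_exp_neg_abs c)
  ultimately show ?thesis using \<delta>(1) by blast
qed

lemma \<phi>_continuous: "continuous_on A \<phi>"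
  using L.isCont_char unfolding char_law by (simp add: continuous_at_imp_continuous_on)

text \<open>On the compact frequency range the continuous \<open>norm (\<phi> t)\<close> has a
  maximum below 1, so the contraction is geometric, and this beats \<open>bn n\<close>, which grows
  at most linearly.\<close>

lemma f_away:
  assumes \<delta>: "0 < \<delta>"
  shows "\<exists>r. (\<forall>n. 0 \<le> r n) \<and> (\<forall>n t. \<delta> \<le> \<bar>t\<bar> \<and> \<bar>t\<bar> \<le> T \<longrightarrow> norm (f n t) \<le> r n) \<and> (\<lambda>n. bn n * r n) \<longlonglongrightarrow> 0"
proof -
  define A where "A = {-T..-\<delta>} \<union> {\<delta>..T}"
  have cA: "compact A" by (simp add: A_def compact_Un)
  have A: "t \<in> A \<longleftrightarrow> \<delta> \<le> \<bar>t\<bar> \<and> \<bar>t\<bar> \<le> T" for t using \<delta> by (auto simp: A_def)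
  obtain \<rho> where \<rho>: "\<rho> < 1" "\<And>t. t \<in> A \<Longrightarrow> norm (\<phi> t) \<le> \<rho>"
  proof (cases "A = {}")
    case True then show ?thesis using that[of 0] by auto
  next
    case False
    have "continuous_on A (\<lambda>t. norm (\<phi> t))" by (intro continuous_intros \<phi>_continuous)
    from continuous_attains_sup[OF cA False this]
    obtain t0 where t0: "t0 \<in> A" "\<And>t. t \<in> A \<Longrightarrow> norm (\<phi> t) \<le> norm (\<phi> t0)" by blast
    have "t0 \<noteq> 0" using t0(1) \<delta> by (auto simp: A)
    then show ?thesis using aperiodic[of t0] t0(2) that[of "norm (\<phi> t0)"] by auto
  qed
  \<comment> \<open>The maximum with \<open>1/2\<close> keeps \<open>q\<close> positive, as division
    by \<open>sqrt q\<close> follows.\<close>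
  define q where "q = max (1/2) (1 - a\<^sup>2 * (1 - \<rho>))"
  have q: "0 < q" "q < 1" using \<rho>(1) a_pos by (auto simp: q_def)
  have bound: "norm (f n t) \<le> q ^ (n div 2)" if "t \<in> A" for n t
  proof -
    have "a\<^sup>2 * (1 - \<rho>) \<le> a\<^sup>2 * (1 - norm (\<phi> t))" using \<rho>(2)[OF that] by (intro mult_left_mono) auto
    then have "1 - a\<^sup>2 * (1 - norm (\<phi> t)) \<le> q" by (simp add: q_def)
    then have "(1 - a\<^sup>2 * (1 - norm (\<phi> t))) ^ (n div 2) \<le> q ^ (n div 2)"
      using two_step_factor(1)[of t] by (intro power_mono) auto
    then show ?thesis using norm_f_le[of n t] by linarith
  qed
  obtain C where C: "C \<ge> 0" "\<And>x. 1 \<le> x \<Longrightarrow> long_run_variance x \<le> C * x" using long_run_variance_linear by blast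
  have "(\<lambda>n. bn n * q ^ (n div 2)) \<longlonglongrightarrow> 0"
  proof (rule Lim_null_comparison)
    show "eventually (\<lambda>n. norm (bn n * q ^ (n div 2)) \<le> C / sqrt q * (real n * sqrt q ^ n)) sequentially"
      using bn_ge[of 1] bn_eq
    proof eventually_elim
      case (elim n)
      have "bn n * bn n = real n * long_run_variance (bn n)" using elim(2) by (simp add: power2_eq_square)
      also have "\<dots> \<le> real n * (C * bn n)" using C(2)[OF elim(1)] by (rule mult_left_mono) simp
      also have "\<dots> = (C * real n) * bn n" by simp
      finally have "bn n \<le> C * real n" using elim(1) by (simp add: mult_le_cancel_right)
      then have "bn n * q ^ (n div 2) \<le> (C * real n) * (sqrt q ^ n / sqrt q)"
        using half_power_bound[OF q, of n] C(1) q(1) by (intro mult_mono) auto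
      then show ?case using elim(1) q by (simp add: abs_mult mult_ac)
    qed
    have "(\<lambda>n. C / sqrt q * (real n * sqrt q ^ n)) \<longlonglongrightarrow> C / sqrt q * 0"
      using q by (intro tendsto_mult tendsto_const powser_times_n_limit_0) simp
    then show "(\<lambda>n. C / sqrt q * (real n * sqrt q ^ n)) \<longlonglongrightarrow> 0" by simp
  qed
  then show ?thesis using bound q(1) by (intro exI[of _ "\<lambda>n. q ^ (n div 2)"]) (auto simp: A)
qed

end

text \<open>The laws enter through their characteristic functions alone, and one sequence is fixed
  before the bandwidth \<open>T\<close>, as it must serve every test function.\<close>

theorem char_error_limit:
  "\<exists>bn. filterlim bn at_top sequentially \<and>
     (\<forall>\<mu>. (\<forall>n. real_distribution (\<mu> n)) \<longrightarrow> (\<forall>n t. char (\<mu> n) t = f n t) \<longrightarrow>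
        (\<forall>T>0. (\<lambda>n. char_error (\<mu> n) (bn n) T) \<longlonglongrightarrow> 0))"
proof -
  obtain bn :: "nat \<Rightarrow> real" where bn: "filterlim bn at_top sequentially"
    "eventually (\<lambda>n. real n * long_run_variance (bn n) = (bn n)\<^sup>2) sequentially" using norming_exists by blast
  show ?thesis
  proof (intro exI[of _ bn] conjI allI impI)
    fix \<mu> :: "nat \<Rightarrow> real measure" and T :: real
    assume \<mu>: "\<forall>n. real_distribution (\<mu> n)" and ch: "\<forall>n t. char (\<mu> n) t = f n t" and T: "0 < T"
    obtain \<delta> G where \<delta>: "\<delta> > 0" "integrable lborel G"
      "eventually (\<lambda>n. \<forall>s. \<bar>s\<bar> \<le> \<delta> * bn n \<longrightarrow> norm (f n (s / bn n)) \<le> G s) sequentially"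
      using f_dominated[OF bn] by blast
    obtain r where r: "\<And>n. 0 \<le> r n" "\<And>n t. \<delta> \<le> \<bar>t\<bar> \<and> \<bar>t\<bar> \<le> T \<Longrightarrow> norm (f n t) \<le> r n" "(\<lambda>n. bn n * r n) \<longlonglongrightarrow> 0"
      using f_away[OF bn \<delta>(1), of T] by blast
    show "(\<lambda>n. char_error (\<mu> n) (bn n) T) \<longlonglongrightarrow> 0"
      by (rule char_error_tendsto_0[OF _ bn(1) T _ \<delta>(1,2) _ _ r(1,3)])
        (use \<mu> ch f_tendsto[OF bn] \<delta>(3) r(2) in auto)
  qed (rule bn(1))
qed

end

subsection \<open>Stationary Markov chains\<close>

locale stationary_markov = prob_space M for M :: "'w measure" +
  fixes S :: "'s measure" and \<xi> :: "int \<Rightarrow> 'w \<Rightarrow> 's" and Q :: "'s \<Rightarrow> 's measure"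
    and a b :: real and S' :: "'s set"
  assumes stationary: "strictly_stationary S \<xi>"
    and markov: "markov_chain_with S Q \<xi>"
    and a_pos: "0 < a"
    and S': "S' \<in> sets S" "measure (distr M S (\<xi> 0)) S' = 1"
    and Q_bounds: "\<And>x A. x \<in> S' \<Longrightarrow> A \<in> sets S \<Longrightarrow>
      a * measure (distr M S (\<xi> 0)) A \<le> measure (Q x) A \<and> measure (Q x) A \<le> b * measure (distr M S (\<xi> 0)) A"
begin

abbreviation \<pi> :: "'s measure" where "\<pi> \<equiv> distr M S (\<xi> 0)"

text \<open>Off the full set \<^term>\<open>S'\<close> the kernel is replaced by \<^term>\<open>\<pi>\<close>, so that the two-sided bound holds everywhere.\<close>

definition Q' :: "'s \<Rightarrow> 's measure" where "Q' x = (if x \<in> S' then Q x else \<pi>)"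

lemma \<xi>_measurable [measurable]: "\<xi> k \<in> M \<rightarrow>\<^sub>M S"
  using stationary by (simp add: strictly_stationary_def)

lemma marginal: "distr M S (\<xi> k) = \<pi>"
proof -
  have shift: "distr M (\<Pi>\<^sub>M k\<in>UNIV. S) (\<lambda>\<omega> j. \<xi> (j + k) \<omega>) = distr M (\<Pi>\<^sub>M k\<in>UNIV. S) (\<lambda>\<omega> j. \<xi> j \<omega>)"
    using stationary by (simp add: strictly_stationary_def)
  have path: "(\<lambda>\<omega> j. \<xi> (j + m) \<omega>) \<in> M \<rightarrow>\<^sub>M (\<Pi>\<^sub>M k\<in>UNIV. S)" for m
    using measurable_PiM_single'[of UNIV "\<lambda>j \<omega>. \<xi> (j + m) \<omega>" M "\<lambda>_. S"] measurable_space[OF \<xi>_measurable] by auto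
  have "distr (distr M (\<Pi>\<^sub>M k\<in>UNIV. S) (\<lambda>\<omega> j. \<xi> (j + m) \<omega>)) S (\<lambda>x. x 0) = distr M S (\<xi> m)" for m
    by (subst distr_distr) (auto simp: comp_def path intro: measurable_component_singleton)
  from this[of k] this[of 0] show ?thesis by (simp add: shift)
qed

lemma prob_space_\<pi>: "prob_space \<pi>"
  by (rule prob_space_distr) simp

lemma Q_measurable: "Q \<in> S \<rightarrow>\<^sub>M prob_algebra S"
  using markov by (simp add: markov_chain_with_def)

lemma Q'_measurable [measurable]: "Q' \<in> S \<rightarrow>\<^sub>M prob_algebra S"
  unfolding Q'_def
proof (rule measurable_If_set)
  show "(\<lambda>x. \<pi>) \<in> S \<rightarrow>\<^sub>M prob_algebra S"
    using prob_space_\<pi> by (intro measurable_const) (simp add: space_prob_algebra)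
qed (use Q_measurable S' in auto)

lemma Q'_subprob [measurable]: "Q' \<in> S \<rightarrow>\<^sub>M subprob_algebra S"
  by (rule measurable_prob_algebraD[OF Q'_measurable])

lemma Q'_prob: "x \<in> space S \<Longrightarrow> prob_space (Q' x)" "x \<in> space S \<Longrightarrow> sets (Q' x) = sets S"
  using measurable_space[OF Q'_measurable] by (auto simp: space_prob_algebra)

lemma AE_S': "AE \<omega> in M. \<xi> k \<omega> \<in> S'"
proof -
  interpret p: prob_space \<pi> by (rule prob_space_\<pi>)
  have "AE x in \<pi>. x \<in> S'" using S' by (intro p.AE_prob_1) simp
  then have "AE x in distr M S (\<xi> k). x \<in> S'" by (subst marginal)
  then show ?thesis using S' by (subst (asm) AE_distr_iff) auto
qed

lemma past_subalgebra: "subalgebra M (past S \<xi> k)"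
proof -
  have "{\<xi> j -` A \<inter> space M | j A. j \<le> k \<and> A \<in> sets S} \<subseteq> sets M" by auto
  then show ?thesis unfolding subalgebra_def past_def
    by (auto simp: space_measure_of_conv sets_measure_of_conv intro!: sets.sigma_sets_subset dest: sets.sets_into_space)
qed

lemma space_past: "space (past S \<xi> k) = space M"
  by (simp add: past_def space_measure_of_conv)

lemma \<xi>_past: "j \<le> k \<Longrightarrow> \<xi> j \<in> past S \<xi> k \<rightarrow>\<^sub>M S"
proof (rule measurableI)
  show "\<xi> j x \<in> space S" if "x \<in> space (past S \<xi> k)" for x
    using that measurable_space[OF \<xi>_measurable] by (simp add: space_past)
  show "\<xi> j -` A \<inter> space (past S \<xi> k) \<in> sets (past S \<xi> k)" if "j \<le> k" "A \<in> sets S" for A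
    unfolding space_past unfolding past_def using that
    by (subst sets_measure_of) (auto intro!: sigma_sets.Basic)
qed

text \<open>Extends the Markov property from conditional probabilities to bounded weights from the
  past. \<open>Q\<close> may be exchanged for \<open>Q'\<close> because every \<open>\<xi> k\<close>
  lies in \<open>S'\<close> almost surely, all marginals being \<open>\<pi>\<close>.\<close>

lemma cond_exp_step:
  assumes W: "W \<in> borel_measurable (past S \<xi> k)" "\<And>\<omega>. \<bar>W \<omega>\<bar> \<le> C" and A: "A \<in> sets S"
  shows "(LINT \<omega>|M. W \<omega> * indicator A (\<xi> (k + 1) \<omega>)) = (LINT \<omega>|M. W \<omega> * measure (Q' (\<xi> k \<omega>)) A)"
proof -
  interpret sigma_finite_subalgebra M "past S \<xi> k"
    by (rule finite_measure_subalgebra_is_sigma_finite)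
      (simp add: finite_measure_subalgebra_def finite_measure_subalgebra_axioms_def past_subalgebra finite_measure_axioms)
  have Wm [measurable]: "W \<in> borel_measurable M" by (rule measurable_from_subalg[OF past_subalgebra W(1)])
  define h where "h = (indicator (\<xi> (k + 1) -` A \<inter> space M) :: 'w \<Rightarrow> real)"
  have hm [measurable]: "h \<in> borel_measurable M" unfolding h_def using A by measurable
  have int: "integrable M (\<lambda>\<omega>. W \<omega> * h \<omega>)"
  proof (rule integrable_const_bound[of _ C])
    show "AE \<omega> in M. norm (W \<omega> * h \<omega>) \<le> C"
      using W(2) order_trans[OF abs_ge_zero W(2)] by (intro AE_I2) (auto simp: h_def indicator_def)
  qed measurable
  have "AE \<omega> in M. real_cond_exp M (past S \<xi> (k + 1 - 1)) h \<omega> = measure (Q (\<xi> (k + 1 - 1) \<omega>)) A"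
    using markov A unfolding markov_chain_with_def h_def by blast
  then have ce: "AE \<omega> in M. real_cond_exp M (past S \<xi> k) h \<omega> = measure (Q' (\<xi> k \<omega>)) A"
    using AE_S'[of k] by eventually_elim (simp add: Q'_def)
  have "(LINT \<omega>|M. W \<omega> * indicator A (\<xi> (k + 1) \<omega>)) = (LINT \<omega>|M. W \<omega> * h \<omega>)"
    by (intro Bochner_Integration.integral_cong) (auto simp: h_def indicator_def)
  also have "\<dots> = (LINT \<omega>|M. W \<omega> * real_cond_exp M (past S \<xi> k) h \<omega>)"
    by (rule real_cond_exp_intg(2)[OF int W(1) hm, symmetric])
  also have "\<dots> = (LINT \<omega>|M. W \<omega> * measure (Q' (\<xi> k \<omega>)) A)"
  proof (rule integral_cong_AE)
    show "(\<lambda>\<omega>. W \<omega> * measure (Q' (\<xi> k \<omega>)) A) \<in> borel_measurable M"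
      using A measurable_compose[OF \<xi>_measurable measurable_compose[OF Q'_subprob measurable_measure_subprob_algebra[OF A]]]
      by measurable
    show "AE x in M. W x * real_cond_exp M (past S \<xi> k) h x = W x * measure (Q' (\<xi> k x)) A"
      using ce by eventually_elim simp
  qed simp
  finally show ?thesis .
qed

text \<open>For a nonnegative weight the Markov property becomes an identity of measures: under the
  weighted measure the law at time \<open>k + 1\<close> is the law at time \<open>k\<close> moved by
  the kernel. Integration rules for \<open>bind\<close> then pass from sets to functions, and weight
  1 gives invariance of \<open>\<pi>\<close>.\<close>

lemma bind_step:
  fixes W :: "'w \<Rightarrow> real"
  assumes W: "W \<in> borel_measurable (past S \<xi> k)" "\<And>\<omega>. 0 \<le> W \<omega>" "\<And>\<omega>. W \<omega> \<le> C"
  shows "distr (density M W) S (\<xi> (k + 1)) = distr (density M W) S (\<xi> k) \<bind> Q'"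
proof (rule measure_eqI)
  have Wm [measurable]: "W \<in> borel_measurable M" by (rule measurable_from_subalg[OF past_subalgebra W(1)])
  have ne: "space S \<noteq> {}" using not_empty measurable_space[OF \<xi>_measurable] by blast
  have sb: "sets (distr (density M W) S (\<xi> k) \<bind> Q') = sets S"
    by (rule sets_bind) (use ne Q'_prob in auto)
  then show "sets (distr (density M W) S (\<xi> (k + 1))) = sets (distr (density M W) S (\<xi> k) \<bind> Q')" by simp
  fix A assume "A \<in> sets (distr (density M W) S (\<xi> (k + 1)))"
  then have A [measurable]: "A \<in> sets S" by simp
  have mm [measurable]: "(\<lambda>\<omega>. measure (Q' (\<xi> k \<omega>)) A) \<in> borel_measurable M"
    using measurable_compose[OF \<xi>_measurable measurable_compose[OF Q'_subprob measurable_measure_subprob_algebra[OF A]]] .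
  have C: "0 \<le> C" using W(2,3) order_trans by blast
  have Wi: "integrable M (\<lambda>\<omega>. W \<omega> * z \<omega>)" if "z \<in> borel_measurable M" "\<And>\<omega>. \<omega> \<in> space M \<Longrightarrow> 0 \<le> z \<omega> \<and> z \<omega> \<le> 1" for z :: "'w \<Rightarrow> real"
  proof (rule integrable_const_bound[of _ C])
    show "AE \<omega> in M. norm (W \<omega> * z \<omega>) \<le> C"
      using W(2,3) C that(2) mult_mono[of "W _" C "z _" 1] by (intro AE_I2) (force simp: abs_mult)
  qed (use that in measurable)
  have "emeasure (distr (density M W) S (\<xi> (k + 1))) A = (\<integral>\<^sup>+\<omega>. ennreal (W \<omega>) * indicator (\<xi> (k + 1) -` A \<inter> space M) \<omega> \<partial>M)"
    by (simp add: emeasure_distr emeasure_density)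
  also have "\<dots> = (\<integral>\<^sup>+\<omega>. ennreal (W \<omega> * indicator A (\<xi> (k + 1) \<omega>)) \<partial>M)"
    by (intro nn_integral_cong) (auto simp: indicator_def)
  also have "\<dots> = ennreal (LINT \<omega>|M. W \<omega> * indicator A (\<xi> (k + 1) \<omega>))"
    using W(2) by (intro nn_integral_eq_integral Wi) (auto simp: indicator_def)
  also have "\<dots> = ennreal (LINT \<omega>|M. W \<omega> * measure (Q' (\<xi> k \<omega>)) A)"
    using cond_exp_step[OF W(1) _ A, of C] W(2,3) by simp
  also have "\<dots> = (\<integral>\<^sup>+\<omega>. ennreal (W \<omega> * measure (Q' (\<xi> k \<omega>)) A) \<partial>M)"
    using W(2) Q'_prob measurable_space[OF \<xi>_measurable]
    by (intro nn_integral_eq_integral[symmetric] Wi) (auto intro: prob_space.prob_le_1)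
  also have "\<dots> = (\<integral>\<^sup>+\<omega>. ennreal (W \<omega>) * emeasure (Q' (\<xi> k \<omega>)) A \<partial>M)"
  proof (intro nn_integral_cong)
    fix \<omega> assume "\<omega> \<in> space M"
    then interpret q: prob_space "Q' (\<xi> k \<omega>)" using Q'_prob measurable_space[OF \<xi>_measurable] by blast
    show "ennreal (W \<omega> * measure (Q' (\<xi> k \<omega>)) A) = ennreal (W \<omega>) * emeasure (Q' (\<xi> k \<omega>)) A"
      using W(2) by (simp add: q.emeasure_eq_measure ennreal_mult)
  qed
  also have "\<dots> = (\<integral>\<^sup>+\<omega>. emeasure (Q' (\<xi> k \<omega>)) A \<partial>density M W)"
    using measurable_compose[OF \<xi>_measurable measurable_compose[OF Q'_subprob measurable_emeasure_subprob_algebra[OF A]]]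
    by (subst nn_integral_density) auto
  also have "\<dots> = (\<integral>\<^sup>+x. emeasure (Q' x) A \<partial>distr (density M W) S (\<xi> k))"
    using measurable_compose[OF Q'_subprob measurable_emeasure_subprob_algebra[OF A]]
    by (subst nn_integral_distr) auto
  also have "\<dots> = emeasure (distr (density M W) S (\<xi> k) \<bind> Q') A"
    using ne by (subst emeasure_bind[where N=S]) auto
  finally show "emeasure (distr (density M W) S (\<xi> (k + 1))) A = emeasure (distr (density M W) S (\<xi> k) \<bind> Q') A" .
qed

lemma invariant: "\<pi> \<bind> Q' = \<pi>"
proof -
  have "distr (density M (\<lambda>_. 1)) S (\<xi> (0 + 1)) = distr (density M (\<lambda>_. 1)) S (\<xi> 0) \<bind> Q'"
    using bind_step[of "\<lambda>_. 1" 0 1] by simp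
  then show ?thesis by (simp add: density_1 marginal[of 1])
qed

lemma kernel: "bounded_kernel \<pi> Q' a b"
proof -
  interpret p: prob_space \<pi> by (rule prob_space_\<pi>)
  \<comment> \<open>Off \<open>S'\<close> the kernel is \<open>\<pi>\<close> itself, where the
    two-sided bound amounts to \<open>a \<le> 1 \<le> b\<close>; this is read off from the total
    masses at a point of \<open>S'\<close>.\<close>
  have a1: "a \<le> 1" "1 \<le> b"
  proof -
    have "S' \<noteq> {}" using S'(2) by auto
    then obtain x where x: "x \<in> S'" by auto
    then have "x \<in> space S" using S'(1) sets.sets_into_space by blast
    then interpret q: prob_space "Q' x" by (rule Q'_prob)
    have m1: "measure (Q x) (space S) = 1"
    proof -
      have "space (Q' x) = space S" by (rule sets_eq_imp_space_eq[OF Q'_prob(2)[OF \<open>x \<in> space S\<close>]])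
      moreover have "Q' x = Q x" using x by (simp add: Q'_def)
      ultimately show ?thesis using q.prob_space by (simp only:)
    qed
    have "measure \<pi> (space S) = 1" using p.prob_space by (simp only: space_distr)
    with Q_bounds[OF x sets.top] m1 show "a \<le> 1" "1 \<le> b" by simp_all
  qed
  show ?thesis
  proof
    show "Q' \<in> \<pi> \<rightarrow>\<^sub>M prob_algebra \<pi>"
    proof -
      have "prob_algebra \<pi> = prob_algebra S"
        unfolding prob_algebra_def by (simp add: subprob_algebra_cong[of \<pi> S])
      moreover have "\<pi> \<rightarrow>\<^sub>M N = S \<rightarrow>\<^sub>M N" for N :: "'s measure measure"
        by (intro measurable_cong_sets) auto
      ultimately show ?thesis using Q'_measurable by simp
    qed
    fix x A assume "x \<in> space \<pi>" "A \<in> sets \<pi>"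
    then show "a * measure \<pi> A \<le> measure (Q' x) A" "measure (Q' x) A \<le> b * measure \<pi> A"
      using Q_bounds[of x A] a1 mult_right_mono[OF a1(1), of "measure \<pi> A"] mult_right_mono[OF a1(2), of "measure \<pi> A"]
      by (auto simp: Q'_def)
  qed (use a_pos invariant in auto)
qed

sublocale B: bounded_kernel \<pi> Q' a b by (rule kernel)

lemma real_step:
  fixes f W :: "_ \<Rightarrow> real"
  assumes W: "W \<in> borel_measurable (past S \<xi> k)" "\<And>\<omega>. \<bar>W \<omega>\<bar> \<le> C"
    and f: "f \<in> borel_measurable S" "\<And>x. x \<in> space S \<Longrightarrow> \<bar>f x\<bar> \<le> D"
  shows "(LINT \<omega>|M. W \<omega> * f (\<xi> (k + 1) \<omega>)) = (LINT \<omega>|M. W \<omega> * (LINT y|Q' (\<xi> k \<omega>). f y))"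
proof -
  have fm [measurable]: "f \<in> borel_measurable S" by fact
  have km [measurable]: "(\<lambda>x. LINT y|Q' x. f y) \<in> borel_measurable S"
    using measurable_compose[OF Q'_subprob integral_measurable_subprob_algebra[OF f(1)]] .
  have Km: "\<bar>LINT y|Q' x. f y\<bar> \<le> D" if x: "x \<in> space S" for x
  proof -
    interpret q: prob_space "Q' x" by (rule Q'_prob[OF x])
    have sp: "space (Q' x) = space S" "sets (Q' x) = sets S" using Q'_prob(2)[OF x] sets_eq_imp_space_eq by auto
    have "\<bar>LINT y|Q' x. f y\<bar> \<le> (LINT y|Q' x. \<bar>f y\<bar>)" by (rule integral_abs_bound)
    also have "\<dots> \<le> (LINT y|Q' x. D)"
    proof (rule integral_mono)
      show "integrable (Q' x) (\<lambda>y. \<bar>f y\<bar>)"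
        using f(2) fm sp by (intro q.integrable_const_bound[of _ D] AE_I2) (auto cong: measurable_cong_sets)
    qed (use f(2) sp in auto)
    finally show ?thesis by (simp add: q.prob_space)
  qed
  have nonneg: "(LINT \<omega>|M. U \<omega> * f (\<xi> (k + 1) \<omega>)) = (LINT \<omega>|M. U \<omega> * (LINT y|Q' (\<xi> k \<omega>). f y))"
    if U: "U \<in> borel_measurable (past S \<xi> k)" "\<And>\<omega>. 0 \<le> U \<omega>" "\<And>\<omega>. U \<omega> \<le> E" for U E
  proof -
    have Um [measurable]: "U \<in> borel_measurable M" by (rule measurable_from_subalg[OF past_subalgebra U(1)])
    have "(\<integral>\<^sup>+\<omega>. ennreal (U \<omega>) \<partial>M) \<le> (\<integral>\<^sup>+\<omega>. ennreal E \<partial>M)"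
      using U by (intro nn_integral_mono ennreal_leI) auto
    then have "emeasure (density M U) (space M) \<noteq> \<infinity>"
      by (simp add: emeasure_density emeasure_space_1 cong: nn_integral_cong) (metis ennreal_less_top not_le top.not_eq_extremum)
    then have fin: "finite_measure (distr (density M U) S (\<xi> k))"
      by (intro finite_measure.finite_measure_distr finite_measureI) auto
    have "(LINT \<omega>|M. U \<omega> * f (\<xi> (k + 1) \<omega>)) = (LINT x|distr (density M U) S (\<xi> (k + 1)). f x)"
      using U(2) by (subst integral_distr, simp, simp, subst integral_density) auto
    also have "\<dots> = (LINT x|distr (density M U) S (\<xi> k). LINT y|Q' x. f y)"
      unfolding bind_step[OF U]
    proof (rule integral_bind[where B=D and B'=1 and K=S])
      show "AE x in distr (density M U) S (\<xi> k). emeasure (Q' x) (space (Q' x)) \<le> ennreal 1"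
        using prob_space.emeasure_space_1[OF Q'_prob(1)] by (intro AE_I2) auto
    qed (use f fin in auto)
    also have "\<dots> = (LINT \<omega>|M. U \<omega> * (LINT y|Q' (\<xi> k \<omega>). f y))"
      using U(2) by (subst integral_distr, simp, simp, subst integral_density) auto
    finally show ?thesis .
  qed
  have Wm [measurable]: "W \<in> borel_measurable M" by (rule measurable_from_subalg[OF past_subalgebra W(1)])
  have C: "0 \<le> C" using W(2) order_trans[OF abs_ge_zero] by blast
  have int: "integrable M (\<lambda>\<omega>. W \<omega> * h (\<xi> j \<omega>))" "integrable M (\<lambda>\<omega>. C * h (\<xi> j \<omega>))"
    if h: "h \<in> borel_measurable S" "\<And>x. x \<in> space S \<Longrightarrow> \<bar>h x\<bar> \<le> D" for h :: "'s \<Rightarrow> real" and j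
  proof -
    have hm [measurable]: "h \<in> borel_measurable S" by fact
    have hx: "\<bar>h (\<xi> j \<omega>)\<bar> \<le> D" if "\<omega> \<in> space M" for \<omega> using h(2) measurable_space[OF \<xi>_measurable that] by blast
    show "integrable M (\<lambda>\<omega>. W \<omega> * h (\<xi> j \<omega>))"
      using W(2) C hx by (intro integrable_const_bound[of _ "C * D"] AE_I2) (auto simp: abs_mult intro!: mult_mono)
    show "integrable M (\<lambda>\<omega>. C * h (\<xi> j \<omega>))"
      using C hx by (intro integrable_const_bound[of _ "C * D"] AE_I2) (auto simp: abs_mult intro!: mult_left_mono)
  qed
  \<comment> \<open>A signed weight is written as the difference of the nonnegative weights
    \<open>W + C\<close> and \<open>C\<close>.\<close>
  have "W \<omega> + C \<le> 2 * C" "0 \<le> W \<omega> + C" for \<omega> using W(2)[of \<omega>] by (auto simp: abs_le_iff)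
  then have "(LINT \<omega>|M. (W \<omega> + C) * f (\<xi> (k + 1) \<omega>)) = (LINT \<omega>|M. (W \<omega> + C) * (LINT y|Q' (\<xi> k \<omega>). f y))"
    using W(1) by (intro nonneg[of _ "2 * C"]) auto
  moreover have "(LINT \<omega>|M. C * f (\<xi> (k + 1) \<omega>)) = (LINT \<omega>|M. C * (LINT y|Q' (\<xi> k \<omega>). f y))"
    using C by (intro nonneg[of _ C]) auto
  ultimately show ?thesis
    using int[OF f] int[OF km Km] by (simp add: distrib_right del: integral_mult_right integral_mult_right_zero)
qed

lemma complex_step:
  fixes F W :: "_ \<Rightarrow> complex"
  assumes W: "W \<in> borel_measurable (past S \<xi> k)" "\<And>\<omega>. norm (W \<omega>) \<le> 1" and F: "B.bnd D F"
  shows "(LINT \<omega>|M. W \<omega> * F (\<xi> (k + 1) \<omega>)) = (LINT \<omega>|M. W \<omega> * B.K F (\<xi> k \<omega>))"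
proof -
  have Wm [measurable]: "W \<in> borel_measurable M" by (rule measurable_from_subalg[OF past_subalgebra W(1)])
  have Fm [measurable]: "F \<in> borel_measurable S" using F by (simp add: B.bnd_def)
  have int: "integrable M (\<lambda>\<omega>. W \<omega> * G (\<xi> j \<omega>))" if "B.bnd D G" for G j
  proof (rule integrable_const_bound[of _ D])
    show "AE \<omega> in M. norm (W \<omega> * G (\<xi> j \<omega>)) \<le> D"
      using that W(2) measurable_space[OF \<xi>_measurable, of _ j] mult_mono[of "norm (W _)" 1 "norm (G _)" D] B.bnd_nonneg[OF that]
      by (intro AE_I2) (force simp: norm_mult B.bnd_def)
    have "G \<in> borel_measurable S" using that by (simp add: B.bnd_def)
    then show "(\<lambda>\<omega>. W \<omega> * G (\<xi> j \<omega>)) \<in> borel_measurable M" by measurable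
  qed
  have Wb: "\<bar>Re (W \<omega>)\<bar> \<le> 1" "\<bar>Im (W \<omega>)\<bar> \<le> 1" for \<omega>
    using W(2)[of \<omega>] abs_Re_le_cmod[of "W \<omega>"] abs_Im_le_cmod[of "W \<omega>"] by auto
  have Fb: "\<bar>Re (F x)\<bar> \<le> D" "\<bar>Im (F x)\<bar> \<le> D" if "x \<in> space S" for x
    using F that abs_Re_le_cmod[of "F x"] abs_Im_le_cmod[of "F x"] by (force simp: B.bnd_def)+
  have Wr: "(\<lambda>\<omega>. Re (W \<omega>)) \<in> borel_measurable (past S \<xi> k)" "(\<lambda>\<omega>. Im (W \<omega>)) \<in> borel_measurable (past S \<xi> k)"
    using W(1) by auto
  have Fr: "(\<lambda>x. Re (F x)) \<in> borel_measurable S" "(\<lambda>x. Im (F x)) \<in> borel_measurable S" by auto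
  have K: "(LINT y|Q' (\<xi> k \<omega>). Re (F y)) = Re (B.K F (\<xi> k \<omega>))" "(LINT y|Q' (\<xi> k \<omega>). Im (F y)) = Im (B.K F (\<xi> k \<omega>))"
    if "\<omega> \<in> space M" for \<omega>
    using B.integrable_kernel[OF _ B.bnd_integrable[OF F], of "\<xi> k \<omega>"] measurable_space[OF \<xi>_measurable that]
    by (simp_all add: B.K_def)
  note step = real_step[OF Wr(1) Wb(1) Fr(1) Fb(1)] real_step[OF Wr(1) Wb(1) Fr(2) Fb(2)]
    real_step[OF Wr(2) Wb(2) Fr(1) Fb(1)] real_step[OF Wr(2) Wb(2) Fr(2) Fb(2)]
  have Kc: "(LINT \<omega>|M. p \<omega> * (LINT y|Q' (\<xi> k \<omega>). Re (F y))) = (LINT \<omega>|M. p \<omega> * Re (B.K F (\<xi> k \<omega>)))"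
    "(LINT \<omega>|M. p \<omega> * (LINT y|Q' (\<xi> k \<omega>). Im (F y))) = (LINT \<omega>|M. p \<omega> * Im (B.K F (\<xi> k \<omega>)))" for p
    by (intro Bochner_Integration.integral_cong refl; simp add: K)+
  note step' = step[unfolded Kc]
  have ii: "integrable M (\<lambda>\<omega>. p (W \<omega>) * q (G (\<xi> j \<omega>)))"
    if "B.bnd D G" "p = Re \<or> p = Im" "q = Re \<or> q = Im" for G j p q
  proof (rule integrable_const_bound[of _ D])
    have b: "\<bar>p (W \<omega>)\<bar> \<le> 1" for \<omega> using that(2) Wb by auto
    show "AE \<omega> in M. norm (p (W \<omega>) * q (G (\<xi> j \<omega>))) \<le> D"
    proof (rule AE_I2)
      fix \<omega> assume "\<omega> \<in> space M"
      then have "norm (G (\<xi> j \<omega>)) \<le> D" using that(1) measurable_space[OF \<xi>_measurable, of \<omega> j] by (simp add: B.bnd_def)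
      then have "\<bar>q (G (\<xi> j \<omega>))\<bar> \<le> D"
        using that(3) abs_Re_le_cmod[of "G (\<xi> j \<omega>)"] abs_Im_le_cmod[of "G (\<xi> j \<omega>)"] by auto
      then show "norm (p (W \<omega>) * q (G (\<xi> j \<omega>))) \<le> D"
        using mult_mono[OF b[of \<omega>], of "\<bar>q (G (\<xi> j \<omega>))\<bar>" D] by (simp add: abs_mult)
    qed
    have "G \<in> borel_measurable S" using that by (simp add: B.bnd_def)
    then show "(\<lambda>\<omega>. p (W \<omega>) * q (G (\<xi> j \<omega>))) \<in> borel_measurable M" using that(2,3) by auto
  qed
  note ii' = ii[OF F] ii[OF B.bnd_K[OF F]]
  show ?thesis
  proof (rule complex_eqI)
    show "Re (LINT \<omega>|M. W \<omega> * F (\<xi> (k + 1) \<omega>)) = Re (LINT \<omega>|M. W \<omega> * B.K F (\<xi> k \<omega>))"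
      unfolding integral_Re[OF int[OF F], symmetric] integral_Re[OF int[OF B.bnd_K[OF F]], symmetric] times_complex.simps
      using step' by (simp add: ii')
    show "Im (LINT \<omega>|M. W \<omega> * F (\<xi> (k + 1) \<omega>)) = Im (LINT \<omega>|M. W \<omega> * B.K F (\<xi> k \<omega>))"
      unfolding integral_Im[OF int[OF F], symmetric] integral_Im[OF int[OF B.bnd_K[OF F]], symmetric] times_complex.simps
      using step' by (simp add: ii')
  qed
qed

end

section \<open>Characteristic functions of the partial sums\<close>

locale stationary_markov_sum = stationary_markov +
  fixes g :: "'b \<Rightarrow> real"
  assumes g_measurable [measurable]: "g \<in> borel_measurable S"
    and g_integrable: "integrable M (\<lambda>\<omega>. g (\<xi> 0 \<omega>))" and g_mean: "(LINT \<omega>|M. g (\<xi> 0 \<omega>)) = 0"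
begin

sublocale O: kernel_observable \<pi> Q' a b g
  by unfold_locales (use g_integrable g_mean in \<open>auto simp: integrable_distr_eq integral_distr\<close>)

definition Sn :: "nat \<Rightarrow> 'a \<Rightarrow> real" where "Sn n \<omega> = (\<Sum>k=1..n. g (\<xi> (int k) \<omega>))"

lemma Sn_past: "Sn n \<in> borel_measurable (past S \<xi> (int n))"
  unfolding Sn_def[abs_def]
  by (intro borel_measurable_sum measurable_compose[OF \<xi>_past g_measurable]) auto

lemma Sn_measurable [measurable]: "Sn n \<in> borel_measurable M"
  by (rule measurable_from_subalg[OF past_subalgebra Sn_past])

text \<open>The induction removes the last summand: conditioning on the past up to n turns the test
  function \<open>F\<close> at time \<open>n + 1\<close> into \<open>P t F\<close> at time n. The
  test function therefore has to be arbitrary.\<close>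

lemma char_Sn_general:
  assumes F: "B.bnd D F"
  shows "(LINT \<omega>|M. iexp (t * Sn n \<omega>) * F (\<xi> (int n) \<omega>)) = (LINT x|\<pi>. (O.P t ^^ n) F x)"
  using F
proof (induction n arbitrary: F)
  case 0
  have "F \<in> borel_measurable S" using 0 by (simp add: B.bnd_def)
  then show ?case by (simp add: Sn_def integral_distr)
next
  case (Suc n)
  have eF: "B.bnd D (\<lambda>x. O.e t x * F x)" by (rule O.bnd_e_mult[OF Suc.prems])
  have W: "(\<lambda>\<omega>. iexp (t * Sn n \<omega>)) \<in> borel_measurable (past S \<xi> (int n))"
    using Sn_past[of n] by measurable
  have "(LINT \<omega>|M. iexp (t * Sn (Suc n) \<omega>) * F (\<xi> (int (Suc n)) \<omega>))
      = (LINT \<omega>|M. iexp (t * Sn n \<omega>) * (O.e t (\<xi> (int n + 1) \<omega>) * F (\<xi> (int n + 1) \<omega>)))"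
    by (intro Bochner_Integration.integral_cong refl)
      (simp add: Sn_def O.e_def distrib_left exp_add add.commute)
  also have "\<dots> = (LINT \<omega>|M. iexp (t * Sn n \<omega>) * O.P t F (\<xi> (int n) \<omega>))"
    unfolding O.P_def by (rule complex_step[OF W _ eF]) simp
  also have "\<dots> = (LINT x|\<pi>. (O.P t ^^ n) (O.P t F) x)"
    by (rule Suc.IH[OF O.bnd_P[OF Suc.prems]])
  finally show ?case by (simp add: funpow_swap1)
qed

lemma char_Sn: "char (distr M borel (Sn n)) t = (LINT x|\<pi>. (O.P t ^^ n) (\<lambda>_. 1) x)"
proof -
  have "B.bnd 1 (\<lambda>_. 1)" using B.bnd_const[of 1] by simp
  from char_Sn_general[OF this, of t n] show ?thesis by (simp add: char_def integral_distr)
qed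

end

subsection \<open>The local limit theorem\<close>

text \<open>If the modulus were 1, rotating by the argument \<theta> would give
  \<open>cos (t * X - \<theta>)\<close> mean 1; being at most 1, it would equal 1 almost surely,
  which puts \<open>X\<close> on a lattice of span \<open>2 * pi / |t|\<close>.\<close>

lemma (in prob_space) non_lattice_char_less_1:
  assumes [measurable]: "X \<in> borel_measurable M" and nl: "non_lattice X" and t: "t \<noteq> 0"
  shows "norm (LINT \<omega>|M. iexp (t * X \<omega>)) < 1"
proof (rule ccontr)
  define z where "z = (LINT \<omega>|M. iexp (t * X \<omega>))"
  have int: "integrable M (\<lambda>\<omega>. iexp (t * X \<omega>))" by (rule integrable_iexp) auto
  have "norm z \<le> (LINT \<omega>|M. norm (iexp (t * X \<omega>)))" unfolding z_def by (rule integral_norm_bound)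
  then have "norm z \<le> 1" by (simp add: prob_space)
  moreover assume "\<not> norm (LINT \<omega>|M. iexp (t * X \<omega>)) < 1"
  ultimately have z1: "norm z = 1" by (simp add: z_def)
  define \<theta> where "\<theta> = Arg z"
  have z: "z = cis \<theta>" using z1 rcis_cmod_Arg[of z] by (simp add: \<theta>_def rcis_def)
  have re: "Re (cis (- \<theta>) * iexp (t * X \<omega>)) = cos (t * X \<omega> - \<theta>)" for \<omega>
    by (simp only: cis_conv_exp[symmetric] cis_mult) simp
  have "(LINT \<omega>|M. cos (t * X \<omega> - \<theta>)) = Re (LINT \<omega>|M. cis (- \<theta>) * iexp (t * X \<omega>))"
    unfolding re[symmetric] using int by (intro integral_Re integrable_mult_right)
  also have "(LINT \<omega>|M. cis (- \<theta>) * iexp (t * X \<omega>)) = cis (- \<theta>) * z" unfolding z_def by (rule integral_mult_right_zero)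
  also have "\<dots> = 1" by (simp add: z cis_mult)
  finally have c1: "(LINT \<omega>|M. cos (t * X \<omega> - \<theta>)) = 1" by simp
  have ci: "integrable M (\<lambda>\<omega>. cos (t * X \<omega> - \<theta>))" by (intro integrable_const_bound[of _ 1]) auto
  have "(LINT \<omega>|M. 1 - cos (t * X \<omega> - \<theta>)) = 0" using c1 ci by (simp add: prob_space)
  then have "AE \<omega> in M. 1 - cos (t * X \<omega> - \<theta>) = 0"
    using ci by (subst (asm) integral_nonneg_eq_0_iff_AE) auto
  then have "AE \<omega> in M. X \<omega> \<in> {\<theta> / t + of_int k * (2 * pi / \<bar>t\<bar>) | k :: int. True}"
  proof eventually_elim
    case (elim \<omega>)
    then have "cos (t * X \<omega> - \<theta>) = 1" by simp
    then obtain j :: int where j: "t * X \<omega> - \<theta> = of_int j * 2 * pi" unfolding cos_one_2pi_int by auto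
    have "X \<omega> = \<theta> / t + of_int j * (2 * pi / t)" using j t by (simp add: field_simps)
    \<comment> \<open>The span of a lattice is positive, so for negative \<open>t\<close> the sign
      moves into the integer.\<close>
    also have "\<dots> = \<theta> / t + of_int (if 0 < t then j else - j) * (2 * pi / \<bar>t\<bar>)" using t by (auto simp: field_simps)
    finally show ?case by blast
  qed
  moreover have "0 < 2 * pi / \<bar>t\<bar>" using t by simp
  ultimately show False using nl unfolding non_lattice_def by blast
qed

text \<open>In \<open>ereal\<close> the supremum is meaningful for each n, and eventual bounds
  uniform in \<open>u\<close> transfer to it.\<close>

lemma SUP_ereal_tendsto_0:
  fixes F :: "nat \<Rightarrow> 'u \<Rightarrow> real"
  assumes nn: "\<And>n u. 0 \<le> F n u" and ev: "\<And>\<epsilon>. 0 < \<epsilon> \<Longrightarrow> eventually (\<lambda>n. \<forall>u. F n u \<le> \<epsilon>) sequentially"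
  shows "(\<lambda>n. SUP u. ereal (F n u)) \<longlonglongrightarrow> 0"
proof (rule order_tendstoI)
  have "0 \<le> (SUP u. ereal (F n u))" for n
    by (rule SUP_upper2[of undefined]) (auto simp: nn)
  then show "eventually (\<lambda>n. y < (SUP u. ereal (F n u))) sequentially" if "y < 0" for y
    using that by (intro always_eventually allI) (rule less_le_trans)
  show "eventually (\<lambda>n. (SUP u. ereal (F n u)) < y) sequentially" if y: "0 < y" for y
  proof -
    obtain \<epsilon> where \<epsilon>: "0 < ereal \<epsilon>" "ereal \<epsilon> < y" using ereal_dense2[OF y] by blast
    have "eventually (\<lambda>n. \<forall>u. F n u \<le> \<epsilon>) sequentially" using \<epsilon>(1) by (intro ev) simp
    then show ?thesis
    proof eventually_elim
      case (elim n)
      have "(SUP u. ereal (F n u)) \<le> ereal \<epsilon>" using elim by (intro SUP_least) simp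
      then show ?case using \<epsilon>(2) by simp
    qed
  qed
qed

theorem corollary6:
  fixes M :: "'w measure" and S :: "'s measure"
    and \<xi> :: "int \<Rightarrow> 'w \<Rightarrow> 's" and Q :: "'s \<Rightarrow> 's measure" and \<pi> :: "'s measure"
    and a b :: real and S' :: "'s set" and g :: "'s \<Rightarrow> real"
    and X :: "int \<Rightarrow> 'w \<Rightarrow> real" and S_sum :: "nat \<Rightarrow> 'w \<Rightarrow> real"
  assumes prob: "prob_space M"
    and stationary: "prob_space.strictly_stationary M S \<xi>"
    and markov: "prob_space.markov_chain_with M S Q \<xi>"
    and marginal: "\<pi> = distr M S (\<xi> 0)"
    and a: "0 < a"
    and S': "S' \<in> sets S" "measure \<pi> S' = 1"
    and Q_bounds: "\<And>x A. x \<in> S' \<Longrightarrow> A \<in> sets S \<Longrightarrow>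
      a * measure \<pi> A \<le> measure (Q x) A \<and> measure (Q x) A \<le> b * measure \<pi> A"
    and g: "g \<in> borel_measurable S"
    and X: "\<And>k \<omega>. X k \<omega> = g (\<xi> k \<omega>)"
    and S_sum: "\<And>n \<omega>. S_sum n \<omega> = (\<Sum>k=1..n. X (int k) \<omega>)"
    and mean_zero: "integrable M (X 0)" "(LINT \<omega>|M. X 0 \<omega>) = 0"
    and slow: "slowly_varying
      (\<lambda>x. LINT \<omega>|M. (X 0 \<omega>)\<^sup>2 * indicator {\<omega>. \<bar>X 0 \<omega>\<bar> \<le> x} \<omega>)"
    and non_lattice: "prob_space.non_lattice M (X 0)"
  shows "\<exists>bn :: nat \<Rightarrow> real. filterlim bn at_top sequentially \<and>
    (\<forall>h :: real \<Rightarrow> real. continuous_on UNIV h \<longrightarrow> compact (closure {x. h x \<noteq> 0}) \<longrightarrow>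
      (\<lambda>n. SUP u. ereal \<bar>sqrt (2 * pi) * bn n * (LINT \<omega>|M. h (S_sum n \<omega> - u))
                          - exp (- (u\<^sup>2 / (2 * (bn n)\<^sup>2))) * (LINT x|lborel. h x)\<bar>)
        \<longlonglongrightarrow> 0)"
proof -
  have X0: "X 0 = (\<lambda>\<omega>. g (\<xi> 0 \<omega>))" by (rule ext) (rule X)
  interpret prob_space M by (rule prob)
  interpret C: stationary_markov_sum M S \<xi> Q a b S' g
    using stationary markov a S' Q_bounds g mean_zero unfolding marginal X0
    by unfold_locales auto
  have trunc: "truncated_moment (distr C.\<pi> borel g)
      = (\<lambda>x. LINT \<omega>|M. (X 0 \<omega>)\<^sup>2 * indicator {\<omega>. \<bar>X 0 \<omega>\<bar> \<le> x} \<omega>)"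
    unfolding truncated_moment_def X0 by (rule ext) (simp add: integral_distr distr_distr indicator_def comp_def)
  interpret K: slowly_varying_kernel C.\<pi> C.Q' a b g
  proof
    show "slowly_varying (truncated_moment (distr C.\<pi> borel g))" unfolding trunc by (rule slow)
    fix t :: real assume t: "t \<noteq> 0"
    have "X 0 \<in> borel_measurable M" unfolding X0 by simp
    from non_lattice_char_less_1[OF this non_lattice t]
    show "norm (C.O.\<phi> t) < 1" by (simp add: X0 C.O.\<phi>_def C.O.e_def integral_distr)
  qed
  have Sn: "S_sum n = C.Sn n" for n by (rule ext) (simp add: S_sum X C.Sn_def)
  define \<mu> where "\<mu> n = distr M borel (C.Sn n)" for n
  have \<mu>: "real_distribution (\<mu> n)" for n unfolding \<mu>_def by (rule real_distribution_distr) simp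
  have "char (\<mu> n) t = K.f n t" for n t unfolding \<mu>_def K.f_def by (rule C.char_Sn)
  \<comment> \<open>The sequence is chosen before \<open>h\<close>, so one norming works for all
    test functions.\<close>
  then obtain bn where bn: "filterlim bn at_top sequentially"
    and err: "\<And>T. 0 < T \<Longrightarrow> (\<lambda>n. char_error (\<mu> n) (bn n) T) \<longlonglongrightarrow> 0"
    using K.char_error_limit \<mu> by blast
  show ?thesis
  proof (intro exI[of _ bn] conjI allI impI bn)
    fix h :: "real \<Rightarrow> real"
    assume h: "continuous_on UNIV h" "compact (closure {x. h x \<noteq> 0})"
    have hm [measurable]: "h \<in> borel_measurable borel" using h(1) by (rule borel_measurable_continuous_onI)
    have E: "(LINT \<omega>|M. h (S_sum n \<omega> - u)) = (LINT x|\<mu> n. h (x - u))" for n u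
      unfolding \<mu>_def Sn by (simp add: integral_distr)
    show "(\<lambda>n. SUP u. ereal \<bar>sqrt (2 * pi) * bn n * (LINT \<omega>|M. h (S_sum n \<omega> - u))
                          - exp (- (u\<^sup>2 / (2 * (bn n)\<^sup>2))) * (LINT x|lborel. h x)\<bar>) \<longlonglongrightarrow> 0"
      unfolding E by (intro SUP_ereal_tendsto_0 local_limit_criterion[OF \<mu> bn err h]) auto
  qed
qed

end
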